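(* The space $\mathfrak D_0^\perp$ is infinite dimensional, it is the $L^2$-orthogonal complement of $\mathfrak D_0$ in $\mathfrak D$ (so $\mathfrak D=\mathfrak D_0\oplus\mathfrak D_0^\perp$), every $\dot\varphi\in\mathfrak D_0^\perp$ solves the linearized obstruction flatness equation $D\mathcal O(\dot\varphi)=0$, and no nonzero element of $\mathfrak D_0^\perp$ is a trivial infinitesimal deformation, i.e. of the form $iZ_1^2f$ with $f\in C^\infty(S^3,\mathbb R)$.
   Context: Let $S^3=\{(z,w)\in\mathbb C^2:|z|^2+|w|^2=1\}$ with standard contact form $\theta=-i(\bar z\,dz+\bar w\,dw)|_{TS^3}$, $Z_1=\bar w\,\partial_z-\bar z\,\partial_w$, $Z_{\bar1}=\overline{Z_1}$, Reeb field $T=i(z\partial_z+w\partial_w)-i(\bar z\partial_{\bar z}+\bar w\partial_{\bar w})$; $L^2=L^2(S^3,\theta\wedge d\theta)$. Spherical harmonics: $H_{p,q}$ ($p,q\ge0$) is the space of restrictions to $S^3$ of harmonic polynomials on $\mathbb C^2$ homogeneous of degree $p$ in $(z,w)$ and $q$ in $(\bar z,\bar w)$; $L^2=\bigoplus H_{p,q}$ orthogonally and $u_{p,q}$ denotes the $H_{p,q}$-component. Let $\mathfrak D=C^\infty(S^3,\mathbb C)$ (infinitesimal deformation tensors of the standard CR structure, the deformed $(1,0)$-bundle being spanned by $Z_1+\varphi Z_{\bar1}$ with the contact distribution fixed); $\mathfrak D_0=\{\varphi:\varphi_{p,q}=0\text{ for }q\in\{0,1\}\}$ (the tangent space at the standard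 structure to the embeddable deformations); $\mathfrak D_0^\perp=\{\varphi:\varphi_{p,q}=0\text{ unless }q\in\{0,1\}\}$. Linearized operators: $D\mathcal Q$ is the real-linear operator $D\mathcal Q(\dot\varphi)=\frac16Z_1^2Z_{\bar1}^2\dot\varphi+\frac16Z_1^4\overline{\dot\varphi}-(T+4i)^2\dot\varphi-\frac{2i}3Z_1Z_{\bar1}(T+4i)\dot\varphi+i(T+4i)\dot\varphi$ (operator compositions), which is the linearization at $\varphi=0$ of the map sending a deformation tensor $\varphi$ to the component $\tilde Q_1{}^{\bar1}$ of the Cartan umbilical tensor of the deformed structure (w.r.t. $\theta$ and the coframe dual to $(T,Z_1+\varphi Z_{\bar1},\overline{Z_1+\varphi Z_{\bar1}})$). $D\mathcal O=Z_{\bar1}^2D\mathcal Q$ is the linearization at $0$ of the map $\varphi\mapsto\mathcal O(\varphi)$ sending a deformation tensor to the CR obstruction density of the deformed structure computed w.r.t. $\theta$. *)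

theory Defs
  imports "HOL-Analysis.Analysis"
begin

text \<open>Points of C^2 are pairs (z,w); the norm on complex \<times> complex is sqrt(|z|^2+|w|^2).
  Functions on S^3 are represented by functions on C^2; only their values on S^3 matter.\<close>

type_synonym pt = "complex \<times> complex"

definition S3 :: "pt set" where
  "S3 = {x. norm x = 1}"

definition hext :: "(pt \<Rightarrow> complex) \<Rightarrow> pt \<Rightarrow> complex" where
  "hext f x = f (scaleR (1 / norm x) x)"

definition dz :: "(pt \<Rightarrow> complex) \<Rightarrow> pt \<Rightarrow> complex" where
  "dz F x = (frechet_derivative F (at x) (1,0) - \<i> * frechet_derivative F (at x) (\<i>,0)) / 2"
definition dzb :: "(pt \<Rightarrow> complex) \<Rightarrow> pt \<Rightarrow> complex" where
  "dzb F x = (frechet_derivative F (at x) (1,0) + \<i> * frechet_derivative F (at x) (\<i>,0)) / 2"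
definition dw :: "(pt \<Rightarrow> complex) \<Rightarrow> pt \<Rightarrow> complex" where
  "dw F x = (frechet_derivative F (at x) (0,1) - \<i> * frechet_derivative F (at x) (0,\<i>)) / 2"
definition dwb :: "(pt \<Rightarrow> complex) \<Rightarrow> pt \<Rightarrow> complex" where
  "dwb F x = (frechet_derivative F (at x) (0,1) + \<i> * frechet_derivative F (at x) (0,\<i>)) / 2"

primrec Ck :: "nat \<Rightarrow> pt set \<Rightarrow> (pt \<Rightarrow> complex) \<Rightarrow> bool" where
  "Ck 0 U F = continuous_on U F"
| "Ck (Suc k) U F = ((\<forall>x\<in>U. F differentiable (at x)) \<and>
      (\<forall>v. Ck k U (\<lambda>x. frechet_derivative F (at x) v)))"

definition smooth_S3 :: "(pt \<Rightarrow> complex) \<Rightarrow> bool" where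
  "smooth_S3 f \<longleftrightarrow> (\<forall>k. Ck k (UNIV - {0}) (hext f))"

definition Dspace :: "(pt \<Rightarrow> complex) set" where
  "Dspace = {\<phi>. smooth_S3 \<phi>}"

text \<open>L^2 inner product; by polar coordinates, integration over S^3 against \<theta>\<and>d\<theta>
  (a constant multiple of surface measure) is a constant multiple of integration of the
  homogeneous extension over the unit ball.\<close>
definition L2ip :: "(pt \<Rightarrow> complex) \<Rightarrow> (pt \<Rightarrow> complex) \<Rightarrow> complex" where
  "L2ip f g = set_lebesgue_integral lborel (ball 0 1) (\<lambda>x. hext f x * cnj (hext g x))"

definition bihom :: "nat \<Rightarrow> nat \<Rightarrow> (nat \<Rightarrow> nat \<Rightarrow> complex) \<Rightarrow> pt \<Rightarrow> complex" where
  "bihom p q cf x = (\<Sum>a\<le>p. \<Sum>k\<le>q. cf a k * fst x ^ a * snd x ^ (p - a)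
                        * cnj (fst x) ^ k * cnj (snd x) ^ (q - k))"

text \<open>Spherical harmonics H_{p,q}: restrictions to S^3 of harmonic bihomogeneous polynomials
  (Laplacian = 4 (d_z d_zbar + d_w d_wbar)).\<close>
definition Hpq :: "nat \<Rightarrow> nat \<Rightarrow> (pt \<Rightarrow> complex) set" where
  "Hpq p q = {h. \<exists>cf. (\<forall>x. dz (dzb (bihom p q cf)) x + dw (dwb (bihom p q cf)) x = 0)
                    \<and> (\<forall>x\<in>S3. h x = bihom p q cf x)}"

text \<open>The H_{p,q}-component of \<phi> vanishes iff \<phi> is L^2-orthogonal to H_{p,q}.\<close>
definition comp_zero :: "nat \<Rightarrow> nat \<Rightarrow> (pt \<Rightarrow> complex) \<Rightarrow> bool" where
  "comp_zero p q \<phi> \<longleftrightarrow> (\<forall>h\<in>Hpq p q. L2ip \<phi> h = 0)"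

definition D0 :: "(pt \<Rightarrow> complex) set" where
  "D0 = {\<phi>\<in>Dspace. \<forall>p q. q \<in> {0,1} \<longrightarrow> comp_zero p q \<phi>}"

definition D0perp :: "(pt \<Rightarrow> complex) set" where
  "D0perp = {\<phi>\<in>Dspace. \<forall>p q. q \<notin> {0,1} \<longrightarrow> comp_zero p q \<phi>}"

definition Z1 :: "(pt \<Rightarrow> complex) \<Rightarrow> pt \<Rightarrow> complex" where
  "Z1 f x = cnj (snd x) * dz (hext f) x - cnj (fst x) * dw (hext f) x"

definition Z1b :: "(pt \<Rightarrow> complex) \<Rightarrow> pt \<Rightarrow> complex" where
  "Z1b f x = snd x * dzb (hext f) x - fst x * dwb (hext f) x"

definition Treeb :: "(pt \<Rightarrow> complex) \<Rightarrow> pt \<Rightarrow> complex" where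
  "Treeb f x = \<i> * (fst x * dz (hext f) x + snd x * dw (hext f) x)
             - \<i> * (cnj (fst x) * dzb (hext f) x + cnj (snd x) * dwb (hext f) x)"

definition Tp :: "(pt \<Rightarrow> complex) \<Rightarrow> pt \<Rightarrow> complex" where
  "Tp f x = Treeb f x + 4 * \<i> * f x"

definition DQ :: "(pt \<Rightarrow> complex) \<Rightarrow> pt \<Rightarrow> complex" where
  "DQ \<phi> x = 1/6 * Z1 (Z1 (Z1b (Z1b \<phi>))) x
           + 1/6 * Z1 (Z1 (Z1 (Z1 (\<lambda>y. cnj (\<phi> y))))) x
           - Tp (Tp \<phi>) x
           - (2 * \<i> / 3) * Z1 (Z1b (Tp \<phi>)) x
           + \<i> * Tp \<phi> x"

definition DO :: "(pt \<Rightarrow> complex) \<Rightarrow> pt \<Rightarrow> complex" where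
  "DO \<phi> = Z1b (Z1b (DQ \<phi>))"

end

theory Submission
  imports Defs
begin

text \<open>
  All identities are obtained by duality from identities for spherical harmonics. The fields \<open>Z1\<close> and \<open>Z1b\<close>
  are, up to sign, adjoint to each other, because their real and imaginary parts generate isometries; they
  map \<open>H_{p,q}\<close> to \<open>H_{p-1,q+1}\<close> and \<open>H_{p+1,q-1}\<close>, and \<open>Z1 Z1b = -q(p+1)\<close> on \<open>H_{p,q}\<close>. Hence the
  \<open>H_{p,q}\<close> with \<open>q \<ge> 2\<close> lie in the range of \<open>Z1\<^sup>2\<close>, those with \<open>q \<le> 1\<close> in the kernel of \<open>Z1b\<^sup>2\<close>, and the
  pairing of \<open>DO \<phi>\<close> with a spherical harmonic reduces to pairings of \<open>\<phi>\<close> with components \<open>q \<ge> 2\<close>; so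
  \<open>DO \<phi> = 0\<close> on \<open>D0perp\<close> by completeness of the spherical harmonics (Stone-Weierstrass).

  The delicate point is that the \<open>D0perp\<close>-part of a smooth function is smooth. With the kernel
  \<open>\<Sum>p. r p * \<langle>x,y\<rangle>^p\<close> (a weighted Szego kernel) one builds smooth functions \<open>S\<^sub>r \<phi>\<close> whose components are
  \<open>r p * \<phi>\<^sub>p\<^sub>,\<^sub>0\<close>: the moments of \<open>\<phi>\<close> decay rapidly since the Reeb field acts on them as \<open>i p\<close>, and the class of
  these series is closed under differentiation. The \<open>D0perp\<close>-part of \<open>\<phi>\<close> is then \<open>S\<^sub>1 \<phi> + Z1 (S\<^sub>r (Z1b \<phi>))\<close>
  with \<open>r p = -1/p\<close>, by the eigenvalue formula for \<open>q = 1\<close>.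
\<close>

section \<open>Smooth functions on the punctured plane\<close>

text \<open>No function is ever expanded into spherical harmonics: a component is known only through
  its pairings, and a pairing is computed by moving the fields onto the polynomial side, where they
  act by explicit algebra. Two points are not formal. The first is the antilinear term of
  \<open>DQ\<close>, four times \<open>Z1\<close> applied to the conjugate of \<phi>. Moving it onto
  a harmonic of bidegree (p, q) conjugates the result, and conjugation swaps the indices: \<phi> is
  paired with bidegree (q - 4, p + 4), whose second index is at least 2 for every p and q. So this
  term, too, sees only components that vanish on \<open>D0perp\<close>. The second is that
  \<open>D0\<close> and \<open>D0perp\<close> are both described by orthogonality to harmonics, not
  as closures of spans, so their mutual orthogonality is not immediate. It needs density in
  quantitative form, with the approximating sum split according to q.\<close>

declare split_paired_All [simp del] split_paired_Ex [simp del]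

lemma Ck_cong:
  assumes "open U" "\<And>x. x \<in> U \<Longrightarrow> F x = G x"
  shows "Ck k U F \<longleftrightarrow> Ck k U G"
  using assms(2)
proof (induction k arbitrary: F G)
  case 0
  then show ?case by (auto cong: continuous_on_cong)
next
  case (Suc k)
  have d: "(F differentiable at x) = (G differentiable at x)" if "x \<in> U" for x
    using that Suc.prems assms(1) unfolding differentiable_def
    by (metis has_derivative_transform_within_open)
  have fd: "frechet_derivative F (at x) = frechet_derivative G (at x)"
    if "x \<in> U" "F differentiable at x" for x
    using frechet_derivative_transform_within_open[OF that(2) assms(1) that(1) Suc.prems] .
  show ?case
  proof (cases "\<forall>x\<in>U. F differentiable at x")
    case True
    then have "Ck k U (\<lambda>x. frechet_derivative F (at x) v) \<longleftrightarrow>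
               Ck k U (\<lambda>x. frechet_derivative G (at x) v)" for v
      by (intro Suc.IH) (simp add: fd)
    then show ?thesis using True d by simp
  qed (use d in auto)
qed

text \<open>Lets the derivative be supplied in any explicit form, so that smoothness of a whole
  family follows by induction once its derivatives are expressed through the family.\<close>

lemma Ck_SucI:
  assumes "open U" "\<And>x. x \<in> U \<Longrightarrow> (F has_derivative F' x) (at x)" "\<And>v. Ck k U (\<lambda>x. F' x v)"
  shows "Ck (Suc k) U F"
proof -
  have "frechet_derivative F (at x) = F' x" if "x \<in> U" for x
    using frechet_derivative_at[OF assms(2)[OF that]] by simp
  then have "Ck k U (\<lambda>x. frechet_derivative F (at x) v) \<longleftrightarrow> Ck k U (\<lambda>x. F' x v)" for v
    by (intro Ck_cong[OF assms(1)]) simp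
  moreover have "F differentiable at x" if "x \<in> U" for x
    using assms(2)[OF that] by (rule differentiableI)
  ultimately show ?thesis using assms(3) by simp
qed

lemma Ck_SucD:
  assumes "Ck (Suc k) U F"
  shows "x \<in> U \<Longrightarrow> (F has_derivative frechet_derivative F (at x)) (at x)"
    and "Ck k U (\<lambda>x. frechet_derivative F (at x) v)"
  using assms by (simp_all add: frechet_derivative_works)

lemma Ck_pred: "Ck (Suc k) U F \<Longrightarrow> Ck k U F"
proof (induction k arbitrary: F)
  case 0
  then show ?case
    by (auto intro!: continuous_at_imp_continuous_on differentiable_imp_continuous_within)
qed simp

lemma Ck_const: "Ck k U (\<lambda>x. c)"
  by (induction k arbitrary: c) (simp_all add: frechet_derivative_const)

lemma Ck_add:
  assumes "open U" "Ck k U F" "Ck k U G"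
  shows "Ck k U (\<lambda>x. F x + G x)"
  using assms(2,3)
proof (induction k arbitrary: F G)
  case (Suc k)
  show ?case
    by (rule Ck_SucI[OF assms(1) has_derivative_add[OF Ck_SucD(1)[OF Suc.prems(1)] Ck_SucD(1)[OF Suc.prems(2)]]])
       (auto intro!: Suc.IH Ck_SucD(2) Suc.prems)
qed (auto intro!: continuous_intros)

lemma Ck_linear:
  assumes "open U" "bounded_linear L" "Ck k U F"
  shows "Ck k U (\<lambda>x. L (F x))"
  using assms(3)
proof (induction k arbitrary: F)
  case 0
  then show ?case using assms(2) by (auto intro: bounded_linear.continuous_on)
next
  case (Suc k)
  show ?case
    by (rule Ck_SucI[OF assms(1) bounded_linear.has_derivative[OF assms(2) Ck_SucD(1)[OF Suc.prems]]])
       (auto intro!: Suc.IH Ck_SucD(2) Suc.prems)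
qed

lemma Ck_mult:
  assumes "open U" "Ck k U F" "Ck k U G"
  shows "Ck k U (\<lambda>x. F x * G x)"
  using assms(2,3)
proof (induction k arbitrary: F G)
  case (Suc k)
  show ?case
    by (rule Ck_SucI[OF assms(1) has_derivative_mult[OF Ck_SucD(1)[OF Suc.prems(1)] Ck_SucD(1)[OF Suc.prems(2)]]])
       (intro Ck_add assms(1) Suc.IH Ck_SucD(2) Suc.prems Ck_pred[OF Suc.prems(1)] Ck_pred[OF Suc.prems(2)] | assumption)+
qed (auto intro!: continuous_intros)

lemma Ck_bounded_linear:
  assumes "open U" "bounded_linear L"
  shows "Ck k U L"
proof (cases k)
  case 0
  then show ?thesis using assms by (simp add: linear_continuous_on)
next
  case (Suc j)
  show ?thesis unfolding Suc
    by (rule Ck_SucI[OF assms(1) bounded_linear_imp_has_derivative[OF assms(2)] Ck_const])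
qed

text \<open>The derivative in direction \<open>v\<close> is \<open>- (x \<bullet> v)\<close> times
  the cube of the function itself, so the induction closes.\<close>

lemma Ck_inverse_norm:
  "Ck k (UNIV - {0}) (\<lambda>x. complex_of_real (1 / norm x))"
proof (induction k)
  case 0
  then show ?case by (auto intro!: continuous_intros)
next
  case (Suc k)
  let ?r = "\<lambda>x::pt. complex_of_real (1 / norm x)"
  have o: "open (UNIV - {0::pt})" by auto
  have d: "(?r has_derivative (\<lambda>v. complex_of_real (- (x \<bullet> v)) * (?r x * (?r x * ?r x)))) (at x)"
    if "x \<in> UNIV - {0}" for x
    using that
  proof -
    have "(norm has_derivative (\<lambda>v. v \<bullet> sgn x)) (at x)"
      using that has_derivative_norm[of x] by simp
    then show ?thesis using that
      by (auto intro!: derivative_eq_intros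
          simp: sgn_div_norm power2_eq_square divide_simps inner_commute simp flip: of_real_mult)
  qed
  show ?case
  proof (rule Ck_SucI[OF o d])
    fix v :: pt
    have "bounded_linear (\<lambda>x::pt. complex_of_real (- (x \<bullet> v)))"
      by (intro bounded_linear_compose[OF bounded_linear_of_real] bounded_linear_minus
          bounded_linear_inner_left)
    then show "Ck k (UNIV - {0}) (\<lambda>x. complex_of_real (- (x \<bullet> v)) * (?r x * (?r x * ?r x)))"
      by (intro Ck_mult o Suc Ck_bounded_linear)
  qed auto
qed

lemma open_punctured: "open (UNIV - {0::pt})"
  by auto

lemma S3_nonzero: "x \<in> S3 \<Longrightarrow> x \<noteq> 0"
  by (auto simp: S3_def)

lemma normalize_in_S3: "x \<noteq> 0 \<Longrightarrow> scaleR (1 / norm x) x \<in> S3"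
  by (simp add: S3_def)

lemma S3_iff: "x \<in> S3 \<longleftrightarrow> fst x * cnj (fst x) + snd x * cnj (snd x) = 1"
proof -
  have "fst x * cnj (fst x) + snd x * cnj (snd x) = complex_of_real ((norm x)\<^sup>2)"
    by (simp only: complex_norm_square[symmetric] of_real_add[symmetric] norm_prod_def)
      (simp add: real_sqrt_pow2)
  moreover have "complex_of_real ((norm x)\<^sup>2) = 1 \<longleftrightarrow> norm x = 1"
    using norm_ge_zero[of x] by (simp only: of_real_eq_1_iff power2_eq_1_iff) linarith
  ultimately show ?thesis by (simp add: S3_def)
qed

lemma hext_S3: "x \<in> S3 \<Longrightarrow> hext f x = f x"
  by (simp add: hext_def S3_def)

lemma hext_scaleR: "r > 0 \<Longrightarrow> hext f (r *\<^sub>R x) = hext f x"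
  by (simp add: hext_def)

lemma hext_cong: "(\<And>y. y \<in> S3 \<Longrightarrow> f y = g y) \<Longrightarrow> x \<noteq> 0 \<Longrightarrow> hext f x = hext g x"
  unfolding hext_def using normalize_in_S3 by blast

lemma smooth_S3_cong:
  assumes "\<And>y. y \<in> S3 \<Longrightarrow> f y = g y"
  shows "smooth_S3 f \<longleftrightarrow> smooth_S3 g"
proof -
  have "Ck k (UNIV - {0}) (hext f) \<longleftrightarrow> Ck k (UNIV - {0}) (hext g)" for k
    by (rule Ck_cong[OF open_punctured hext_cong[OF assms]]) auto
  then show ?thesis by (simp add: smooth_S3_def)
qed

lemma smooth_S3_const: "smooth_S3 (\<lambda>x. c)"
  by (simp add: smooth_S3_def hext_def[abs_def] Ck_const)

lemma smooth_S3_add: "smooth_S3 f \<Longrightarrow> smooth_S3 g \<Longrightarrow> smooth_S3 (\<lambda>x. f x + g x)"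
  unfolding smooth_S3_def using Ck_add[OF open_punctured, of _ "hext f" "hext g"] by (simp add: hext_def[abs_def])

lemma smooth_S3_mult: "smooth_S3 f \<Longrightarrow> smooth_S3 g \<Longrightarrow> smooth_S3 (\<lambda>x. f x * g x)"
  unfolding smooth_S3_def using Ck_mult[OF open_punctured, of _ "hext f" "hext g"] by (simp add: hext_def[abs_def])

lemma smooth_S3_linear: "bounded_linear L \<Longrightarrow> smooth_S3 f \<Longrightarrow> smooth_S3 (\<lambda>x. L (f x))"
  unfolding smooth_S3_def using Ck_linear[OF open_punctured, of L _ "hext f"] by (simp add: hext_def[abs_def])

lemma smooth_S3_cnj: "smooth_S3 f \<Longrightarrow> smooth_S3 (\<lambda>x. cnj (f x))"
  by (rule smooth_S3_linear[OF bounded_linear_cnj])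

lemma smooth_S3_coordinate:
  assumes "bounded_linear L"
  shows "smooth_S3 L"
proof -
  have "hext L x = complex_of_real (1 / norm x) * L x" for x
    unfolding hext_def using linear_cmul[OF bounded_linear.linear[OF assms]]
    by (simp add: scaleR_conv_of_real)
  then have "hext L = (\<lambda>x. complex_of_real (1 / norm x) * L x)" by blast
  then show ?thesis unfolding smooth_S3_def
    by (intro allI) (simp only: Ck_mult Ck_inverse_norm Ck_bounded_linear assms open_punctured)
qed

lemma smooth_S3_diff: "smooth_S3 f \<Longrightarrow> smooth_S3 g \<Longrightarrow> smooth_S3 (\<lambda>x. f x - g x)"
  using smooth_S3_add[OF _ smooth_S3_linear[OF bounded_linear_minus[OF bounded_linear_ident]], of f g]
  by simp

lemma smooth_S3_power: "smooth_S3 f \<Longrightarrow> smooth_S3 (\<lambda>x. f x ^ n)"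
  by (induction n) (simp_all add: smooth_S3_const smooth_S3_mult)

lemma smooth_S3_sum: "finite A \<Longrightarrow> (\<And>a. a \<in> A \<Longrightarrow> smooth_S3 (f a)) \<Longrightarrow> smooth_S3 (\<lambda>x. \<Sum>a\<in>A. f a x)"
  by (induction A rule: finite_induct) (simp_all add: smooth_S3_const smooth_S3_add)

lemmas smooth_S3_fst = smooth_S3_coordinate[OF bounded_linear_fst]
lemmas smooth_S3_snd = smooth_S3_coordinate[OF bounded_linear_snd]

lemmas smooth_S3_intros = smooth_S3_const smooth_S3_add smooth_S3_mult smooth_S3_cnj smooth_S3_diff
  smooth_S3_power smooth_S3_fst smooth_S3_snd smooth_S3_sum

lemma smooth_S3_has_derivative:
  "smooth_S3 f \<Longrightarrow> x \<noteq> 0 \<Longrightarrow> (hext f has_derivative frechet_derivative (hext f) (at x)) (at x)"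
  unfolding smooth_S3_def by (rule Ck_SucD(1)[of 0 "UNIV - {0}"]) auto

text \<open>\<open>hext f\<close> is homogeneous of degree 0, hence its differential is homogeneous
  of degree -1; scaling the direction together with the base point compensates for this.\<close>

lemma frechet_derivative_hext_scaleR:
  assumes "smooth_S3 f" "x \<noteq> 0" "r > 0"
  shows "frechet_derivative (hext f) (at (r *\<^sub>R x)) (r *\<^sub>R v) = frechet_derivative (hext f) (at x) v"
proof -
  have "((\<lambda>y. hext f (r *\<^sub>R y)) has_derivative
        (\<lambda>v. frechet_derivative (hext f) (at (r *\<^sub>R x)) (r *\<^sub>R v))) (at x)"
    by (rule has_derivative_compose[OF _ smooth_S3_has_derivative[OF assms(1)]])
       (use assms in \<open>auto intro!: derivative_eq_intros\<close>)
  then have "(hext f has_derivative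
        (\<lambda>v. frechet_derivative (hext f) (at (r *\<^sub>R x)) (r *\<^sub>R v))) (at x)"
    using assms(3) by (simp add: hext_scaleR)
  from has_derivative_unique[OF this smooth_S3_has_derivative[OF assms(1,2)]]
  show ?thesis by metis
qed

lemma real_linear_C2_expand:
  fixes D :: "pt \<Rightarrow> complex"
  assumes "linear D"
  shows "D v = of_real (Re (fst v)) * D (1,0) + of_real (Im (fst v)) * D (\<i>,0)
             + of_real (Re (snd v)) * D (0,1) + of_real (Im (snd v)) * D (0,\<i>)"
proof -
  have "v = Re (fst v) *\<^sub>R (1,0) + Im (fst v) *\<^sub>R (\<i>,0) + Re (snd v) *\<^sub>R (0,1) + Im (snd v) *\<^sub>R (0,\<i>)"
    by (simp add: prod_eq_iff complex_eq_iff)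
  then have "D v = D (Re (fst v) *\<^sub>R (1,0) + Im (fst v) *\<^sub>R (\<i>,0) + Re (snd v) *\<^sub>R (0,1) + Im (snd v) *\<^sub>R (0,\<i>))"
    by (rule arg_cong)
  also have "\<dots> = of_real (Re (fst v)) * D (1,0) + of_real (Im (fst v)) * D (\<i>,0)
             + of_real (Re (snd v)) * D (0,1) + of_real (Im (snd v)) * D (0,\<i>)"
    by (simp only: linear_add[OF assms] linear_cmul[OF assms] scaleR_conv_of_real)
  finally show ?thesis .
qed

lemma wirtinger_expand:
  assumes "F differentiable at x"
  shows "frechet_derivative F (at x) v =
     dz F x * fst v + dzb F x * cnj (fst v) + dw F x * snd v + dwb F x * cnj (snd v)"
proof -
  let ?D = "frechet_derivative F (at x)"
  have l: "linear ?D" by (rule linear_frechet_derivative[OF assms])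
  obtain a b a' b' where v: "v = (Complex a b, Complex a' b')"
    by (metis complex_surj surj_pair)
  show ?thesis
    unfolding real_linear_C2_expand[OF l, of v] dz_def dzb_def dw_def dwb_def
    unfolding v by (simp add: Complex_eq algebra_simps add_divide_distrib diff_divide_distrib)
qed

section \<open>The fields as derivatives along linear vector fields\<close>

definition Dir :: "(pt \<Rightarrow> pt) \<Rightarrow> (pt \<Rightarrow> complex) \<Rightarrow> pt \<Rightarrow> complex" where
  "Dir M f x = frechet_derivative (hext f) (at x) (M x)"

text \<open>Degree -1 of the differential and degree 1 of the direction cancel, so
  \<open>Dir M f\<close> is constant on rays and is its own extension. This is what allows the
  fields to be iterated.\<close>

lemma hext_Dir:
  assumes "smooth_S3 f" "linear M" "x \<noteq> 0"
  shows "hext (Dir M f) x = Dir M f x"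
  using frechet_derivative_hext_scaleR[OF assms(1,3), of "1 / norm x" "M x"] assms(3)
    linear_cmul[OF assms(2), of "1 / norm x" x]
  by (simp add: hext_def Dir_def)

lemma Ck_Dir:
  assumes "smooth_S3 f" "linear M"
  shows "Ck k (UNIV - {0}) (Dir M f)"
proof -
  let ?D = "\<lambda>v x. frechet_derivative (hext f) (at x) v"
  have e: "Dir M f x = of_real (Re (fst (M x))) * ?D (1,0) x + of_real (Im (fst (M x))) * ?D (\<i>,0) x
             + of_real (Re (snd (M x))) * ?D (0,1) x + of_real (Im (snd (M x))) * ?D (0,\<i>) x"
    if "x \<in> UNIV - {0}" for x
    unfolding Dir_def
    using has_derivative_linear[OF smooth_S3_has_derivative[OF assms(1)]] that
    by (intro real_linear_C2_expand) auto
  have M: "bounded_linear M" using assms(2) by (simp add: linear_conv_bounded_linear)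
  have D: "Ck k (UNIV - {0}) (?D v)" for v
    using assms(1) Ck_SucD(2) unfolding smooth_S3_def by blast
  have b: "bounded_linear (\<lambda>x. complex_of_real (Re (fst (M x))))"
       "bounded_linear (\<lambda>x. complex_of_real (Im (fst (M x))))"
       "bounded_linear (\<lambda>x. complex_of_real (Re (snd (M x))))"
       "bounded_linear (\<lambda>x. complex_of_real (Im (snd (M x))))"
    by (intro bounded_linear_compose[OF bounded_linear_of_real] bounded_linear_compose[OF bounded_linear_Re]
        bounded_linear_compose[OF bounded_linear_Im] bounded_linear_compose[OF bounded_linear_fst]
        bounded_linear_compose[OF bounded_linear_snd] M)+
  show ?thesis
    by (subst Ck_cong[OF open_punctured e], assumption, intro Ck_add Ck_mult open_punctured D Ck_bounded_linear b)
qed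

lemma smooth_S3_Dir:
  assumes "smooth_S3 f" "linear M"
  shows "smooth_S3 (Dir M f)"
  unfolding smooth_S3_def
proof
  fix k
  have "Ck k (UNIV - {0}) (hext (Dir M f)) \<longleftrightarrow> Ck k (UNIV - {0}) (Dir M f)"
    by (rule Ck_cong[OF open_punctured]) (simp add: hext_Dir[OF assms])
  then show "Ck k (UNIV - {0}) (hext (Dir M f))" using Ck_Dir[OF assms] by simp
qed

text \<open>Three anticommuting complex structures, as for the quaternion units: \<open>M1\<close>
  and \<open>M2\<close> are the real directions behind \<open>Z1\<close> and \<open>Z1b\<close>, and
  \<open>M0\<close> is the Reeb direction. Each is an isometry with square -1 and tangent to the
  sphere.\<close>

definition "M1 x = (cnj (snd x), - cnj (fst x))"
definition "M2 x = (\<i> * cnj (snd x), - (\<i> * cnj (fst x)))"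
definition "M0 x = (\<i> * fst x, \<i> * snd x)"

lemma linear_M: "linear M1" "linear M2" "linear M0"
  unfolding M1_def[abs_def] M2_def[abs_def] M0_def[abs_def]
  by (auto intro!: linearI simp: algebra_simps scaleR_conv_of_real)

lemma fields_Dir:
  assumes "smooth_S3 f" "x \<noteq> 0"
  shows "Z1 f x = (Dir M1 f x - \<i> * Dir M2 f x) / 2"
    and "Z1b f x = (Dir M1 f x + \<i> * Dir M2 f x) / 2"
    and "Treeb f x = Dir M0 f x"
proof -
  have d: "hext f differentiable at x"
    using smooth_S3_has_derivative[OF assms] by (rule differentiableI)
  show "Z1 f x = (Dir M1 f x - \<i> * Dir M2 f x) / 2"
    and "Z1b f x = (Dir M1 f x + \<i> * Dir M2 f x) / 2"
    and "Treeb f x = Dir M0 f x"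
    unfolding Dir_def wirtinger_expand[OF d] Z1_def Z1b_def Treeb_def M1_def M2_def M0_def
    by (simp_all add: algebra_simps)
qed

lemma smooth_S3_fields:
  assumes "smooth_S3 f"
  shows "smooth_S3 (Z1 f)" "smooth_S3 (Z1b f)" "smooth_S3 (Treeb f)" "smooth_S3 (Tp f)"
proof -
  have "smooth_S3 (\<lambda>x. 1/2 * (Dir M1 f x - \<i> * Dir M2 f x))"
    "smooth_S3 (\<lambda>x. 1/2 * (Dir M1 f x + \<i> * Dir M2 f x))"
    by (intro smooth_S3_intros smooth_S3_Dir assms linear_M)+
  moreover have "smooth_S3 (Z1 f) = smooth_S3 (\<lambda>x. 1/2 * (Dir M1 f x - \<i> * Dir M2 f x))"
    "smooth_S3 (Z1b f) = smooth_S3 (\<lambda>x. 1/2 * (Dir M1 f x + \<i> * Dir M2 f x))"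
    "smooth_S3 (Treeb f) = smooth_S3 (Dir M0 f)"
    by (intro smooth_S3_cong; simp add: fields_Dir[OF assms S3_nonzero])+
  ultimately show "smooth_S3 (Z1 f)" "smooth_S3 (Z1b f)" and t: "smooth_S3 (Treeb f)"
    using smooth_S3_Dir[OF assms linear_M(3)] by simp_all
  show "smooth_S3 (Tp f)" unfolding Tp_def[abs_def]
    by (intro smooth_S3_intros t assms)
qed

lemma smooth_S3_DQ: "smooth_S3 \<phi> \<Longrightarrow> smooth_S3 (DQ \<phi>)"
  unfolding DQ_def[abs_def] by (intro smooth_S3_intros smooth_S3_fields)

section \<open>Integration over the sphere\<close>

definition sint :: "(pt \<Rightarrow> complex) \<Rightarrow> complex" where
  "sint f = set_lebesgue_integral lborel (ball 0 1) (hext f)"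

lemma L2ip_sint: "L2ip f g = sint (\<lambda>x. f x * cnj (g x))"
  by (simp add: L2ip_def sint_def hext_def[abs_def])

lemma compact_S3: "compact S3"
proof -
  have "S3 = sphere 0 1" by (auto simp: S3_def)
  show ?thesis unfolding \<open>S3 = sphere 0 1\<close> by (rule compact_sphere)
qed

lemma AE_nonzero: "AE x::pt in lborel. x \<noteq> 0"
  using AE_lborel_singleton[of "0::pt"] by simp

lemma continuous_on_hext:
  assumes "continuous_on S3 f"
  shows "continuous_on (UNIV - {0}) (hext f)"
proof -
  have "continuous_on (UNIV - {0}) (f \<circ> (\<lambda>x. scaleR (1 / norm x) x))"
  proof (rule continuous_on_compose)
    show "continuous_on (UNIV - {0}) (\<lambda>x::pt. scaleR (1 / norm x) x)"
      by (auto intro!: continuous_intros)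
    show "continuous_on ((\<lambda>x. scaleR (1 / norm x) x) ` (UNIV - {0})) f"
      by (rule continuous_on_subset[OF assms]) (use normalize_in_S3 in blast)
  qed
  then show ?thesis by (simp add: hext_def[abs_def] comp_def)
qed

lemma smooth_S3_continuous: "smooth_S3 f \<Longrightarrow> continuous_on S3 f"
proof -
  assume "smooth_S3 f"
  then have "continuous_on (UNIV - {0}) (hext f)"
    unfolding smooth_S3_def by (metis Ck.simps(1))
  then have "continuous_on S3 (hext f)"
    by (rule continuous_on_subset) (auto dest: S3_nonzero)
  then show ?thesis by (simp add: hext_S3 cong: continuous_on_cong)
qed

lemma hext_measurable:
  assumes "continuous_on S3 f"
  shows "hext f \<in> borel_measurable lborel"
proof -
  \<comment> \<open>\<open>hext f 0\<close> is the unconstrained value \<open>f 0\<close>; singling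
    out the origin leaves a function that is continuous on the complement.\<close>
  have "(\<lambda>x. if x \<in> {0} then hext f 0 else hext f x) \<in> borel_measurable borel"
    by (rule borel_measurable_continuous_on_if)
      (use continuous_on_hext[OF assms] in \<open>auto simp: Compl_eq_Diff_UNIV\<close>)
  moreover have "(\<lambda>x. if x \<in> {0} then hext f 0 else hext f x) = hext f" by auto
  ultimately show ?thesis by simp
qed

lemma indicator_hext_measurable:
  assumes "continuous_on S3 f"
  shows "(\<lambda>x. indicator (ball 0 1) x *\<^sub>R hext f x) \<in> borel_measurable lborel"
  by (intro borel_measurable_scaleR borel_measurable_indicator hext_measurable assms) auto

lemma hext_bounded:
  assumes "\<And>x. x \<in> S3 \<Longrightarrow> norm (f x) \<le> B"
  shows "AE x in lborel. norm (indicator (ball 0 1) x *\<^sub>R hext f x) \<le> B * indicator (ball 0 1) x"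
  using AE_nonzero
proof eventually_elim
  case (elim x)
  then show ?case using assms[OF normalize_in_S3[OF elim]]
    by (simp add: hext_def indicator_def)
qed

lemma integrable_ball: "integrable lborel (\<lambda>x::pt. B * indicator (ball 0 1) x :: real)"
  by (intro integrable_mult_right integrable_real_indicator) (auto simp: emeasure_lborel_ball_finite[of 0 1, simplified infinity_ennreal_def])

lemma continuous_S3_bounded:
  assumes "continuous_on S3 f"
  obtains B where "B \<ge> 0" "\<And>x. x \<in> S3 \<Longrightarrow> norm (f x) \<le> (B::real)"
proof -
  have "bounded (f ` S3)"
    by (intro compact_imp_bounded compact_continuous_image assms compact_S3)
  then show ?thesis using that by (auto simp: bounded_pos intro: less_imp_le)
qed

lemma hext_integrable:
  assumes "continuous_on S3 f"
  shows "set_integrable lborel (ball 0 1) (hext f)"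
proof -
  obtain B where B: "\<And>x. x \<in> S3 \<Longrightarrow> norm (f x) \<le> B"
    using continuous_S3_bounded[OF assms] by blast
  show ?thesis unfolding set_integrable_def
  proof (rule Bochner_Integration.integrable_bound[OF integrable_ball[of B]])
    show "(\<lambda>x. indicator (ball 0 1) x *\<^sub>R hext f x) \<in> borel_measurable lborel"
      by (rule indicator_hext_measurable[OF assms])
    show "AE x in lborel. norm (indicator (ball 0 1) x *\<^sub>R hext f x) \<le> norm (B * indicator (ball 0 1) x :: real)"
      using hext_bounded[where f=f and B=B, OF B, simplified]
    proof eventually_elim
      case (elim x)
      then show ?case by simp
    qed
  qed
qed

lemma sint_cong:
  assumes "\<And>x. x \<in> S3 \<Longrightarrow> f x = g x" "continuous_on S3 f"
  shows "sint f = sint g"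
proof -
  have "continuous_on S3 g" using assms by (simp cong: continuous_on_cong)
  note m = indicator_hext_measurable[OF assms(2)] indicator_hext_measurable[OF this]
  show ?thesis unfolding sint_def set_lebesgue_integral_def
  proof (rule integral_cong_AE)
    show "(\<lambda>x. indicator (ball 0 1) x *\<^sub>R hext f x) \<in> borel_measurable lborel"
         "(\<lambda>x. indicator (ball 0 1) x *\<^sub>R hext g x) \<in> borel_measurable lborel"
      using m .
    show "AE x in lborel. indicator (ball 0 1) x *\<^sub>R hext f x = indicator (ball 0 1) x *\<^sub>R hext g x"
      using AE_nonzero
    proof eventually_elim
      case (elim x)
      then show ?case using hext_cong[of f g x] assms(1) by simp
    qed
  qed
qed

lemma sint_add:
  assumes "continuous_on S3 f" "continuous_on S3 g"
  shows "sint (\<lambda>x. f x + g x) = sint f + sint g"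
  using set_integral_add(2)[OF hext_integrable[OF assms(1)] hext_integrable[OF assms(2)]]
  by (simp add: sint_def hext_def[abs_def])

lemma sint_cmult: "sint (\<lambda>x. c * f x) = c * sint f"
  by (simp add: sint_def hext_def[abs_def])

lemma sint_sum:
  assumes "finite A" "\<And>a. a \<in> A \<Longrightarrow> continuous_on S3 (f a)"
  shows "sint (\<lambda>x. \<Sum>a\<in>A. f a x) = (\<Sum>a\<in>A. sint (f a))"
  using assms
proof (induction A rule: finite_induct)
  case empty
  then show ?case using sint_cmult[of 0 "\<lambda>x. 0"] by simp
next
  case (insert a A)
  then show ?case by (simp add: sint_add continuous_on_sum)
qed

lemma sint_cnj: "sint (\<lambda>x. cnj (f x)) = cnj (sint f)"
proof -
  have "(\<lambda>x. indicator (ball 0 1) x *\<^sub>R hext (\<lambda>x. cnj (f x)) x) =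
        (\<lambda>x. cnj (indicator (ball 0 1) x *\<^sub>R hext f x))"
    by (auto simp: hext_def)
  then show ?thesis unfolding sint_def set_lebesgue_integral_def
    by (simp only: Bochner_Integration.integral_cnj)
qed

definition vol :: real where "vol = measure lborel (ball (0::pt) 1)"

lemma vol_pos: "vol > 0"
  by (simp add: vol_def content_ball_pos)

lemma sint_one: "sint (\<lambda>x. 1) = of_real vol"
proof -
  have "sint (\<lambda>x. 1) = of_real (set_lebesgue_integral lborel (ball (0::pt) 1) (\<lambda>x. 1))"
    unfolding sint_def hext_def set_lebesgue_integral_def
    by (subst integral_complex_of_real[symmetric]) (simp add: scaleR_conv_of_real)
  also have "set_lebesgue_integral lborel (ball (0::pt) 1) (\<lambda>x. 1::real) = vol"
    unfolding vol_def set_lebesgue_integral_def by simp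
  finally show ?thesis .
qed

lemma sint_norm_le:
  assumes "continuous_on S3 f" "\<And>x. x \<in> S3 \<Longrightarrow> norm (f x) \<le> B"
  shows "norm (sint f) \<le> B * vol"
proof -
  have "norm (sint f) \<le> (\<integral>x. B * indicator (ball (0::pt) 1) x \<partial>lborel)"
    unfolding sint_def set_lebesgue_integral_def
    by (rule order_trans[OF Bochner_Integration.integral_norm_bound
          integral_mono_AE[OF integrable_norm integrable_ball hext_bounded[OF assms(2)]]])
      (use hext_integrable[OF assms(1)] in \<open>simp add: set_integrable_def\<close>)
  also have "\<dots> = B * vol" by (simp add: vol_def)
  finally show ?thesis .
qed

lemma sint_positive_definite:
  assumes "continuous_on S3 f" "sint (\<lambda>x. f x * cnj (f x)) = 0" "x \<in> S3"
  shows "f x = 0"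
proof (rule ccontr)
  assume nz: "f x \<noteq> 0"
  let ?g = "\<lambda>x. indicator (ball 0 1) x *\<^sub>R (norm (hext f x))\<^sup>2"
  have c2: "continuous_on S3 (\<lambda>x. f x * cnj (f x))" by (intro continuous_intros assms)
  have eq: "(\<lambda>x. indicator (ball 0 1) x *\<^sub>R hext (\<lambda>x. f x * cnj (f x)) x) = (\<lambda>x. complex_of_real (?g x))"
    by (simp only: hext_def complex_norm_square[symmetric] scaleR_conv_of_real of_real_mult of_real_eq_id id_apply)
  have int: "integrable lborel (\<lambda>x. complex_of_real (?g x))"
    using hext_integrable[OF c2] unfolding set_integrable_def eq .
  then have intg: "integrable lborel ?g" using complex_of_real_integrable_eq by blast
  have "complex_of_real (integral\<^sup>L lborel ?g) = 0"
    using assms(2) unfolding sint_def set_lebesgue_integral_def eq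
    by (simp only: integral_complex_of_real)
  then have "integral\<^sup>L lborel ?g = 0" by simp
  then have ae: "AE y in lborel. ?g y = 0"
    using integral_nonneg_eq_0_iff_AE[OF intg] by simp
  \<comment> \<open>An open set that the vanishing integral forces to be null. It contains the
    midpoint of 0 and \<open>x\<close>; the factor 1/2 moves \<open>x\<close> into the open
    ball.\<close>
  define W where "W = (ball 0 1 - {0}) \<inter> hext f -` (- {0})"
  have "continuous_on (ball 0 1 - {0}) (hext f)"
    by (rule continuous_on_subset[OF continuous_on_hext[OF assms(1)]]) auto
  then have "open W" unfolding W_def
    by (intro continuous_open_preimage) auto
  moreover have "(1/2) *\<^sub>R x \<in> W"
    using nz assms(3) S3_nonzero[OF assms(3)] unfolding W_def
    by (simp add: hext_scaleR hext_S3 S3_def)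
  moreover have "negligible W"
  proof -
    have "AE y in lborel. y \<notin> W" using ae by eventually_elim (auto simp: W_def)
    then have "emeasure lborel W = 0"
      using \<open>open W\<close> by (subst (asm) AE_iff_measurable[OF _ refl]) auto
    then show ?thesis using \<open>open W\<close>
      by (simp add: negligible_iff_null_sets null_setsI)
  qed
  ultimately show False using open_not_negligible by blast
qed

section \<open>Measure-preserving maps and rotations\<close>

definition mpres :: "(pt \<Rightarrow> pt) \<Rightarrow> bool" where
  "mpres R \<longleftrightarrow> R \<in> borel_measurable borel \<and> distr lborel borel R = lborel"

lemma mpres_comp:
  assumes "mpres R" "mpres S"
  shows "mpres (\<lambda>x. R (S x))"
  using assms distr_distr[of R borel borel S lborel] by (auto simp: mpres_def comp_def)

lemma vimage_translation: "emeasure lborel ((\<lambda>z. z + (c::complex)) -` A) = emeasure lborel A" if "A \<in> sets borel"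
proof -
  have "emeasure (distr lborel borel (\<lambda>z. c + z)) A = emeasure lborel ((\<lambda>z. c + z) -` A)"
    using that by (subst emeasure_distr) auto
  moreover have "distr lborel borel (\<lambda>z. c + z) = lborel" by (rule lborel_distr_plus)
  ultimately show ?thesis by (simp add: add.commute)
qed

text \<open>By Fubini: on each slice with \<open>w\<close> fixed the map is a translation of the
  z-plane. Shears serve because a rotation is a product of three of them.\<close>

lemma mpres_shear1:
  assumes [measurable]: "g \<in> borel_measurable borel"
  shows "mpres (\<lambda>(z,w). (z + g w, w))"
proof -
  let ?T = "\<lambda>(z::complex,w::complex). (z + g w, w)"
  have T: "?T \<in> borel_measurable borel"
    by (subst borel_prod[symmetric]) measurable
  have "distr lborel borel ?T = lborel"
  proof (rule measure_eqI)
    fix A assume "A \<in> sets (distr lborel borel ?T)"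
    then have A: "A \<in> sets borel" by simp
    have A': "A \<in> sets (lborel \<Otimes>\<^sub>M lborel)" using A by (simp only: lborel_prod sets_lborel)
    have TA: "?T -` A \<in> sets (lborel \<Otimes>\<^sub>M lborel)"
      using measurable_sets[OF T A] by (simp only: lborel_prod sets_lborel space_borel Int_UNIV_right)
    have "emeasure (distr lborel borel ?T) A = emeasure (lborel \<Otimes>\<^sub>M lborel) (?T -` A)"
      using A T by (subst emeasure_distr) (auto simp: lborel_prod)
    also have "\<dots> = (\<integral>\<^sup>+ w. emeasure lborel ((\<lambda>z. (z,w)) -` (?T -` A)) \<partial>lborel)"
      by (rule lborel_pair.emeasure_pair_measure_alt2[OF TA])
    also have "\<dots> = (\<integral>\<^sup>+ w. emeasure lborel ((\<lambda>z. (z,w)) -` A) \<partial>lborel)"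
    proof (rule nn_integral_cong)
      fix w :: complex
      have "(\<lambda>z. (z,w)) -` (?T -` A) = (\<lambda>z. z + g w) -` ((\<lambda>z. (z,w)) -` A)" by auto
      moreover have "(\<lambda>z. (z,w)) -` A \<in> sets borel"
        using sets_Pair2[OF A'] by simp
      ultimately show "emeasure lborel ((\<lambda>z. (z,w)) -` (?T -` A)) = emeasure lborel ((\<lambda>z. (z,w)) -` A)"
        by (simp add: vimage_translation)
    qed
    also have "\<dots> = emeasure (lborel \<Otimes>\<^sub>M lborel) A"
      by (rule lborel_pair.emeasure_pair_measure_alt2[OF A', symmetric])
    finally show "emeasure (distr lborel borel ?T) A = emeasure lborel A" by (simp add: lborel_prod)
  qed simp
  then show ?thesis using T by (simp add: mpres_def)
qed

lemma mpres_shear2: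
  assumes [measurable]: "g \<in> borel_measurable borel"
  shows "mpres (\<lambda>(z,w). (z, w + g z))"
proof -
  let ?T = "\<lambda>(z::complex,w::complex). (z, w + g z)"
  have T: "?T \<in> borel_measurable borel"
    by (subst borel_prod[symmetric]) measurable
  have "distr lborel borel ?T = lborel"
  proof (rule measure_eqI)
    fix A assume "A \<in> sets (distr lborel borel ?T)"
    then have A: "A \<in> sets borel" by simp
    have A': "A \<in> sets (lborel \<Otimes>\<^sub>M lborel)" using A by (simp only: lborel_prod sets_lborel)
    have TA: "?T -` A \<in> sets (lborel \<Otimes>\<^sub>M lborel)"
      using measurable_sets[OF T A] by (simp only: lborel_prod sets_lborel space_borel Int_UNIV_right)
    have "emeasure (distr lborel borel ?T) A = emeasure (lborel \<Otimes>\<^sub>M lborel) (?T -` A)"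
      using A T by (subst emeasure_distr) (auto simp: lborel_prod)
    also have "\<dots> = (\<integral>\<^sup>+ z. emeasure lborel (Pair z -` (?T -` A)) \<partial>lborel)"
      by (rule lborel.emeasure_pair_measure_alt[OF TA])
    also have "\<dots> = (\<integral>\<^sup>+ z. emeasure lborel (Pair z -` A) \<partial>lborel)"
    proof (rule nn_integral_cong)
      fix z :: complex
      have "Pair z -` (?T -` A) = (\<lambda>w. w + g z) -` (Pair z -` A)" by auto
      moreover have "Pair z -` A \<in> sets borel"
        using sets_Pair1[OF A'] by simp
      ultimately show "emeasure lborel (Pair z -` (?T -` A)) = emeasure lborel (Pair z -` A)"
        by (simp add: vimage_translation)
    qed
    also have "\<dots> = emeasure (lborel \<Otimes>\<^sub>M lborel) A"
      by (rule lborel.emeasure_pair_measure_alt[OF A', symmetric])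
    finally show "emeasure (distr lborel borel ?T) A = emeasure lborel A" by (simp add: lborel_prod)
  qed simp
  then show ?thesis using T by (simp add: mpres_def)
qed

lemma sint_mpres:
  assumes "mpres R" "linear R" "\<And>x. norm (R x) = norm x" "continuous_on S3 f"
  shows "sint (\<lambda>x. f (R x)) = sint f"
proof -
  have R[measurable]: "R \<in> borel_measurable borel" and d: "distr lborel borel R = lborel"
    using assms(1) by (auto simp: mpres_def)
  have h: "hext (\<lambda>x. f (R x)) x = hext f (R x)" for x
    by (simp add: hext_def linear_cmul[OF assms(2)] assms(3))
  have m: "(\<lambda>x. indicator (ball 0 1) x *\<^sub>R hext f x) \<in> borel_measurable borel"
    using indicator_hext_measurable[OF assms(4)] by simp
  have "sint f = (\<integral>x. indicator (ball 0 1) x *\<^sub>R hext f x \<partial>distr lborel borel R)"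
    by (simp add: sint_def set_lebesgue_integral_def d)
  also have "\<dots> = (\<integral>x. indicator (ball 0 1) (R x) *\<^sub>R hext f (R x) \<partial>lborel)"
    by (rule integral_distr) (use m in auto)
  also have "\<dots> = sint (\<lambda>x. f (R x))"
    unfolding sint_def set_lebesgue_integral_def by (simp add: h indicator_def assms(3))
  finally show ?thesis by simp
qed


text \<open>For \<open>M\<^sup>2 = -1\<close> the one-parameter group generated by \<open>M\<close> is \<open>exp (t M) = cos t + (sin t) M\<close>.\<close>

definition rot :: "(pt \<Rightarrow> pt) \<Rightarrow> real \<Rightarrow> pt \<Rightarrow> pt" where
  "rot M t x = cos t *\<^sub>R x + sin t *\<^sub>R M x"

lemma linear_rot: "linear M \<Longrightarrow> linear (rot M t)"
  unfolding rot_def[abs_def]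
  by (rule linearI) (simp_all add: linear_add linear_cmul scaleR_add_right mult.commute)

lemma norm_rot:
  assumes "\<And>x. norm (M x) = norm x" "\<And>x. x \<bullet> M x = 0"
  shows "norm (rot M t x) = norm x"
proof -
  have "(norm (rot M t x))\<^sup>2 = (cos t)\<^sup>2 * (norm x)\<^sup>2 + (sin t)\<^sup>2 * (norm (M x))\<^sup>2"
    using assms(2)[of x] unfolding rot_def power2_norm_eq_inner
    by (simp only: inner_add_left inner_add_right inner_scaleR_left inner_scaleR_right inner_commute[of "M x" x])
      (simp add: power2_eq_square)
  also have "\<dots> = ((cos t)\<^sup>2 + (sin t)\<^sup>2) * (norm x)\<^sup>2"
    by (simp only: assms(1) distrib_right)
  also have "(cos t)\<^sup>2 + (sin t)\<^sup>2 = 1" by (rule sin_cos_squared_add2)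
  finally show ?thesis by simp
qed

lemma has_derivative_along_rot:
  assumes f: "smooth_S3 f" and M: "linear M" "\<And>x. M (M x) = - x" and nz: "rot M t x \<noteq> 0"
  shows "((\<lambda>t. hext f (rot M t x)) has_derivative (\<lambda>h. h *\<^sub>R Dir M f (rot M t x))) (at t within S)"
proof -
  have l: "linear (frechet_derivative (hext f) (at (rot M t x)))"
    using smooth_S3_has_derivative[OF f nz] by (rule has_derivative_linear)
  have 1: "((\<lambda>t. rot M t x) has_derivative (\<lambda>h. h *\<^sub>R M (rot M t x))) (at t within S)"
    unfolding rot_def
    by (auto intro!: derivative_eq_intros simp: linear_add[OF M(1)] linear_cmul[OF M(1)] M(2)
        algebra_simps)
  have "((\<lambda>t. hext f (rot M t x)) has_derivative
      (\<lambda>h. frechet_derivative (hext f) (at (rot M t x)) (h *\<^sub>R M (rot M t x)))) (at t within S)"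
    by (rule has_derivative_compose[OF 1 smooth_S3_has_derivative[OF f nz]])
  then show ?thesis by (simp add: Dir_def linear_cmul[OF l])
qed

text \<open>Invariance makes the integral of every difference quotient of \<open>f\<close> along the
  flow zero, and dominated convergence passes to the derivative. This is the source of all
  integrations by parts on the sphere.\<close>

lemma sint_Dir_zero:
  assumes f: "smooth_S3 f"
    and M: "linear M" "\<And>x. M (M x) = - x" "\<And>x. norm (M x) = norm x" "\<And>x. x \<bullet> M x = 0"
    and mp: "\<And>t. 0 < t \<Longrightarrow> t < 1 \<Longrightarrow> mpres (rot M t)"
  shows "sint (Dir M f) = 0"
proof -
  note nr = norm_rot[OF M(3,4)]
  have cf: "continuous_on S3 f" by (rule smooth_S3_continuous[OF f])
  have cD: "continuous_on S3 (Dir M f)" by (rule smooth_S3_continuous[OF smooth_S3_Dir[OF f M(1)]])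
  obtain B where B: "B \<ge> 0" "\<And>x. x \<in> S3 \<Longrightarrow> norm (Dir M f x) \<le> B"
    using continuous_S3_bounded[OF cD] by blast
  have BU: "norm (Dir M f x) \<le> B" if "x \<noteq> 0" for x
    using hext_Dir[OF f M(1) that] B(2)[OF normalize_in_S3[OF that]] by (simp add: hext_def)
  \<comment> \<open>A null sequence inside (0, 1), the range of times for which invariance is
    assumed.\<close>
  define t where "t n = 1 / (real n + 2)" for n
  have t: "0 < t n" "t n < 1" "t n \<noteq> 0" for n by (auto simp: t_def)
  have t0: "t \<longlonglongrightarrow> 0" unfolding t_def by real_asymp
  define s where "s n x = indicator (ball 0 1) x *\<^sub>R hext (\<lambda>x. (f (rot M (t n) x) - f x) / of_real (t n)) x" for n x
  have rS: "rot M u x \<in> S3" if "x \<in> S3" for u x using that by (simp add: S3_def nr)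
  have crot: "continuous_on S3 (\<lambda>x. f (rot M u x))" for u
    using continuous_on_compose2[OF cf linear_continuous_on[of "rot M u" S3]] rS linear_rot[OF M(1), of u]
    by (auto simp: linear_conv_bounded_linear image_subset_iff)
  have cs: "continuous_on S3 (\<lambda>x. (f (rot M (t n) x) - f x) / of_real (t n))" for n
    by (intro continuous_intros crot cf) (use t in auto)
  have hx: "hext (\<lambda>x. (f (rot M (t n) x) - f x) / of_real (t n)) x
            = (hext f (rot M (t n) x) - hext f x) / of_real (t n)" for n x
    by (simp add: hext_def nr linear_cmul[OF linear_rot[OF M(1)]])
  have int0: "integral\<^sup>L lborel (s n) = 0" for n
  proof -
    have "integral\<^sup>L lborel (s n) = sint (\<lambda>x. (1 / of_real (t n)) * (f (rot M (t n) x) + (-1) * f x))"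
      by (simp add: sint_def set_lebesgue_integral_def s_def[abs_def])
    also have "\<dots> = (1 / of_real (t n)) * (sint (\<lambda>x. f (rot M (t n) x)) + (-1) * sint f)"
      by (subst sint_cmult, subst sint_add) (auto intro!: crot continuous_intros cf simp: sint_cmult[of "-1" f, simplified])
    also have "sint (\<lambda>x. f (rot M (t n) x)) = sint f"
      by (rule sint_mpres[OF mp linear_rot[OF M(1)] nr cf]) (use t in auto)
    finally show ?thesis by simp
  qed
  have "(\<lambda>n. integral\<^sup>L lborel (s n)) \<longlonglongrightarrow> (\<integral>x. indicator (ball 0 1) x *\<^sub>R hext (Dir M f) x \<partial>lborel)"
  proof (rule integral_dominated_convergence[where w="\<lambda>x. B * indicator (ball 0 1) x"])
    show "(\<lambda>x. indicator (ball 0 1) x *\<^sub>R hext (Dir M f) x) \<in> borel_measurable lborel"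
      by (rule indicator_hext_measurable[OF cD])
    show "s n \<in> borel_measurable lborel" for n
      unfolding s_def by (rule indicator_hext_measurable[OF cs])
    show "integrable lborel (\<lambda>x::pt. B * indicator (ball 0 1) x)" by (rule integrable_ball)
    show "AE x in lborel. norm (s n x) \<le> B * indicator (ball 0 1) x" for n
      using AE_nonzero
    proof eventually_elim
      case (elim x)
      have nz: "rot M u x \<noteq> 0" for u using nr[of u x] elim by (metis norm_eq_zero)
      \<comment> \<open>The mean value inequality along the orbit bounds the quotients by
        \<open>B\<close> uniformly in \<open>n\<close>; the orbit avoids 0 because
        \<open>rot\<close> preserves the norm.\<close>
      have "norm (hext f (rot M (t n) x) - hext f (rot M 0 x)) \<le> B * norm (t n - 0)"
      proof (rule differentiable_bound[where S="{0..t n}" and f'="\<lambda>u h. h *\<^sub>R Dir M f (rot M u x)"])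
        show "onorm (\<lambda>h. h *\<^sub>R Dir M f (rot M u x)) \<le> B" for u
          by (rule onorm_le) (use mult_right_mono[OF BU[OF nz] abs_ge_zero] in \<open>simp add: mult.commute\<close>)
        show "((\<lambda>t. hext f (rot M t x)) has_derivative (\<lambda>h. h *\<^sub>R Dir M f (rot M u x))) (at u within {0..t n})"
          for u by (rule has_derivative_along_rot[OF f M(1,2) nz])
      qed (use t[of n] in auto)
      then have "norm ((hext f (rot M (t n) x) - hext f x) / of_real (t n)) \<le> B"
        using t[of n] by (simp add: norm_divide rot_def divide_le_eq)
      then show ?case unfolding s_def hx by (simp add: indicator_def)
    qed
    show "AE x in lborel. (\<lambda>n. s n x) \<longlonglongrightarrow> indicator (ball 0 1) x *\<^sub>R hext (Dir M f) x"
      using AE_nonzero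
    proof eventually_elim
      case (elim x)
      have r0: "rot M 0 x = x" by (simp add: rot_def)
      have "((\<lambda>h. norm (hext f (rot M h x) - hext f x - h *\<^sub>R Dir M f x) / norm h) \<longlongrightarrow> 0) (at 0)"
        using has_derivative_along_rot[OF f M(1,2), of 0 x UNIV] elim r0
        by (simp add: has_derivative_iff_norm)
      moreover have "norm (hext f (rot M h x) - hext f x - h *\<^sub>R Dir M f x) / norm h =
          norm ((hext f (rot M h x) - hext f x) /\<^sub>R h - Dir M f x)" if "h \<noteq> 0" for h
      proof -
        have "(hext f (rot M h x) - hext f x) /\<^sub>R h - Dir M f x =
            (hext f (rot M h x) - hext f x - h *\<^sub>R Dir M f x) /\<^sub>R h"
          using that by (simp add: scaleR_diff_right)
        then show ?thesis by (simp add: divide_inverse mult.commute)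
      qed
      ultimately have "((\<lambda>h. norm ((hext f (rot M h x) - hext f x) /\<^sub>R h - Dir M f x)) \<longlongrightarrow> 0) (at 0)"
        by (subst filterlim_cong[OF refl refl, where g="\<lambda>h. norm (hext f (rot M h x) - hext f x - h *\<^sub>R Dir M f x) / norm h"])
          (auto simp: eventually_at_filter)
      then have "((\<lambda>h. (hext f (rot M h x) - hext f x) /\<^sub>R h) \<longlongrightarrow> Dir M f x) (at 0)"
        by (rule LIM_zero_cancel[OF tendsto_norm_zero_cancel])
      then have "(\<lambda>n. (hext f (rot M (t n) x) - hext f x) /\<^sub>R t n) \<longlonglongrightarrow> Dir M f x"
        by (rule filterlim_compose) (use t t0 in \<open>auto simp: filterlim_at\<close>)
      then have "(\<lambda>n. indicator (ball 0 1) x *\<^sub>R ((hext f (rot M (t n) x) - hext f x) /\<^sub>R t n)) \<longlonglongrightarrow>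
           indicator (ball 0 1) x *\<^sub>R Dir M f x"
        by (rule tendsto_scaleR[OF tendsto_const])
      then show ?case unfolding s_def hx hext_Dir[OF f M(1) elim]
        by (simp add: scaleR_conv_of_real divide_inverse mult.commute)
    qed
  qed
  then show ?thesis using int0 by (simp add: sint_def set_lebesgue_integral_def LIMSEQ_const_iff)
qed

text \<open>The classical factorisation of a plane rotation into three shears. The mutually inverse
  maps \<open>N\<close> and \<open>N'\<close> identify the two factors, so that the generator still
  squares to -1.\<close>

lemma mpres_rot:
  fixes N N' :: "complex \<Rightarrow> complex" and t :: real
  assumes N: "bounded_linear N" "bounded_linear N'" "\<And>z. N (N' z) = z" "\<And>z. N' (N z) = z" and s: "sin t \<noteq> 0"
  shows "mpres (rot (\<lambda>(z,w). (N w, - N' z)) t)"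
proof -
  \<comment> \<open>The tangent of \<open>t / 2\<close>, slope of the two outer shears; the middle
    one has slope \<open>- sin t\<close>. The identities \<open>c\<close> and \<open>d\<close> are
    what the product of the three requires.\<close>
  define a where "a = (1 - cos t) / sin t"
  let ?S = "\<lambda>(z,w). (z + a *\<^sub>R N w, w)" and ?S' = "\<lambda>(z,w). (z, w + (- sin t) *\<^sub>R N' z)"
  have [measurable]: "N \<in> borel_measurable borel" "N' \<in> borel_measurable borel"
    using N(1,2) by (auto intro!: borel_measurable_continuous_onI linear_continuous_on)
  have m1: "mpres ?S" and m2: "mpres ?S'"
    by (rule mpres_shear1, measurable) (rule mpres_shear2, measurable)
  have m: "mpres (\<lambda>x. ?S (?S' (?S x)))"
    by (rule mpres_comp[OF m1 mpres_comp[OF m2 m1]])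
  have c: "1 - a * sin t = cos t" using s by (simp add: a_def)
  have "a * (1 + cos t) = ((1 - cos t) * (1 + cos t)) / sin t"
    by (simp add: a_def)
  also have "(1 - cos t) * (1 + cos t) = sin t * sin t"
    using sin_squared_eq[of t] by (simp add: algebra_simps power2_eq_square)
  finally have d: "a * (1 + cos t) = sin t" using s by simp
  have "?S (?S' (?S (z,w))) = rot (\<lambda>(z,w). (N w, - N' z)) t (z,w)" for z w
  proof -
    interpret N: bounded_linear N by fact
    interpret N': bounded_linear N' by fact
    have w': "w - sin t *\<^sub>R (N' z + a *\<^sub>R w) = cos t *\<^sub>R w - sin t *\<^sub>R N' z"
      by (simp add: c[symmetric] algebra_simps)
    have "z + a *\<^sub>R N w + a *\<^sub>R N (cos t *\<^sub>R w - sin t *\<^sub>R N' z)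
        = (1 - a * sin t) *\<^sub>R z + (a * (1 + cos t)) *\<^sub>R N w"
      by (simp add: N.diff N.scaleR N(3) algebra_simps)
    then show ?thesis using w'
      by (simp add: rot_def N'.add N'.scaleR N(4) c d)
  qed
  then have "(\<lambda>x. ?S (?S' (?S x))) = rot (\<lambda>(z,w). (N w, - N' z)) t" by (auto simp: fun_eq_iff)
  then show ?thesis using m by simp
qed

lemma sin_pos_unit: "0 < t \<Longrightarrow> t < 1 \<Longrightarrow> sin (t::real) \<noteq> 0"
  using sin_gt_zero[of t] pi_gt3 by auto

lemma bounded_linear_conj_mult: "bounded_linear (\<lambda>z. c * cnj z)"
  by (intro bounded_linear_compose[OF bounded_linear_mult_right] bounded_linear_cnj)

lemma mpres_rot_M1: "0 < t \<Longrightarrow> t < 1 \<Longrightarrow> mpres (rot M1 t)"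
proof -
  assume "0 < t" "t < 1"
  moreover have "M1 = (\<lambda>(z,w). (1 * cnj w, - (1 * cnj z)))" by (auto simp: M1_def fun_eq_iff)
  ultimately show ?thesis
    using mpres_rot[OF bounded_linear_conj_mult bounded_linear_conj_mult _ _ sin_pos_unit, of 1 1] by simp
qed

lemma mpres_rot_M2: "0 < t \<Longrightarrow> t < 1 \<Longrightarrow> mpres (rot M2 t)"
proof -
  assume "0 < t" "t < 1"
  moreover have "M2 = (\<lambda>(z,w). (\<i> * cnj w, - (\<i> * cnj z)))" by (auto simp: M2_def fun_eq_iff)
  ultimately show ?thesis
    using mpres_rot[OF bounded_linear_conj_mult bounded_linear_conj_mult _ _ sin_pos_unit, of \<i> \<i>] by simp
qed

text \<open>Each map is a product of two quarter turns. The first kind is the Reeb flow, the second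
  separates monomials of equal degree.\<close>

lemma mpres_diag:
  assumes "cmod \<alpha> = 1"
  shows "mpres (\<lambda>(z,w). (\<alpha> * z, \<alpha> * w))" "mpres (\<lambda>(z,w). (\<alpha> * z, cnj \<alpha> * w))"
proof -
  have a: "\<alpha> * cnj \<alpha> = 1" using assms by (simp add: complex_norm_square[symmetric])
  \<comment> \<open>At \<open>pi/2\<close> a rotation coincides with its generator, so
    \<open>mpres_rot\<close> applies to the generators themselves.\<close>
  have q: "rot (\<lambda>(z,w). (N w, - N' z)) (pi/2) = (\<lambda>(z,w). (N w, - N' z))" for N N' :: "complex \<Rightarrow> complex"
    by (auto simp: rot_def fun_eq_iff)
  have 1: "mpres (\<lambda>(z,w). (c * cnj w, - (c * cnj z)))" if "c * cnj c = 1" for c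
    using mpres_rot[OF bounded_linear_conj_mult[of c] bounded_linear_conj_mult[of c], of "pi/2"] that
    unfolding q by (simp flip: mult.assoc)
  have 2: "mpres (\<lambda>(z,w). (c * w, - (cnj c * z)))" if "c * cnj c = 1" for c
    using mpres_rot[OF bounded_linear_mult_right[of c] bounded_linear_mult_right[of "cnj c"], of "pi/2"]
      that that[unfolded mult.commute[of c]]
    unfolding q by (simp flip: mult.assoc)
  show "mpres (\<lambda>(z,w). (\<alpha> * z, \<alpha> * w))"
    using mpres_comp[OF 1[of "\<alpha>"] 1[of "-1"]] a by (simp add: case_prod_unfold mult.commute)
  show "mpres (\<lambda>(z,w). (\<alpha> * z, cnj \<alpha> * w))"
    using mpres_comp[OF 2[of "\<alpha>"] 2[of "-1"]] a by (simp add: case_prod_unfold mult.commute)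
qed

lemma mpres_rot_M0: "mpres (rot M0 t)"
proof -
  have "rot M0 t = (\<lambda>(z,w). (cis t * z, cis t * w))"
    by (auto simp: rot_def M0_def fun_eq_iff cis_conv_exp exp_Euler scaleR_conv_of_real algebra_simps
        simp flip: cos_of_real sin_of_real)
  then show ?thesis using mpres_diag(1)[of "cis t"] by simp
qed

lemma M_isometry:
  "M1 (M1 x) = - x" "norm (M1 x) = norm x" "x \<bullet> M1 x = 0"
  "M2 (M2 x) = - x" "norm (M2 x) = norm x" "x \<bullet> M2 x = 0"
  "M0 (M0 x) = - x" "norm (M0 x) = norm x" "x \<bullet> M0 x = 0"
  by (simp_all add: M1_def M2_def M0_def prod_eq_iff norm_prod_def inner_prod_def inner_complex_def
      norm_mult add.commute flip: mult.assoc)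

lemma sint_fields_zero:
  assumes "smooth_S3 f"
  shows "sint (Z1 f) = 0" "sint (Z1b f) = 0" "sint (Treeb f) = 0"
proof -
  note 0 = sint_Dir_zero[OF assms]
  have D: "sint (Dir M1 f) = 0" "sint (Dir M2 f) = 0" "sint (Dir M0 f) = 0"
    by (intro 0 linear_M M_isometry mpres_rot_M1 mpres_rot_M2 mpres_rot_M0; assumption)+
  note sm = smooth_S3_Dir[OF assms linear_M(1)] smooth_S3_Dir[OF assms linear_M(2)]
  note cf = smooth_S3_fields[OF assms, THEN smooth_S3_continuous]
  have c: "continuous_on S3 (Dir M1 f)" "continuous_on S3 (\<lambda>x. c * Dir M2 f x)" for c
    by (intro continuous_intros smooth_S3_continuous sm)+
  have "sint (Z1 f) = sint (\<lambda>x. 1/2 * (Dir M1 f x + (-\<i>) * Dir M2 f x))"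
    by (rule sint_cong[OF _ cf(1)]) (simp add: fields_Dir[OF assms S3_nonzero])
  then show "sint (Z1 f) = 0"
    by (simp only: sint_cmult sint_add[OF c] D) simp
  have "sint (Z1b f) = sint (\<lambda>x. 1/2 * (Dir M1 f x + \<i> * Dir M2 f x))"
    by (rule sint_cong[OF _ cf(2)]) (simp add: fields_Dir[OF assms S3_nonzero])
  then show "sint (Z1b f) = 0"
    by (simp only: sint_cmult sint_add[OF c] D) simp
  have "sint (Treeb f) = sint (Dir M0 f)"
    by (rule sint_cong[OF _ cf(3)]) (simp add: fields_Dir[OF assms S3_nonzero])
  then show "sint (Treeb f) = 0" by (simp add: D)
qed

section \<open>Derivation rules and adjoints\<close>

lemma Dir_mult:
  assumes "smooth_S3 f" "smooth_S3 g" "x \<noteq> 0"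
  shows "Dir M (\<lambda>x. f x * g x) x = hext f x * Dir M g x + Dir M f x * hext g x"
proof -
  have e: "hext (\<lambda>x. f x * g x) = (\<lambda>x. hext f x * hext g x)" by (simp add: hext_def[abs_def])
  show ?thesis unfolding Dir_def e
    by (subst frechet_derivative_at[OF has_derivative_mult[OF smooth_S3_has_derivative[OF assms(1,3)]
        smooth_S3_has_derivative[OF assms(2,3)]], symmetric]) (rule refl)
qed

lemma Dir_cnj:
  assumes "smooth_S3 f" "x \<noteq> 0"
  shows "Dir M (\<lambda>x. cnj (f x)) x = cnj (Dir M f x)"
proof -
  have e: "hext (\<lambda>x. cnj (f x)) = (\<lambda>x. cnj (hext f x))" by (simp add: hext_def[abs_def])
  show ?thesis unfolding Dir_def e
    by (subst frechet_derivative_at[OF bounded_linear.has_derivative[OF bounded_linear_cnj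
        smooth_S3_has_derivative[OF assms]], symmetric]) (rule refl)
qed

lemma Dir_const: "Dir M (\<lambda>x. c) x = 0"
  by (simp add: Dir_def hext_def[abs_def] frechet_derivative_const)

lemma fields_mult:
  assumes "smooth_S3 f" "smooth_S3 g" "x \<in> S3"
  shows "Z1 (\<lambda>x. f x * g x) x = Z1 f x * g x + f x * Z1 g x"
    "Z1b (\<lambda>x. f x * g x) x = Z1b f x * g x + f x * Z1b g x"
    "Treeb (\<lambda>x. f x * g x) x = Treeb f x * g x + f x * Treeb g x"
  using assms
  by (simp_all add: fields_Dir Dir_mult smooth_S3_mult S3_nonzero hext_S3 algebra_simps
      add_divide_distrib diff_divide_distrib)

lemma fields_cmult:
  assumes "smooth_S3 f" "x \<in> S3"
  shows "Z1 (\<lambda>x. c * f x) x = c * Z1 f x" "Z1b (\<lambda>x. c * f x) x = c * Z1b f x"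
    "Treeb (\<lambda>x. c * f x) x = c * Treeb f x"
  using assms
  by (simp_all add: fields_Dir Dir_mult Dir_const smooth_S3_mult smooth_S3_const S3_nonzero hext_def algebra_simps
      add_divide_distrib diff_divide_distrib)

lemma fields_cnj:
  assumes "smooth_S3 f" "x \<in> S3"
  shows "Z1 (\<lambda>x. cnj (f x)) x = cnj (Z1b f x)" "Z1b (\<lambda>x. cnj (f x)) x = cnj (Z1 f x)"
    "Treeb (\<lambda>x. cnj (f x)) x = cnj (Treeb f x)"
  using assms
  by (simp_all add: fields_Dir Dir_cnj smooth_S3_cnj S3_nonzero)

lemma Z1_cong: "(\<And>y. y \<in> S3 \<Longrightarrow> f y = g y) \<Longrightarrow> smooth_S3 f \<Longrightarrow> x \<in> S3 \<Longrightarrow> Z1 f x = Z1 g x"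
  and Z1b_cong: "(\<And>y. y \<in> S3 \<Longrightarrow> f y = g y) \<Longrightarrow> smooth_S3 f \<Longrightarrow> x \<in> S3 \<Longrightarrow> Z1b f x = Z1b g x"
  and Treeb_cong: "(\<And>y. y \<in> S3 \<Longrightarrow> f y = g y) \<Longrightarrow> smooth_S3 f \<Longrightarrow> x \<in> S3 \<Longrightarrow> Treeb f x = Treeb g x"
proof -
  assume a: "\<And>y. y \<in> S3 \<Longrightarrow> f y = g y" "smooth_S3 f" "x \<in> S3"
  have "frechet_derivative (hext f) (at x) = frechet_derivative (hext g) (at x)"
    using differentiableI[OF smooth_S3_has_derivative[OF a(2) S3_nonzero[OF a(3)]]]
    by (rule frechet_derivative_transform_within_open[OF _ open_punctured])
      (use a S3_nonzero hext_cong[of f g] in auto)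
  then show "Z1 f x = Z1 g x" "Z1b f x = Z1b g x" "Treeb f x = Treeb g x"
    by (simp_all add: Z1_def Z1b_def Treeb_def dz_def dzb_def dw_def dwb_def)
qed

lemma L2ip_cong:
  assumes "\<And>x. x \<in> S3 \<Longrightarrow> f x = f' x" "\<And>x. x \<in> S3 \<Longrightarrow> g x = g' x"
    "continuous_on S3 f" "continuous_on S3 g"
  shows "L2ip f g = L2ip f' g'"
  unfolding L2ip_sint
proof (rule sint_cong)
  show "continuous_on S3 (\<lambda>x. f x * cnj (g x))"
    by (intro continuous_intros assms)
qed (simp add: assms)

lemma L2ip_add_left:
  assumes "continuous_on S3 f" "continuous_on S3 g" "continuous_on S3 h"
  shows "L2ip (\<lambda>x. f x + g x) h = L2ip f h + L2ip g h"
  unfolding L2ip_sint distrib_right by (rule sint_add) (auto intro!: continuous_intros simp: assms)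

lemma L2ip_cmult_left: "L2ip (\<lambda>x. c * f x) g = c * L2ip f g"
  unfolding L2ip_sint by (simp add: sint_cmult mult.assoc)

lemma L2ip_sym: "L2ip g f = cnj (L2ip f g)"
  unfolding L2ip_sint by (simp add: mult.commute flip: sint_cnj)

lemma L2ip_cnj: "L2ip (\<lambda>x. cnj (f x)) g = cnj (L2ip f (\<lambda>x. cnj (g x)))"
  unfolding L2ip_sint by (simp flip: sint_cnj)

lemma L2ip_cmult_right: "L2ip f (\<lambda>x. c * g x) = cnj c * L2ip f g"
  by (subst (1 2) L2ip_sym) (simp add: L2ip_cmult_left)

lemma L2ip_add_right:
  assumes "continuous_on S3 f" "continuous_on S3 g" "continuous_on S3 h"
  shows "L2ip h (\<lambda>x. f x + g x) = L2ip h f + L2ip h g"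
  by (subst (1 2 3) L2ip_sym) (simp add: L2ip_add_left assms)

lemma L2ip_norm_le:
  assumes "continuous_on S3 f" "continuous_on S3 g"
    "\<And>x. x \<in> S3 \<Longrightarrow> norm (f x) \<le> A" "\<And>x. x \<in> S3 \<Longrightarrow> norm (g x) \<le> B" "A \<ge> 0"
  shows "norm (L2ip f g) \<le> A * B * vol"
  unfolding L2ip_sint
  by (rule sint_norm_le) (auto intro!: continuous_intros mult_mono simp: assms norm_mult)

lemma L2ip_zero_imp_zero:
  "continuous_on S3 f \<Longrightarrow> L2ip f f = 0 \<Longrightarrow> x \<in> S3 \<Longrightarrow> f x = 0"
  unfolding L2ip_sint by (rule sint_positive_definite)

text \<open>Each field applied to \<open>f x * cnj (g x)\<close> integrates to zero, and the Leibniz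
  rule splits that integral. Conjugation exchanges \<open>Z1\<close> and \<open>Z1b\<close> and
  preserves \<open>Treeb\<close>, which decides the pairing of adjoints.\<close>

lemma L2ip_adjoint:
  assumes f: "smooth_S3 f" and g: "smooth_S3 g"
  shows "L2ip (Z1 f) g = - L2ip f (Z1b g)"
    "L2ip (Z1b f) g = - L2ip f (Z1 g)"
    "L2ip (Treeb f) g = - L2ip f (Treeb g)"
proof -
  let ?h = "\<lambda>x. f x * cnj (g x)"
  have h: "smooth_S3 ?h" by (intro smooth_S3_intros f g)
  note ff = smooth_S3_fields[OF f] and gf = smooth_S3_fields[OF g]
  note hf = smooth_S3_fields[OF h, THEN smooth_S3_continuous]
  have c: "continuous_on S3 (\<lambda>x. u x * cnj (v x))" if "smooth_S3 u" "smooth_S3 v" for u v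
    by (intro smooth_S3_continuous smooth_S3_intros that)
  have "0 = sint (Z1 ?h)" using sint_fields_zero[OF h] by simp
  also have "\<dots> = sint (\<lambda>x. Z1 f x * cnj (g x) + f x * cnj (Z1b g x))"
    by (rule sint_cong[OF _ hf(1)]) (simp add: fields_mult f g smooth_S3_cnj fields_cnj)
  finally show "L2ip (Z1 f) g = - L2ip f (Z1b g)"
    unfolding L2ip_sint by (subst (asm) sint_add[OF c c]) (auto simp: f g ff gf eq_neg_iff_add_eq_0)
  have "0 = sint (Z1b ?h)" using sint_fields_zero[OF h] by simp
  also have "\<dots> = sint (\<lambda>x. Z1b f x * cnj (g x) + f x * cnj (Z1 g x))"
    by (rule sint_cong[OF _ hf(2)]) (simp add: fields_mult f g smooth_S3_cnj fields_cnj)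
  finally show "L2ip (Z1b f) g = - L2ip f (Z1 g)"
    unfolding L2ip_sint by (subst (asm) sint_add[OF c c]) (auto simp: f g ff gf eq_neg_iff_add_eq_0)
  have "0 = sint (Treeb ?h)" using sint_fields_zero[OF h] by simp
  also have "\<dots> = sint (\<lambda>x. Treeb f x * cnj (g x) + f x * cnj (Treeb g x))"
    by (rule sint_cong[OF _ hf(3)]) (simp add: fields_mult f g smooth_S3_cnj fields_cnj)
  finally show "L2ip (Treeb f) g = - L2ip f (Treeb g)"
    unfolding L2ip_sint by (subst (asm) sint_add[OF c c]) (auto simp: f g ff gf eq_neg_iff_add_eq_0)
qed

section \<open>Bihomogeneous polynomials\<close>

definition cmonom :: "complex \<Rightarrow> nat \<Rightarrow> nat \<Rightarrow> nat \<Rightarrow> nat \<Rightarrow> pt \<Rightarrow> complex" where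
  "cmonom K a b c d x = K * fst x ^ a * snd x ^ b * cnj (fst x) ^ c * cnj (snd x) ^ d"

text \<open>The functions \<open>bihom p q cf\<close>, generated inductively so that closure
  properties and derivative formulas need only be checked on monomials and sums.\<close>

inductive BH :: "nat \<Rightarrow> nat \<Rightarrow> (pt \<Rightarrow> complex) \<Rightarrow> bool" where
  BH_cmonom: "a + b = p \<Longrightarrow> c + d = q \<Longrightarrow> BH p q (cmonom K a b c d)"
| BH_add: "BH p q F \<Longrightarrow> BH p q G \<Longrightarrow> BH p q (\<lambda>x. F x + G x)"

lemma BH_zero: "BH p q (\<lambda>x. 0)"
  using BH_cmonom[of p 0 p q 0 q 0] by (simp add: cmonom_def[abs_def])

lemma BH_sum: "finite A \<Longrightarrow> (\<And>a. a \<in> A \<Longrightarrow> BH p q (F a)) \<Longrightarrow> BH p q (\<lambda>x. \<Sum>a\<in>A. F a x)"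
  by (induction A rule: finite_induct) (simp_all add: BH_zero BH_add)

lemma BH_iff_bihom: "BH p q F \<longleftrightarrow> (\<exists>cf. F = bihom p q cf)"
proof
  assume "BH p q F"
  then show "\<exists>cf. F = bihom p q cf"
  proof induction
    case (BH_cmonom a b p c d q K)
    let ?cf = "\<lambda>a' k'. if a' = a then (if k' = c then K else 0) else 0"
    have "cmonom K a b c d x = bihom p q ?cf x" for x
    proof -
      have b: "b = p - a" "d = q - c" "a \<le> p" "c \<le> q" using BH_cmonom by auto
      have "bihom p q ?cf x = (\<Sum>a'\<le>p. \<Sum>k'\<le>q. if a' = a then (if k' = c then cmonom K a b c d x else 0) else 0)"
        unfolding bihom_def by (intro sum.cong refl) (simp add: cmonom_def b)
      also have "\<dots> = (\<Sum>a'\<le>p. if a' = a then (\<Sum>k'\<le>q. if k' = c then cmonom K a b c d x else 0) else 0)"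
        by (intro sum.cong refl) simp
      finally have "bihom p q ?cf x = \<dots>" .
      then show ?thesis using b by simp
    qed
    then show ?case by blast
  next
    case (BH_add p q F G)
    then obtain cf cg where "F = bihom p q cf" "G = bihom p q cg" by blast
    then have "(\<lambda>x. F x + G x) = bihom p q (\<lambda>a k. cf a k + cg a k)"
      by (auto simp: bihom_def fun_eq_iff algebra_simps sum.distrib)
    then show ?case by blast
  qed
next
  assume "\<exists>cf. F = bihom p q cf"
  then obtain cf where F: "F = bihom p q cf" by blast
  have "BH p q (\<lambda>x. \<Sum>a\<in>{..p}. (\<Sum>k\<in>{..q}. cmonom (cf a k) a (p - a) k (q - k) x))"
    by (intro BH_sum BH_cmonom) auto
  then show "BH p q F" by (simp add: F bihom_def[abs_def] cmonom_def)
qed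

lemma cmonom_mult: "cmonom K a b c d x * cmonom K' a' b' c' d' x = cmonom (K * K') (a + a') (b + b') (c + c') (d + d') x"
  by (simp add: cmonom_def power_add mult_ac)

lemma BH_mult:
  assumes "BH p q F" "BH p' q' G"
  shows "BH (p + p') (q + q') (\<lambda>x. F x * G x)"
  using assms
proof (induction)
  case (BH_cmonom a b p c d q K)
  from BH_cmonom(3) show ?case
  proof (induction)
    case (BH_cmonom a' b' p' c' d' q' K')
    then show ?case unfolding cmonom_mult using \<open>a + b = p\<close> \<open>c + d = q\<close>
      by (intro BH.BH_cmonom) auto
  next
    case (BH_add p' q' F' G')
    then show ?case unfolding distrib_left by (intro BH.BH_add)
  qed
next
  case (BH_add p q F G')
  then show ?case unfolding distrib_right by (intro BH.BH_add)
qed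

lemma BH_coords:
  "BH 1 0 fst" "BH 1 0 snd" "BH 0 1 (\<lambda>x. cnj (fst x))" "BH 0 1 (\<lambda>x. cnj (snd x))" "BH 0 0 (\<lambda>x. k)"
  using BH_cmonom[of 1 0 1 0 0 0 1] BH_cmonom[of 0 1 1 0 0 0 1] BH_cmonom[of 0 0 0 1 0 1 1]
    BH_cmonom[of 0 0 0 0 1 1 1] BH_cmonom[of 0 0 0 0 0 0 k]
  by (simp_all add: cmonom_def[abs_def])

lemma BH_cmult: "BH p q F \<Longrightarrow> BH p q (\<lambda>x. c * F x)"
  using BH_mult[OF BH_coords(5)[of c], of p q F] by simp

lemma BH_diff: "BH p q F \<Longrightarrow> BH p q G \<Longrightarrow> BH p q (\<lambda>x. F x - G x)"
  using BH_add[OF _ BH_cmult[of p q G "-1"], of F] by simp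

lemma BH_cnj: "BH p q F \<Longrightarrow> BH q p (\<lambda>x. cnj (F x))"
proof (induction rule: BH.induct)
  case (BH_cmonom a b p c d q K)
  have "(\<lambda>x. cnj (cmonom K a b c d x)) = cmonom (cnj K) c d a b" by (auto simp: cmonom_def mult_ac)
  then show ?case using BH.BH_cmonom[OF BH_cmonom(2,1)] by simp
qed (simp add: BH_add)

section \<open>Wirtinger calculus on polynomials\<close>

lemma wirtinger_unique:
  assumes "(F has_derivative (\<lambda>v. A * fst v + B * cnj (fst v) + C * snd v + D * cnj (snd v))) (at x)"
  shows "dz F x = A" "dzb F x = B" "dw F x = C" "dwb F x = D"
  unfolding dz_def dzb_def dw_def dwb_def frechet_derivative_at[OF assms, symmetric]
  by (simp_all add: algebra_simps)

lemma wirtinger_has_derivative: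
  assumes "F differentiable at x"
  shows "(F has_derivative (\<lambda>v. dz F x * fst v + dzb F x * cnj (fst v) + dw F x * snd v + dwb F x * cnj (snd v))) (at x)"
proof -
  have "frechet_derivative F (at x) =
      (\<lambda>v. dz F x * fst v + dzb F x * cnj (fst v) + dw F x * snd v + dwb F x * cnj (snd v))"
    by (rule ext) (rule wirtinger_expand[OF assms])
  with assms show ?thesis unfolding frechet_derivative_works by (simp only:)
qed

lemma wirtinger_add:
  assumes "F differentiable at x" "G differentiable at x"
  shows "dz (\<lambda>x. F x + G x) x = dz F x + dz G x" "dzb (\<lambda>x. F x + G x) x = dzb F x + dzb G x"
    "dw (\<lambda>x. F x + G x) x = dw F x + dw G x" "dwb (\<lambda>x. F x + G x) x = dwb F x + dwb G x"
proof -
  have "((\<lambda>x. F x + G x) has_derivative (\<lambda>v. (dz F x + dz G x) * fst v + (dzb F x + dzb G x) * cnj (fst v)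
      + (dw F x + dw G x) * snd v + (dwb F x + dwb G x) * cnj (snd v))) (at x)"
    using has_derivative_add[OF wirtinger_has_derivative[OF assms(1)] wirtinger_has_derivative[OF assms(2)]]
    by (simp add: algebra_simps)
  from wirtinger_unique[OF this]
  show "dz (\<lambda>x. F x + G x) x = dz F x + dz G x" "dzb (\<lambda>x. F x + G x) x = dzb F x + dzb G x"
    "dw (\<lambda>x. F x + G x) x = dw F x + dw G x" "dwb (\<lambda>x. F x + G x) x = dwb F x + dwb G x" .
qed

lemma wirtinger_mult:
  assumes "F differentiable at x" "G differentiable at x"
  shows "dz (\<lambda>x. F x * G x) x = dz F x * G x + F x * dz G x" "dzb (\<lambda>x. F x * G x) x = dzb F x * G x + F x * dzb G x"
    "dw (\<lambda>x. F x * G x) x = dw F x * G x + F x * dw G x" "dwb (\<lambda>x. F x * G x) x = dwb F x * G x + F x * dwb G x"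
proof -
  have "((\<lambda>x. F x * G x) has_derivative (\<lambda>v. (dz F x * G x + F x * dz G x) * fst v
      + (dzb F x * G x + F x * dzb G x) * cnj (fst v)
      + (dw F x * G x + F x * dw G x) * snd v + (dwb F x * G x + F x * dwb G x) * cnj (snd v))) (at x)"
    using has_derivative_mult[OF wirtinger_has_derivative[OF assms(1)] wirtinger_has_derivative[OF assms(2)]]
    by (simp add: algebra_simps)
  from wirtinger_unique[OF this]
  show "dz (\<lambda>x. F x * G x) x = dz F x * G x + F x * dz G x" "dzb (\<lambda>x. F x * G x) x = dzb F x * G x + F x * dzb G x"
    "dw (\<lambda>x. F x * G x) x = dw F x * G x + F x * dw G x" "dwb (\<lambda>x. F x * G x) x = dwb F x * G x + F x * dwb G x" .
qed

lemma wirtinger_cnj: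
  assumes "F differentiable at x"
  shows "dz (\<lambda>x. cnj (F x)) x = cnj (dzb F x)" "dzb (\<lambda>x. cnj (F x)) x = cnj (dz F x)"
    "dw (\<lambda>x. cnj (F x)) x = cnj (dwb F x)" "dwb (\<lambda>x. cnj (F x)) x = cnj (dw F x)"
proof -
  have "((\<lambda>x. cnj (F x)) has_derivative (\<lambda>v. cnj (dzb F x) * fst v + cnj (dz F x) * cnj (fst v)
      + cnj (dwb F x) * snd v + cnj (dw F x) * cnj (snd v))) (at x)"
    using bounded_linear.has_derivative[OF bounded_linear_cnj wirtinger_has_derivative[OF assms(1)]]
    by (simp add: algebra_simps)
  from wirtinger_unique[OF this]
  show "dz (\<lambda>x. cnj (F x)) x = cnj (dzb F x)" "dzb (\<lambda>x. cnj (F x)) x = cnj (dz F x)"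
    "dw (\<lambda>x. cnj (F x)) x = cnj (dwb F x)" "dwb (\<lambda>x. cnj (F x)) x = cnj (dw F x)" .
qed

lemma wirtinger_coords:
  "dz fst x = 1" "dzb fst x = 0" "dw fst x = 0" "dwb fst x = 0"
  "dz snd x = 0" "dzb snd x = 0" "dw snd x = 1" "dwb snd x = 0"
  "dz (\<lambda>x. c) x = 0" "dzb (\<lambda>x. c) x = 0" "dw (\<lambda>x. c) x = 0" "dwb (\<lambda>x. c) x = 0"
proof -
  have "(fst has_derivative (\<lambda>v. 1 * fst v + 0 * cnj (fst v) + 0 * snd v + 0 * cnj (snd v))) (at x)"
    by (auto intro!: derivative_eq_intros)
  from wirtinger_unique[OF this] show "dz fst x = 1" "dzb fst x = 0" "dw fst x = 0" "dwb fst x = 0" .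
  have "(snd has_derivative (\<lambda>v. 0 * fst v + 0 * cnj (fst v) + 1 * snd v + 0 * cnj (snd v))) (at x)"
    by (auto intro!: derivative_eq_intros)
  from wirtinger_unique[OF this] show "dz snd x = 0" "dzb snd x = 0" "dw snd x = 1" "dwb snd x = 0" .
  show "dz (\<lambda>x. c) x = 0" "dzb (\<lambda>x. c) x = 0" "dw (\<lambda>x. c) x = 0" "dwb (\<lambda>x. c) x = 0"
    by (simp_all add: dz_def dzb_def dw_def dwb_def frechet_derivative_const)
qed

lemma cmonom_has_derivative:
  "(cmonom K a b c d has_derivative (\<lambda>v. cmonom (K * of_nat a) (a - 1) b c d x * fst v
     + cmonom (K * of_nat c) a b (c - 1) d x * cnj (fst v) + cmonom (K * of_nat b) a (b - 1) c d x * snd v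
     + cmonom (K * of_nat d) a b c (d - 1) x * cnj (snd v))) (at x)"
  unfolding cmonom_def[abs_def]
  by (auto intro!: derivative_eq_intros simp: algebra_simps)

lemmas wirtinger_cmonom = wirtinger_unique[OF cmonom_has_derivative, folded fun_eq_iff]

lemma BH_differentiable: "BH p q F \<Longrightarrow> F differentiable at x"
  by (induction rule: BH.induct) (auto intro: differentiableI[OF cmonom_has_derivative])

text \<open>Derivatives of monomials carry exponents such as \<open>a - 1\<close>. At
  \<open>a = 0\<close> the degree would be wrong, but there the coefficient is 0; the disjunction
  covers both situations.\<close>

lemma BH_cmonom_coeff:
  "K = 0 \<or> (a + b = p \<and> c + d = q) \<Longrightarrow> BH p q (cmonom K a b c d)"
proof (elim disjE)
  assume "K = 0"
  then have "cmonom K a b c d = (\<lambda>x. 0)" by (simp add: cmonom_def[abs_def])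
  then show ?thesis by (simp add: BH_zero)
qed (auto intro: BH_cmonom)

lemma BH_wirtinger:
  assumes "BH p q F"
  shows "BH (p - 1) q (dz F)" "BH (p - 1) q (dw F)" "BH p (q - 1) (dzb F)" "BH p (q - 1) (dwb F)"
proof -
  have "BH (p - 1) q (dz F) \<and> BH (p - 1) q (dw F) \<and> BH p (q - 1) (dzb F) \<and> BH p (q - 1) (dwb F)"
    using assms
  proof induction
    case (BH_cmonom a b p c d q K)
    then show ?case unfolding wirtinger_cmonom by (intro conjI BH_cmonom_coeff) auto
  next
    case (BH_add p q F G)
    have e: "dz (\<lambda>x. F x + G x) = (\<lambda>x. dz F x + dz G x)" "dw (\<lambda>x. F x + G x) = (\<lambda>x. dw F x + dw G x)"
      "dzb (\<lambda>x. F x + G x) = (\<lambda>x. dzb F x + dzb G x)" "dwb (\<lambda>x. F x + G x) = (\<lambda>x. dwb F x + dwb G x)"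
      using BH_add by (auto simp: fun_eq_iff wirtinger_add BH_differentiable)
    show ?case unfolding e using BH_add by (auto intro: BH.BH_add)
  qed
  then show "BH (p - 1) q (dz F)" "BH (p - 1) q (dw F)" "BH p (q - 1) (dzb F)" "BH p (q - 1) (dwb F)" by auto
qed

lemma cmonom_zero: "cmonom 0 a b c d x = 0"
  by (simp add: cmonom_def)

lemma BH_wirtinger_zero:
  "BH 0 q F \<Longrightarrow> dz F x = 0 \<and> dw F x = 0"
  "BH p 0 F \<Longrightarrow> dzb F x = 0 \<and> dwb F x = 0"
proof -
  have "(p = 0 \<longrightarrow> dz F x = 0 \<and> dw F x = 0) \<and> (q = 0 \<longrightarrow> dzb F x = 0 \<and> dwb F x = 0)" if "BH p q F" for p q F
    using that
    by induction (auto simp: wirtinger_cmonom wirtinger_add BH_differentiable cmonom_zero)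
  then show "BH 0 q F \<Longrightarrow> dz F x = 0 \<and> dw F x = 0"
  "BH p 0 F \<Longrightarrow> dzb F x = 0 \<and> dwb F x = 0" by auto
qed

lemma BH_commute:
  assumes "BH p q F"
  shows "dz (dzb F) x = dzb (dz F) x" "dz (dwb F) x = dwb (dz F) x" "dw (dzb F) x = dzb (dw F) x"
    "dw (dwb F) x = dwb (dw F) x" "dwb (dzb F) x = dzb (dwb F) x" "dw (dz F) x = dz (dw F) x"
proof -
  have "dz (dzb F) x = dzb (dz F) x \<and> dz (dwb F) x = dwb (dz F) x \<and> dw (dzb F) x = dzb (dw F) x \<and>
    dw (dwb F) x = dwb (dw F) x \<and> dwb (dzb F) x = dzb (dwb F) x \<and> dw (dz F) x = dz (dw F) x" (is "?P F")
    using assms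
  proof induction
    case (BH_cmonom a b p c d q K)
    then show ?case unfolding wirtinger_cmonom by (simp add: mult_ac)
  next
    case (BH_add p q F G)
    have e: "dz (\<lambda>x. F x + G x) = (\<lambda>x. dz F x + dz G x)" "dw (\<lambda>x. F x + G x) = (\<lambda>x. dw F x + dw G x)"
      "dzb (\<lambda>x. F x + G x) = (\<lambda>x. dzb F x + dzb G x)" "dwb (\<lambda>x. F x + G x) = (\<lambda>x. dwb F x + dwb G x)"
      using BH_add by (auto simp: fun_eq_iff wirtinger_add BH_differentiable)
    show ?case unfolding e using BH_add
      by (simp add: wirtinger_add BH_wirtinger[THEN BH_differentiable])
  qed
  then show "dz (dzb F) x = dzb (dz F) x" "dz (dwb F) x = dwb (dz F) x" "dw (dzb F) x = dzb (dw F) x"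
    "dw (dwb F) x = dwb (dw F) x" "dwb (dzb F) x = dzb (dwb F) x" "dw (dz F) x = dz (dw F) x" by auto
qed

lemma BH_Euler:
  assumes "BH p q F"
  shows "fst x * dz F x + snd x * dw F x = of_nat p * F x"
    "cnj (fst x) * dzb F x + cnj (snd x) * dwb F x = of_nat q * F x"
proof -
  have "fst x * dz F x + snd x * dw F x = of_nat p * F x \<and>
    cnj (fst x) * dzb F x + cnj (snd x) * dwb F x = of_nat q * F x" using assms
  proof induction
    case (BH_cmonom a b p c d q K)
    have "fst x * cmonom (K * of_nat a) (a - 1) b c d x = of_nat a * cmonom K a b c d x"
      "snd x * cmonom (K * of_nat b) a (b - 1) c d x = of_nat b * cmonom K a b c d x"
      "cnj (fst x) * cmonom (K * of_nat c) a b (c - 1) d x = of_nat c * cmonom K a b c d x"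
      "cnj (snd x) * cmonom (K * of_nat d) a b c (d - 1) x = of_nat d * cmonom K a b c d x"
      unfolding cmonom_def
      subgoal by (cases a) (auto simp: mult_ac)
      subgoal by (cases b) (auto simp: mult_ac)
      subgoal by (cases c) (auto simp: mult_ac)
      subgoal by (cases d) (auto simp: mult_ac)
      done
    then show ?case unfolding wirtinger_cmonom using BH_cmonom by (auto simp: distrib_right)
  next
    case (BH_add p q F G)
    have "F differentiable at x" "G differentiable at x" using BH_add BH_differentiable by auto
    then show ?case using BH_add by (simp add: wirtinger_add) (simp add: algebra_simps)
  qed
  then show "fst x * dz F x + snd x * dw F x = of_nat p * F x"
    "cnj (fst x) * dzb F x + cnj (snd x) * dwb F x = of_nat q * F x" by auto
qed

section \<open>Spherical harmonics\<close>

definition hpoly :: "nat \<Rightarrow> nat \<Rightarrow> (pt \<Rightarrow> complex) \<Rightarrow> bool" where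
  "hpoly p q F \<longleftrightarrow> BH p q F \<and> (\<forall>x. dz (dzb F) x + dw (dwb F) x = 0)"

lemma Hpq_iff_hpoly: "h \<in> Hpq p q \<longleftrightarrow> (\<exists>F. hpoly p q F \<and> (\<forall>x\<in>S3. h x = F x))"
  unfolding Hpq_def hpoly_def BH_iff_bihom by auto

lemma wirtinger_diff:
  assumes "F differentiable at x" "G differentiable at x"
  shows "dz (\<lambda>x. F x - G x) x = dz F x - dz G x" "dzb (\<lambda>x. F x - G x) x = dzb F x - dzb G x"
    "dw (\<lambda>x. F x - G x) x = dw F x - dw G x" "dwb (\<lambda>x. F x - G x) x = dwb F x - dwb G x"
proof -
  have "(\<lambda>x. - 1 * G x) differentiable at x" using assms(2) by simp
  note * = wirtinger_add[OF assms(1) this] wirtinger_mult[OF differentiable_const[of "-1"] assms(2)]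
  show "dz (\<lambda>x. F x - G x) x = dz F x - dz G x" "dzb (\<lambda>x. F x - G x) x = dzb F x - dzb G x"
    "dw (\<lambda>x. F x - G x) x = dw F x - dw G x" "dwb (\<lambda>x. F x - G x) x = dwb F x - dwb G x"
    using * by (simp_all add: wirtinger_coords)
qed

lemma differentiable_coords: "fst differentiable at x" "snd differentiable at x"
  "(\<lambda>x. cnj (fst x)) differentiable at x" "(\<lambda>x. cnj (snd x)) differentiable at x" for x :: pt
  using BH_coords[THEN BH_differentiable] by blast+

lemma BH_differentiable2:
  assumes "BH p q F"
  shows "F differentiable at x"
    "dz F differentiable at x" "dw F differentiable at x" "dzb F differentiable at x" "dwb F differentiable at x"
    "dz (dzb F) differentiable at x" "dz (dwb F) differentiable at x"
    "dw (dzb F) differentiable at x" "dw (dwb F) differentiable at x"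
    "dzb (dzb F) differentiable at x" "dzb (dwb F) differentiable at x"
    "dwb (dzb F) differentiable at x" "dwb (dwb F) differentiable at x"
    "dzb (dz F) differentiable at x" "dzb (dw F) differentiable at x"
    "dwb (dz F) differentiable at x" "dwb (dw F) differentiable at x"
  by (auto intro: assms BH_differentiable BH_wirtinger[OF assms, THEN BH_differentiable]
     BH_wirtinger[OF BH_wirtinger(1)[OF assms], THEN BH_differentiable]
     BH_wirtinger[OF BH_wirtinger(2)[OF assms], THEN BH_differentiable]
     BH_wirtinger[OF BH_wirtinger(3)[OF assms], THEN BH_differentiable]
     BH_wirtinger[OF BH_wirtinger(4)[OF assms], THEN BH_differentiable])

lemma hpoly_cmult: "hpoly p q F \<Longrightarrow> hpoly p q (\<lambda>x. c * F x)"
proof -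
  assume a: "hpoly p q F"
  then have F: "BH p q F" by (auto simp: hpoly_def)
  have e: "dzb (\<lambda>x. c * F x) = (\<lambda>x. c * dzb F x)" "dwb (\<lambda>x. c * F x) = (\<lambda>x. c * dwb F x)"
    by (rule ext, simp add: wirtinger_mult wirtinger_coords BH_differentiable2[OF F])+
  have "dz (dzb (\<lambda>x. c * F x)) x + dw (dwb (\<lambda>x. c * F x)) x
     = c * (dz (dzb F) x + dw (dwb F) x)" for x
    unfolding e by (simp add: wirtinger_mult wirtinger_coords BH_differentiable2[OF F] distrib_left)
  then show ?thesis using a by (simp add: hpoly_def BH_cmult)
qed

lemma hpoly_cnj: "hpoly p q F \<Longrightarrow> hpoly q p (\<lambda>x. cnj (F x))"
proof -
  assume a: "hpoly p q F"
  then have F: "BH p q F" by (auto simp: hpoly_def)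
  have e: "dzb (\<lambda>x. cnj (F x)) = (\<lambda>x. cnj (dz F x))" "dwb (\<lambda>x. cnj (F x)) = (\<lambda>x. cnj (dw F x))"
    by (rule ext, simp add: wirtinger_cnj BH_differentiable2[OF F])+
  have "dz (dzb (\<lambda>x. cnj (F x))) x + dw (dwb (\<lambda>x. cnj (F x))) x
     = cnj (dz (dzb F) x + dw (dwb F) x)" for x
    unfolding e by (simp add: wirtinger_cnj BH_differentiable2[OF F] BH_commute[OF F])
  moreover have "dz (dzb F) x + dw (dwb F) x = 0" for x using a by (simp add: hpoly_def)
  ultimately show ?thesis by (simp only: hpoly_def BH_cnj[OF F] complex_cnj_zero simp_thms)
qed

text \<open>\<open>dzb\<close> and \<open>dwb\<close> commute with the Laplacian. For
  \<open>q = 0\<close> both derivatives vanish, so the truncated index does no harm.\<close>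

lemma hpoly_bar_derivative:
  assumes "hpoly p q F"
  shows "hpoly p (q - 1) (dzb F)" "hpoly p (q - 1) (dwb F)"
proof -
  have F: "BH p q F" and L: "\<And>x. dz (dzb F) x + dw (dwb F) x = 0" using assms by (auto simp: hpoly_def)
  note d = BH_differentiable2[OF F]
  have c: "dwb (dzb F) = dzb (dwb F)" by (rule ext) (rule BH_commute[OF F])
  have L0: "(\<lambda>x. dz (dzb F) x + dw (dwb F) x) = (\<lambda>x. 0)" using L by blast
  have "dz (dzb (dzb F)) x + dw (dwb (dzb F)) x = 0" for x
  proof -
    have "dz (dzb (dzb F)) x + dw (dwb (dzb F)) x = dzb (dz (dzb F)) x + dzb (dw (dwb F)) x"
      unfolding c by (simp add: BH_commute[OF BH_wirtinger(3)[OF F]] BH_commute[OF BH_wirtinger(4)[OF F]])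
    also have "\<dots> = dzb (\<lambda>x. dz (dzb F) x + dw (dwb F) x) x" by (simp add: wirtinger_add d)
    finally show ?thesis by (simp add: L0 wirtinger_coords)
  qed
  then show "hpoly p (q - 1) (dzb F)" using BH_wirtinger(3)[OF F] unfolding hpoly_def by blast
  have "dz (dzb (dwb F)) x + dw (dwb (dwb F)) x = 0" for x
  proof -
    have "dz (dzb (dwb F)) x + dw (dwb (dwb F)) x = dwb (dz (dzb F)) x + dwb (dw (dwb F)) x"
      unfolding c[symmetric] by (simp add: BH_commute[OF BH_wirtinger(3)[OF F]] BH_commute[OF BH_wirtinger(4)[OF F]])
    also have "\<dots> = dwb (\<lambda>x. dz (dzb F) x + dw (dwb F) x) x" by (simp add: wirtinger_add d)
    finally show ?thesis by (simp add: L0 wirtinger_coords)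
  qed
  then show "hpoly p (q - 1) (dwb F)" using BH_wirtinger(4)[OF F] unfolding hpoly_def by blast
qed

section \<open>The fields on harmonic polynomials\<close>

definition PZ :: "(pt \<Rightarrow> complex) \<Rightarrow> pt \<Rightarrow> complex" where
  "PZ F x = cnj (snd x) * dz F x - cnj (fst x) * dw F x"
definition PZb :: "(pt \<Rightarrow> complex) \<Rightarrow> pt \<Rightarrow> complex" where
  "PZb F x = snd x * dzb F x - fst x * dwb F x"

text \<open>The Laplacian of \<open>snd x * dzb F x\<close> produces the cross term
  \<open>dwb (dzb F) x\<close>, that of \<open>fst x * dwb F x\<close> the cross term
  \<open>dzb (dwb F) x\<close>. These cancel, and the rest are multiples of Laplacians of harmonic
  derivatives.\<close>

lemma hpoly_PZb:
  assumes "hpoly p q F"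
  shows "hpoly (Suc p) (q - 1) (PZb F)"
proof -
  have F: "BH p q F" using assms by (auto simp: hpoly_def)
  note d = BH_differentiable2[OF F] differentiable_coords
  note w = wirtinger_diff wirtinger_mult wirtinger_coords
  have e: "dzb (PZb F) = (\<lambda>x. snd x * dzb (dzb F) x - fst x * dzb (dwb F) x)"
    "dwb (PZb F) = (\<lambda>x. snd x * dwb (dzb F) x - fst x * dwb (dwb F) x)"
    unfolding PZb_def[abs_def] by (rule ext, simp add: w d)+
  have L: "dz (dzb (dzb F)) x = - dw (dwb (dzb F)) x" "dw (dwb (dwb F)) x = - dz (dzb (dwb F)) x" for x
    using hpoly_bar_derivative[OF assms] by (auto simp: hpoly_def eq_neg_iff_add_eq_0 add.commute)
  have "dz (dzb (PZb F)) x + dw (dwb (PZb F)) x = 0" for x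
    unfolding e by (simp add: w d L) (simp add: BH_commute[OF F])
  moreover have "BH (1 + p) (0 + (q - 1)) (PZb F)"
    unfolding PZb_def[abs_def] by (intro BH_diff BH_mult BH_coords BH_wirtinger F)
  ultimately show ?thesis by (simp add: hpoly_def)
qed

lemma PZb_zero: "BH p 0 F \<Longrightarrow> PZb F x = 0"
  by (simp add: PZb_def BH_wirtinger_zero)

text \<open>Harmonicity turns the second-order part into holomorphic Euler operators on
  \<open>dzb F\<close> and \<open>dwb F\<close>, contributing the factor p; what remains is the
  conjugate Euler operator on \<open>F\<close>, contributing q. Together this is - p q - q.\<close>

lemma PZ_PZb:
  assumes "hpoly p q F"
  shows "PZ (PZb F) x = - (of_nat q * (of_nat p + 1)) * F x"
proof -
  have F: "BH p q F" and L: "\<And>x. dw (dwb F) x = - dz (dzb F) x"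
    using assms by (auto simp: hpoly_def eq_neg_iff_add_eq_0 add.commute)
  note d = BH_differentiable2[OF F] differentiable_coords
  note w = wirtinger_diff wirtinger_mult wirtinger_coords
  define z w u v where "z = fst x" and "w = snd x" and "u = cnj z" and "v = cnj w"
  note zw = z_def[symmetric] w_def[symmetric] u_def[symmetric] v_def[symmetric]
  have 1: "z * dz (dzb F) x + w * dw (dzb F) x = of_nat p * dzb F x"
    "z * dz (dwb F) x + w * dw (dwb F) x = of_nat p * dwb F x"
    "u * dzb F x + v * dwb F x = of_nat q * F x"
    unfolding u_def v_def z_def w_def
    using BH_Euler(1)[OF BH_wirtinger(3)[OF F]] BH_Euler(1)[OF BH_wirtinger(4)[OF F]] BH_Euler(2)[OF F] by auto
  have "PZ (PZb F) x = v * (w * dz (dzb F) x - dwb F x - z * dz (dwb F) x)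
      - u * (dzb F x + w * dw (dzb F) x - z * dw (dwb F) x)"
    unfolding PZ_def PZb_def[abs_def] by (simp add: w d zw algebra_simps)
  also have "\<dots> = - (u * (z * dz (dzb F) x + w * dw (dzb F) x) + v * (z * dz (dwb F) x + w * dw (dwb F) x))
     - (u * dzb F x + v * dwb F x)"
    by (simp add: L algebra_simps)
  also have "\<dots> = - of_nat p * (u * dzb F x + v * dwb F x) - (u * dzb F x + v * dwb F x)"
    unfolding 1(1,2) by (simp add: algebra_simps)
  also have "\<dots> = - (of_nat q * (of_nat p + 1)) * F x" unfolding 1(3) by (simp add: algebra_simps)
  finally show ?thesis .
qed

lemma normalization_has_derivative:
  assumes "x \<in> S3"
  shows "((\<lambda>y. scaleR (1 / norm y) y) has_derivative (\<lambda>v. v - (x \<bullet> v) *\<^sub>R x)) (at x)"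
proof -
  have n: "norm x = 1" and nz: "x \<noteq> 0" using assms by (auto simp: S3_def)
  have "(norm has_derivative (\<lambda>v. v \<bullet> sgn x)) (at x)" using has_derivative_norm[of x] nz by simp
  then have d: "(norm has_derivative (\<lambda>v. x \<bullet> v)) (at x)"
    using n by (simp add: sgn_div_norm inner_commute)
  show ?thesis
    by (rule has_derivative_eq_rhs[OF has_derivative_scaleR[OF has_derivative_divide[OF has_derivative_const d] has_derivative_ident]])
      (use n in \<open>auto simp: fun_eq_iff\<close>)
qed

text \<open>On the sphere the differential of the normalisation is the orthogonal projection onto
  the tangent space, so a tangential direction differentiates \<open>hext F\<close> as it does
  \<open>F\<close>. This links the fields to \<open>PZ\<close> and \<open>PZb\<close>.\<close>

lemma Dir_tangential:
  assumes "F differentiable at x" "x \<in> S3" "x \<bullet> M x = 0"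
  shows "Dir M F x = frechet_derivative F (at x) (M x)"
proof -
  have "((\<lambda>y. F (scaleR (1 / norm y) y)) has_derivative
      (\<lambda>v. frechet_derivative F (at x) (v - (x \<bullet> v) *\<^sub>R x))) (at x)"
  proof (rule has_derivative_compose[OF normalization_has_derivative[OF assms(2)]])
    show "(F has_derivative frechet_derivative F (at x)) (at (scaleR (1 / norm x) x))"
      using assms by (simp add: S3_def frechet_derivative_works)
  qed
  then have "frechet_derivative (hext F) (at x) = (\<lambda>v. frechet_derivative F (at x) (v - (x \<bullet> v) *\<^sub>R x))"
    unfolding hext_def[abs_def] by (rule frechet_derivative_at[symmetric])
  then show ?thesis by (simp add: Dir_def assms(3))
qed

lemma smooth_S3_BH: "BH p q F \<Longrightarrow> smooth_S3 F"
  by (induction rule: BH.induct) (auto simp: cmonom_def[abs_def] intro!: smooth_S3_intros)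

lemma fields_BH:
  assumes "BH p q F" "x \<in> S3"
  shows "Z1 F x = PZ F x" "Z1b F x = PZb F x" "Treeb F x = \<i> * (of_nat p - of_nat q) * F x"
proof -
  note d = BH_differentiable[OF assms(1)]
  note f = fields_Dir[OF smooth_S3_BH[OF assms(1)] S3_nonzero[OF assms(2)]]
    Dir_tangential[where F=F and M=M1, OF d assms(2) M_isometry(3)] Dir_tangential[where F=F and M=M2, OF d assms(2) M_isometry(6)]
    Dir_tangential[where F=F and M=M0, OF d assms(2) M_isometry(9)] wirtinger_expand[OF d]
  show "Z1 F x = PZ F x" "Z1b F x = PZb F x"
    unfolding f PZ_def PZb_def M1_def M2_def by (simp_all add: field_simps)
  have "Treeb F x = \<i> * (fst x * dz F x + snd x * dw F x) - \<i> * (cnj (fst x) * dzb F x + cnj (snd x) * dwb F x)"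
    unfolding f M0_def by (simp add: algebra_simps)
  then show "Treeb F x = \<i> * (of_nat p - of_nat q) * F x"
    unfolding BH_Euler[OF assms(1)] by (simp add: algebra_simps)
qed

lemma Hpq_cong: "h \<in> Hpq p q \<Longrightarrow> (\<And>x. x \<in> S3 \<Longrightarrow> h x = g x) \<Longrightarrow> g \<in> Hpq p q"
  by (auto simp: Hpq_iff_hpoly)

lemma hpoly_in_Hpq: "hpoly p q F \<Longrightarrow> F \<in> Hpq p q"
  by (auto simp: Hpq_iff_hpoly)

lemma Hpq_smooth: "h \<in> Hpq p q \<Longrightarrow> smooth_S3 h"
  unfolding Hpq_iff_hpoly hpoly_def using smooth_S3_BH smooth_S3_cong by blast

lemma Hpq_cmult: "h \<in> Hpq p q \<Longrightarrow> (\<lambda>x. c * h x) \<in> Hpq p q"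
  unfolding Hpq_iff_hpoly by (metis (no_types, lifting) hpoly_cmult)

lemma Hpq_cnj: "h \<in> Hpq p q \<Longrightarrow> (\<lambda>x. cnj (h x)) \<in> Hpq q p"
  unfolding Hpq_iff_hpoly by (metis (no_types, lifting) hpoly_cnj)

text \<open>For \<open>q = 0\<close> the image is the zero function on the sphere, which belongs to
  every \<open>Hpq\<close>; the truncated index is therefore harmless, and likewise the one in
  \<open>Hpq_Z1\<close>.\<close>

lemma Hpq_Z1b: "h \<in> Hpq p q \<Longrightarrow> Z1b h \<in> Hpq (Suc p) (q - 1)"
proof -
  assume h: "h \<in> Hpq p q"
  then obtain F where F: "hpoly p q F" "\<And>x. x \<in> S3 \<Longrightarrow> h x = F x" by (auto simp: Hpq_iff_hpoly)
  have "Z1b h x = PZb F x" if "x \<in> S3" for x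
    using Z1b_cong[of h F, OF F(2) Hpq_smooth[OF h] that] fields_BH(2)[of p q F, OF _ that] F(1)
    by (simp add: hpoly_def)
  then show ?thesis using hpoly_PZb[OF F(1)] by (auto simp: Hpq_iff_hpoly)
qed

lemma Hpq_Z1: "h \<in> Hpq p q \<Longrightarrow> Z1 h \<in> Hpq (p - 1) (Suc q)"
proof -
  assume h: "h \<in> Hpq p q"
  have "(\<lambda>x. cnj (Z1b (\<lambda>x. cnj (h x)) x)) \<in> Hpq (p - 1) (Suc q)"
    by (intro Hpq_cnj Hpq_Z1b h)
  then show ?thesis
    by (rule Hpq_cong) (simp add: fields_cnj Hpq_smooth[OF h])
qed

lemma Hpq_Z1b_zero: "h \<in> Hpq p 0 \<Longrightarrow> x \<in> S3 \<Longrightarrow> Z1b h x = 0"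
proof -
  assume h: "h \<in> Hpq p 0" and x: "x \<in> S3"
  then obtain F where F: "hpoly p 0 F" "\<And>x. x \<in> S3 \<Longrightarrow> h x = F x" by (auto simp: Hpq_iff_hpoly)
  then show ?thesis
    using Z1b_cong[of h F, OF F(2) Hpq_smooth[OF h] x] fields_BH(2)[of p 0 F, OF _ x] PZb_zero[of p F x]
    by (simp add: hpoly_def)
qed

lemma Hpq_Z1_Z1b:
  assumes h: "h \<in> Hpq p q" and x: "x \<in> S3"
  shows "Z1 (Z1b h) x = - (of_nat q * (of_nat p + 1)) * h x"
proof -
  obtain F where F: "hpoly p q F" "\<And>x. x \<in> S3 \<Longrightarrow> h x = F x" using h by (auto simp: Hpq_iff_hpoly)
  then have BF: "BH p q F" by (simp add: hpoly_def)
  have G: "BH (Suc p) (q - 1) (PZb F)" using hpoly_PZb[OF F(1)] by (simp add: hpoly_def)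
  have "Z1b h y = PZb F y" if "y \<in> S3" for y
    using Z1b_cong[of h F, OF F(2) Hpq_smooth[OF h] that] fields_BH(2)[OF BF that] by simp
  then have "Z1 (Z1b h) x = Z1 (PZb F) x"
    using Z1_cong[of "Z1b h" "PZb F", OF _ _ x] smooth_S3_fields(2)[OF Hpq_smooth[OF h]] by blast
  then show ?thesis using fields_BH(1)[OF G x] PZ_PZb[OF F(1)] F(2)[OF x] by simp
qed

lemma Hpq_Treeb:
  assumes h: "h \<in> Hpq p q" and x: "x \<in> S3"
  shows "Treeb h x = \<i> * (of_nat p - of_nat q) * h x"
proof -
  obtain F where F: "hpoly p q F" "\<And>x. x \<in> S3 \<Longrightarrow> h x = F x" using h by (auto simp: Hpq_iff_hpoly)
  then show ?thesis
    using Treeb_cong[of h F, OF F(2) Hpq_smooth[OF h] x] fields_BH(3)[of p q F, OF _ x] x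
    by (simp add: hpoly_def)
qed

section \<open>Splitting polynomials into harmonics, and completeness\<close>

definition n2 :: "pt \<Rightarrow> complex" where
  "n2 x = fst x * cnj (fst x) + snd x * cnj (snd x)"

lemma BH_n2: "BH 1 1 n2"
  unfolding n2_def[abs_def]
  using BH_add[OF BH_mult[OF BH_coords(1,3)] BH_mult[OF BH_coords(2,4)]] by simp

text \<open>\<open>n2\<close> has Laplacian 2, the mixed terms are the two Euler operators on
  \<open>G\<close>, and the last term contains the Laplacian of \<open>G\<close>.\<close>

lemma laplace_n2:
  assumes "hpoly p q G"
  shows "dz (dzb (\<lambda>x. n2 x * G x)) x + dw (dwb (\<lambda>x. n2 x * G x)) x = (of_nat p + of_nat q + 2) * G x"
proof -
  have G: "BH p q G" and L: "\<And>x. dz (dzb G) x = - dw (dwb G) x"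
    using assms by (auto simp: hpoly_def eq_neg_iff_add_eq_0)
  note d = BH_differentiable2[OF G] differentiable_coords BH_differentiable[OF BH_n2]
  note w = wirtinger_add wirtinger_mult wirtinger_coords wirtinger_cnj
  have n: "dzb n2 = fst" "dwb n2 = snd" "dz n2 = (\<lambda>x. cnj (fst x))" "dw n2 = (\<lambda>x. cnj (snd x))"
    unfolding n2_def[abs_def] by (rule ext, simp add: w d)+
  have e: "dzb (\<lambda>x. n2 x * G x) = (\<lambda>x. fst x * G x + n2 x * dzb G x)"
    "dwb (\<lambda>x. n2 x * G x) = (\<lambda>x. snd x * G x + n2 x * dwb G x)"
    by (rule ext, simp add: w d n)+
  have "dz (dzb (\<lambda>x. n2 x * G x)) x + dw (dwb (\<lambda>x. n2 x * G x)) x =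
     2 * G x + (fst x * dz G x + snd x * dw G x) + (cnj (fst x) * dzb G x + cnj (snd x) * dwb G x)"
    unfolding e by (simp add: w d n L algebra_simps)
  then show ?thesis unfolding BH_Euler[OF G] by (simp add: algebra_simps)
qed

text \<open>The constant \<open>k\<close> comes from \<open>\<Delta> (n2 G) = (p + q + 1) G\<close> for harmonic \<open>G\<close> of bidegree \<open>(p, q - 1)\<close>,
  with \<open>\<Delta> = dz dzb + dw dwb\<close>. Since \<open>n2 = 1\<close> on the sphere, this writes \<open>c F\<close> there as a sum of spherical harmonics.\<close>

lemma Hpq_times_coord_aux:
  assumes F: "hpoly p q F" and G: "hpoly p (q - 1) G" "q = 0 \<longrightarrow> G = (\<lambda>x. 0)" and c: "BH 1 0 c"
    and L: "\<And>x. dz (dzb (\<lambda>x. c x * F x)) x + dw (dwb (\<lambda>x. c x * F x)) x = G x"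
    and k: "k * (of_nat p + of_nat q + 1) = 1"
  shows "hpoly (Suc p) q (\<lambda>x. c x * F x - k * (n2 x * G x))"
proof -
  have BF: "BH p q F" and BG: "BH p (q - 1) G" using F G by (auto simp: hpoly_def)
  have cF: "BH (Suc p) q (\<lambda>x. c x * F x)" using BH_mult[OF c BF] by simp
  have nG: "BH (Suc p) q (\<lambda>x. n2 x * G x)"
  proof (cases q)
    case 0
    then show ?thesis using G(2) by (simp add: BH_zero)
  next
    case (Suc n)
    then show ?thesis using BH_mult[OF BH_n2 BG] by simp
  qed
  have knG: "BH (Suc p) q (\<lambda>x. k * (n2 x * G x))" by (rule BH_cmult[OF nG])
  define A where "A = (\<lambda>x. c x * F x)"
  define B where "B = (\<lambda>x. n2 x * G x)"
  note d = BH_differentiable2[OF cF, folded A_def] BH_differentiable2[OF nG, folded B_def]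
  note w = wirtinger_diff wirtinger_mult[OF differentiable_const] wirtinger_coords
  have e: "dzb (\<lambda>x. A x - k * B x) = (\<lambda>x. dzb A x - k * dzb B x)"
    "dwb (\<lambda>x. A x - k * B x) = (\<lambda>x. dwb A x - k * dwb B x)"
    by (rule ext, simp add: w d)+
  have "dz (dzb (\<lambda>x. A x - k * B x)) x + dw (dwb (\<lambda>x. A x - k * B x)) x
     = (dz (dzb A) x + dw (dwb A) x) - k * (dz (dzb B) x + dw (dwb B) x)" for x
    unfolding e by (simp add: w d) (simp add: algebra_simps)
  \<comment> \<open>\<open>G\<close> has second degree \<open>q - 1\<close>, so its factor from
    \<open>laplace_n2\<close> is p + q + 1, the inverse of \<open>k\<close>. For
    \<open>q = 0\<close> the truncated index is off by one, but then \<open>G\<close> is 0.\<close>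
  moreover have "G x - k * ((of_nat p + of_nat (q - 1) + 2) * G x) = 0" for x
  proof (cases q)
    case 0
    then show ?thesis using G(2) by simp
  next
    case (Suc n)
    have "of_nat p + of_nat (q - 1) + 2 = (of_nat p + of_nat q + 1 :: complex)" using Suc by simp
    then have "G x - k * ((of_nat p + of_nat (q - 1) + 2) * G x) = G x - (k * (of_nat p + of_nat q + 1)) * G x"
      by (simp only: mult.assoc)
    then show ?thesis by (simp add: k)
  qed
  moreover have "BH (Suc p) q (\<lambda>x. A x - k * B x)"
    unfolding A_def B_def by (rule BH_diff[OF cF knG])
  moreover have "dz (dzb A) x + dw (dwb A) x = G x"
    "dz (dzb B) x + dw (dwb B) x = (of_nat p + of_nat (q - 1) + 2) * G x" for x
    unfolding A_def B_def using L laplace_n2[OF G(1)] by blast+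
  ultimately have "hpoly (Suc p) q (\<lambda>x. A x - k * B x)" by (simp add: hpoly_def)
  then show ?thesis unfolding A_def B_def .
qed

text \<open>For harmonic \<open>F\<close> the Laplacian of z F is \<open>dzb F\<close> and that of w
  F is \<open>dwb F\<close>, again harmonic, so a single correction restores harmonicity. Iterated,
  this puts every polynomial into the span of the harmonics.\<close>

lemma Hpq_times_coord:
  assumes "h \<in> Hpq p q" and c: "c = fst \<or> c = snd"
  shows "\<exists>f g. f \<in> Hpq (Suc p) q \<and> g \<in> Hpq p (q - 1) \<and> (\<forall>x. c x * h x = f x + g x)"
proof -
  obtain F where F: "hpoly p q F" "\<And>x. x \<in> S3 \<Longrightarrow> h x = F x" using assms by (auto simp: Hpq_iff_hpoly)
  have BF: "BH p q F" and L: "\<And>x. dz (dzb F) x = - dw (dwb F) x"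
    using F by (auto simp: hpoly_def eq_neg_iff_add_eq_0)
  note d = BH_differentiable2[OF BF] differentiable_coords
  note w = wirtinger_add wirtinger_mult wirtinger_coords
  have Bc: "BH 1 0 c" using c BH_coords by auto
  define G where "G = (if c = fst then dzb F else dwb F)"
  have G: "hpoly p (q - 1) G" using hpoly_bar_derivative[OF F(1)] by (simp add: G_def)
  have G0: "q = 0 \<longrightarrow> G = (\<lambda>x. 0)" using BH_wirtinger_zero(2)[of p F] BF by (auto simp: G_def)
  have "dz (dzb (\<lambda>x. c x * F x)) x + dw (dwb (\<lambda>x. c x * F x)) x = G x" for x
    using c
  proof
    assume c: "c = fst"
    have e: "dzb (\<lambda>x. c x * F x) = (\<lambda>x. fst x * dzb F x)" "dwb (\<lambda>x. c x * F x) = (\<lambda>x. fst x * dwb F x)"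
      unfolding c by (rule ext, simp add: w d)+
    show ?thesis unfolding e by (simp add: w d L G_def c)
  next
    assume c: "c = snd"
    have ne: "snd \<noteq> (fst :: pt \<Rightarrow> complex)"
      by (metis fst_conv snd_conv zero_neq_one)
    have e: "dzb (\<lambda>x. c x * F x) = (\<lambda>x. snd x * dzb F x)" "dwb (\<lambda>x. c x * F x) = (\<lambda>x. snd x * dwb F x)"
      unfolding c by (rule ext, simp add: w d)+
    show ?thesis unfolding e by (simp add: w d L G_def c ne)
  qed
  note H = Hpq_times_coord_aux[OF F(1) G G0 Bc this]
  define k where "k = 1 / (of_nat p + of_nat q + 1 :: complex)"
  have "of_nat p + of_nat q + 1 \<noteq> (0::complex)"
    by (metis Suc_eq_plus1 nat.distinct(1) of_nat_1 of_nat_add of_nat_eq_0_iff)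
  then have k: "k * (of_nat p + of_nat q + 1) = 1" by (simp add: k_def)
  have "(\<lambda>x. k * G x) \<in> Hpq p (q - 1)" by (rule hpoly_in_Hpq[OF hpoly_cmult[OF G]])
  moreover have "(\<lambda>x. c x * h x - k * G x) \<in> Hpq (Suc p) q"
    using hpoly_in_Hpq[OF H[OF k]]
    by (rule Hpq_cong) (use F(2) S3_iff in \<open>simp add: n2_def\<close>)
  ultimately show ?thesis by (intro exI[of _ "\<lambda>x. c x * h x - k * G x"] exI[of _ "\<lambda>x. k * G x"]) simp
qed

text \<open>The filter \<open>Q\<close> restricts the second index only, because the alternative q
  \<le> 1 or q \<ge> 2 is all that distinguishes \<open>D0perp\<close> from
  \<open>D0\<close>.\<close>

inductive hspan :: "(nat \<Rightarrow> bool) \<Rightarrow> (pt \<Rightarrow> complex) \<Rightarrow> bool" for Q where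
  hspan_zero: "hspan Q (\<lambda>x. 0)"
| hspan_base: "h \<in> Hpq p q \<Longrightarrow> Q q \<Longrightarrow> hspan Q h"
| hspan_add: "hspan Q f \<Longrightarrow> hspan Q g \<Longrightarrow> hspan Q (\<lambda>x. f x + g x)"

abbreviation hspan_all where "hspan_all \<equiv> hspan (\<lambda>q. True)"

lemma hspan_cmult: "hspan Q f \<Longrightarrow> hspan Q (\<lambda>x. c * f x)"
  by (induction rule: hspan.induct) (auto intro: hspan_zero hspan_base Hpq_cmult hspan_add simp: distrib_left)

lemma hspan_smooth: "hspan Q f \<Longrightarrow> smooth_S3 f"
  by (induction rule: hspan.induct) (auto intro: Hpq_smooth smooth_S3_add smooth_S3_const)

lemma hspan_cnj: "hspan_all f \<Longrightarrow> hspan_all (\<lambda>x. cnj (f x))"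
  by (induction rule: hspan.induct) (auto intro: hspan_zero hspan_base Hpq_cnj hspan_add)

lemma hspan_coord:
  assumes "hspan_all h" "c = fst \<or> c = snd"
  shows "hspan_all (\<lambda>x. c x * h x)"
  using assms(1)
proof induction
  case hspan_zero
  then show ?case by (simp add: hspan.hspan_zero)
next
  case (hspan_base h p q)
  obtain f g where f: "f \<in> Hpq (Suc p) q" "g \<in> Hpq p (q - 1)" "\<forall>x. c x * h x = f x + g x"
    using Hpq_times_coord[OF hspan_base(1) assms(2)] by blast
  have "hspan_all (\<lambda>x. f x + g x)"
    by (rule hspan_add[OF hspan.hspan_base[OF f(1)] hspan.hspan_base[OF f(2)]]) auto
  moreover have "(\<lambda>x. c x * h x) = (\<lambda>x. f x + g x)" using f(3) by blast
  ultimately show ?case by simp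
next
  case (hspan_add f g)
  then show ?case unfolding distrib_left by (intro hspan.hspan_add)
qed

lemma hspan_coord_cnj:
  assumes "hspan_all h" "c = fst \<or> c = snd"
  shows "hspan_all (\<lambda>x. cnj (c x) * h x)"
  using hspan_cnj[OF hspan_coord[OF hspan_cnj[OF assms(1)] assms(2)]] by simp

text \<open>Speaking of multiplication by \<open>r\<close> on the whole span, rather than of
  membership of \<open>r\<close>, makes the product case a mere succession of the two induction
  hypotheses.\<close>

lemma hspan_real_polynomial:
  assumes "real_polynomial_function r" "hspan_all h"
  shows "hspan_all (\<lambda>x. of_real (r x) * h x)"
  using assms
proof (induction arbitrary: h)
  case (linear r)
  let ?D = "\<lambda>v. complex_of_real (r v)"
  have l: "linear ?D" using linear(1)
    by (intro bounded_linear.linear bounded_linear_compose[OF bounded_linear_of_real])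
  define A B C D where "A = (?D (1,0) - \<i> * ?D (\<i>,0)) / 2" and "B = (?D (1,0) + \<i> * ?D (\<i>,0)) / 2"
    and "C = (?D (0,1) - \<i> * ?D (0,\<i>)) / 2" and "D = (?D (0,1) + \<i> * ?D (0,\<i>)) / 2"
  have ri: "complex_of_real (Re z) = (z + cnj z) / 2" "complex_of_real (Im z) = - \<i> * (z - cnj z) / 2" for z
    by (auto simp: complex_eq_iff)
  have "?D x = A * fst x + B * cnj (fst x) + C * snd x + D * cnj (snd x)" for x
    unfolding real_linear_C2_expand[OF l, of x] A_def B_def C_def D_def ri
    by (simp add: field_simps)
  then have "(\<lambda>x. ?D x * h x) = (\<lambda>x. ((A * (fst x * h x) + B * (cnj (fst x) * h x)) + C * (snd x * h x)) + D * (cnj (snd x) * h x))"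
    by (simp add: algebra_simps)
  moreover have "hspan_all \<dots>"
    by (intro hspan_add hspan_cmult hspan_coord hspan_coord_cnj linear) auto
  ultimately show ?case by simp
next
  case (const c)
  then show ?case by (rule hspan_cmult)
next
  case (add f g)
  then show ?case unfolding of_real_add distrib_right by (intro hspan_add)
next
  case (mult f g)
  then show ?case unfolding of_real_mult mult.assoc by blast
qed

lemma Hpq_one: "(\<lambda>x. 1) \<in> Hpq 0 0"
proof (rule hpoly_in_Hpq)
  have "dz (\<lambda>x. 0) = (\<lambda>x. 0)" "dw (\<lambda>x. 0) = (\<lambda>x. 0)" "dzb (\<lambda>x. 1) = (\<lambda>x. 0)" "dwb (\<lambda>x. 1) = (\<lambda>x. 0)"
    by (auto simp: fun_eq_iff wirtinger_coords)
  then show "hpoly 0 0 (\<lambda>x. 1)" using BH_coords(5)[of 1] by (simp add: hpoly_def)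
qed

lemma hspan_dense:
  assumes "continuous_on S3 f" "e > 0"
  shows "\<exists>h. hspan_all h \<and> (\<forall>x\<in>S3. norm (f x - h x) < e)"
proof -
  obtain g where g: "polynomial_function g" "\<And>x. x \<in> S3 \<Longrightarrow> norm (f x - g x) < e"
    using Stone_Weierstrass_polynomial_function[OF compact_S3 assms] by blast
  have r: "real_polynomial_function (\<lambda>x. Re (g x))" "real_polynomial_function (\<lambda>x. Im (g x))"
    using g(1) bounded_linear_Re bounded_linear_Im unfolding polynomial_function_def comp_def by blast+
  have 1: "hspan_all (\<lambda>x. 1)" by (rule hspan_base[OF Hpq_one]) simp
  have "hspan_all (\<lambda>x. of_real (Re (g x)) * 1 + \<i> * (of_real (Im (g x)) * 1))"
    by (intro hspan_add hspan_cmult hspan_real_polynomial r 1)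
  moreover have "(\<lambda>x. of_real (Re (g x)) * 1 + \<i> * (of_real (Im (g x)) * 1)) = g"
    by (auto simp: complex_eq_iff)
  ultimately show ?thesis using g(2) by metis
qed

lemma L2ip_hspan_zero:
  assumes "continuous_on S3 u" "\<And>p q h. h \<in> Hpq p q \<Longrightarrow> Q q \<Longrightarrow> L2ip u h = 0" "hspan Q h"
  shows "L2ip u h = 0"
  using assms(3)
proof induction
  case (hspan_add f g)
  then show ?case using L2ip_add_right[OF _ _ assms(1)] hspan_smooth smooth_S3_continuous by simp
next
  case hspan_zero
  then show ?case using L2ip_cmult_right[of u 0 "\<lambda>x. 0"] by simp
qed (rule assms(2))

lemma completeness:
  assumes u: "continuous_on S3 u" and "\<And>p q h. h \<in> Hpq p q \<Longrightarrow> L2ip u h = 0" and x: "x \<in> S3"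
  shows "u x = 0"
proof (rule L2ip_zero_imp_zero[OF u _ x])
  obtain B where B: "B \<ge> 0" "\<And>x. x \<in> S3 \<Longrightarrow> norm (u x) \<le> B" using continuous_S3_bounded[OF u] by blast
  \<comment> \<open>As \<open>u\<close> is orthogonal to its approximation \<open>h\<close>, the
    pairing of \<open>u\<close> with itself equals that of \<open>u\<close> with
    \<open>u - h\<close>.\<close>
  have "norm (L2ip u u) \<le> e * (B * vol)" if e: "e > 0" for e
  proof -
    obtain h where h: "hspan_all h" "\<And>x. x \<in> S3 \<Longrightarrow> norm (u x - h x) < e"
      using hspan_dense[OF u e] by blast
    have ch: "continuous_on S3 h" by (rule smooth_S3_continuous[OF hspan_smooth[OF h(1)]])
    have "L2ip u h = 0" by (rule L2ip_hspan_zero[OF u _ h(1)]) (rule assms(2))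
    moreover have "L2ip u u = L2ip u (\<lambda>x. (u x - h x) + h x)" by simp
    ultimately have "L2ip u u = L2ip u (\<lambda>x. u x - h x)"
      using L2ip_add_right[of "\<lambda>x. u x - h x" h u] u ch by (simp add: continuous_on_diff)
    also have "norm \<dots> \<le> B * e * vol"
      by (rule L2ip_norm_le) (use u ch h(2) B in \<open>auto intro!: continuous_intros intro: less_imp_le\<close>)
    finally show ?thesis by (simp add: mult_ac)
  qed
  note n = this
  show "L2ip u u = 0"
  proof (rule ccontr)
    assume nz: "L2ip u u \<noteq> 0"
    \<comment> \<open>With this \<open>e\<close> the bound is at most half of the norm itself; the
      added 1 keeps the denominator positive when \<open>B\<close> is 0.\<close>
    define e where "e = norm (L2ip u u) / (2 * (B * vol + 1))"
    have p: "B * vol + 1 > 0" using B(1) vol_pos by (simp add: add_nonneg_pos)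
    then have "e > 0" using nz by (simp add: e_def)
    then have le: "norm (L2ip u u) \<le> e * (B * vol)" by (rule n)
    have e: "e * (2 * (B * vol + 1)) = norm (L2ip u u)" using p by (simp add: e_def)
    have "norm (L2ip u u) * (2 * (B * vol + 1)) \<le> e * (B * vol) * (2 * (B * vol + 1))"
      by (rule mult_right_mono[OF le]) (use p in simp)
    also have "\<dots> = (e * (2 * (B * vol + 1))) * (B * vol)" by (simp only: mult_ac)
    finally have "2 * (norm (L2ip u u) * (B * vol + 1)) \<le> norm (L2ip u u) * (B * vol)"
      unfolding e by (simp only: mult_ac)
    moreover have "norm (L2ip u u) * (B * vol) \<le> norm (L2ip u u) * (B * vol + 1)"
      by (simp add: mult_left_mono)
    ultimately have "norm (L2ip u u) * (B * vol + 1) \<le> 0" by linarith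
    moreover have "norm (L2ip u u) * (B * vol + 1) > 0" using p nz by simp
    ultimately show False by linarith
  qed
qed

lemma hspan_split:
  assumes "hspan_all h"
  shows "\<exists>f g. hspan Q f \<and> hspan (\<lambda>q. \<not> Q q) g \<and> h = (\<lambda>x. f x + g x)"
  using assms
proof induction
  case hspan_zero
  have "(\<lambda>x. 0) = (\<lambda>x::pt. 0 + (0::complex))" by simp
  then show ?case using hspan.hspan_zero by blast
next
  case (hspan_base h p q)
  have h: "h = (\<lambda>x. h x + 0)" "h = (\<lambda>x. 0 + h x)" by simp_all
  show ?case
  proof (cases "Q q")
    case True
    then have "hspan Q h" using hspan_base by (auto intro: hspan.hspan_base)
    with h(1) show ?thesis using hspan.hspan_zero by blast
  next
    case False
    then have "hspan (\<lambda>q. \<not> Q q) h" using hspan_base by (auto intro: hspan.hspan_base)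
    with h(2) show ?thesis using hspan.hspan_zero by blast
  qed
next
  case (hspan_add f g)
  then obtain f1 f2 g1 g2 where *: "hspan Q f1" "hspan (\<lambda>q. \<not> Q q) f2" "f = (\<lambda>x. f1 x + f2 x)"
    "hspan Q g1" "hspan (\<lambda>q. \<not> Q q) g2" "g = (\<lambda>x. g1 x + g2 x)" by blast
  have "(\<lambda>x. f x + g x) = (\<lambda>x. (f1 x + g1 x) + (f2 x + g2 x))" by (simp add: * algebra_simps)
  then show ?case using hspan.hspan_add[OF *(1,4)] hspan.hspan_add[OF *(2,5)] by blast
qed

lemma Z1b_Z1b_zero:
  assumes "h \<in> Hpq p q" "q \<le> 1" "x \<in> S3"
  shows "Z1b (Z1b h) x = 0"
proof -
  have "Z1b h \<in> Hpq (Suc p) 0" using Hpq_Z1b[OF assms(1)] assms(2) by simp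
  then show ?thesis by (rule Hpq_Z1b_zero) (rule assms(3))
qed

lemma Hpq_eq_Z1_Z1:
  assumes h: "h \<in> Hpq p q" and q: "q \<ge> 2"
  obtains k where "smooth_S3 k" "k \<in> Hpq (Suc (Suc p)) (q - 2)" "\<And>x. x \<in> S3 \<Longrightarrow> h x = Z1 (Z1 k) x"
proof -
  \<comment> \<open>The product of the eigenvalues of \<open>Z1\<close> after \<open>Z1b\<close> on
    bidegrees (p + 1, q - 1) and (p, q), whose signs cancel. The factor q - 1 is where
    \<open>q \<ge> 2\<close> enters.\<close>
  define c :: complex where "c = of_nat ((q - 1) * (p + 2) * (q * (p + 1)))"
  have c: "c \<noteq> 0" using q by (simp only: c_def of_nat_eq_0_iff) simp
  note h1 = Hpq_Z1b[OF h]
  note h2 = Hpq_Z1b[OF h1]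
  note s = Hpq_smooth[OF h] Hpq_smooth[OF h1] Hpq_smooth[OF h2]
  have sm: "smooth_S3 (Z1 (Z1b (Z1b h)))" by (rule smooth_S3_fields(1)[OF s(3)])
  have "Z1 (Z1 (Z1b (Z1b h))) x = c * h x" if x: "x \<in> S3" for x
  proof -
    have "Z1 (Z1 (Z1b (Z1b h))) x = Z1 (\<lambda>x. - (of_nat (q - 1) * (of_nat (Suc p) + 1)) * Z1b h x) x"
      by (rule Z1_cong[OF Hpq_Z1_Z1b[OF h1] sm x])
    also have "\<dots> = - (of_nat (q - 1) * (of_nat (Suc p) + 1)) * Z1 (Z1b h) x"
      by (rule fields_cmult(1)[OF s(2) x])
    also have "\<dots> = c * h x"
      unfolding Hpq_Z1_Z1b[OF h x] c_def of_nat_mult of_nat_add by (simp add: algebra_simps)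
    finally show ?thesis .
  qed
  note Z = this
  let ?k = "\<lambda>x. (1/c) * Z1b (Z1b h) x"
  have "Z1 (Z1 ?k) x = h x" if x: "x \<in> S3" for x
  proof -
    have sk: "smooth_S3 ?k" by (intro smooth_S3_intros s)
    have "Z1 (Z1 ?k) x = Z1 (\<lambda>x. (1/c) * Z1 (Z1b (Z1b h)) x) x"
      by (rule Z1_cong[OF fields_cmult(1)[OF s(3)] smooth_S3_fields(1)[OF sk] x])
    also have "\<dots> = (1/c) * Z1 (Z1 (Z1b (Z1b h))) x" by (rule fields_cmult(1)[OF sm x])
    finally show ?thesis using Z[OF x] c by simp
  qed
  moreover have "smooth_S3 ?k" by (intro smooth_S3_intros s)
  moreover have "?k \<in> Hpq (Suc (Suc p)) (q - 2)"
    using Hpq_cmult[OF h2, of "1/c"] by (simp add: numeral_2_eq_2)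
  ultimately show ?thesis using that by metis
qed

lemma L2ip_Z1_Z1:
  assumes "smooth_S3 f" "smooth_S3 g"
  shows "L2ip (Z1 (Z1 f)) g = L2ip f (Z1b (Z1b g))" "L2ip (Z1b (Z1b f)) g = L2ip f (Z1 (Z1 g))"
  by (simp_all add: L2ip_adjoint assms smooth_S3_fields)

lemma L2ip_zero: "L2ip (\<lambda>x. 0) g = 0" "L2ip f (\<lambda>x. 0) = 0"
  using L2ip_cmult_left[of 0 "\<lambda>x. 0" g] L2ip_cmult_right[of f 0 "\<lambda>x. 0"] by simp_all

text \<open>\<open>g\<close> is in the range of \<open>Z1\<close> applied twice, and the adjoint of
  that operator kills \<open>f\<close>; no comparison of degrees enters.\<close>

lemma Hpq_orthogonal:
  assumes "f \<in> Hpq p q" "q \<le> 1" "g \<in> Hpq p' q'" "q' \<ge> 2"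
  shows "L2ip f g = 0"
proof -
  obtain k where k: "smooth_S3 k" "\<And>x. x \<in> S3 \<Longrightarrow> g x = Z1 (Z1 k) x"
    using Hpq_eq_Z1_Z1[OF assms(3,4)] by metis
  note f = Hpq_smooth[OF assms(1)]
  have "L2ip f g = L2ip f (Z1 (Z1 k))"
    by (rule L2ip_cong[OF refl k(2)]) (use f Hpq_smooth[OF assms(3)] smooth_S3_continuous in auto)
  also have "\<dots> = L2ip (Z1b (Z1b f)) k" by (simp add: L2ip_Z1_Z1 f k)
  also have "\<dots> = L2ip (\<lambda>x. 0) k"
    by (rule L2ip_cong[OF Z1b_Z1b_zero[OF assms(1,2)] refl])
      (use f k(1) smooth_S3_continuous smooth_S3_fields in auto)
  finally show ?thesis by (simp add: L2ip_zero)
qed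

section \<open>Smoothness of Szego type series\<close>

text \<open>Termwise differentiation with a Weierstrass majorant: the tails of \<open>B\<close> give
  the uniform convergence of the differentials.\<close>

lemma has_derivative_suminf:
  fixes f :: "nat \<Rightarrow> 'a::real_normed_vector \<Rightarrow> 'b::banach"
  assumes S: "convex S" "open S" "x \<in> S"
    and d: "\<And>n y. y \<in> S \<Longrightarrow> (f n has_derivative f' n y) (at y)"
    and B: "summable B" "\<And>n y h. y \<in> S \<Longrightarrow> norm (f' n y h) \<le> B n * norm h"
    and s: "summable (\<lambda>n. f n x)"
  shows "((\<lambda>y. \<Sum>n. f n y) has_derivative (\<lambda>h. \<Sum>n. f' n x h)) (at x)"
proof -
  have sf: "summable (\<lambda>n. f' n y h)" if "y \<in> S" for y and h :: 'a
    by (rule summable_comparison_test'[OF summable_mult2[OF B(1), of "norm h"]]) (use B(2)[OF that] in auto)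
  have tail: "(\<lambda>n. \<Sum>i. B (i + n)) \<longlonglongrightarrow> 0" by (rule suminf_exist_split2[OF B(1)])
  have "\<exists>g. \<forall>y\<in>S. (\<lambda>n. f n y) sums (g y) \<and> (g has_derivative (\<lambda>h. \<Sum>n. f' n y h)) (at y within S)"
  proof (rule has_derivative_series[where f=f and f'=f' and g'="\<lambda>y h. \<Sum>n. f' n y h",
        OF S(1) _ _ S(3) summable_sums[OF s]])
    show "(f n has_derivative f' n y) (at y within S)" if "y \<in> S" for n y
      by (rule has_derivative_at_withinI[OF d[OF that]])
    fix e :: real assume "e > 0"
    then have "\<forall>\<^sub>F n in sequentially. (\<Sum>i. B (i + n)) < e"
      by (rule order_tendstoD(2)[OF tail])
    then show "\<forall>\<^sub>F n in sequentially. \<forall>y\<in>S. \<forall>h. norm ((\<Sum>i<n. f' i y h) - (\<Sum>i. f' i y h)) \<le> e * norm h"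
    proof eventually_elim
      case (elim n)
      show ?case
      proof (intro ballI allI)
        fix y and h :: 'a assume y: "y \<in> S"
        have sB: "summable (\<lambda>i. B (i + n) * norm h)"
          by (intro summable_mult2) (use B(1) in \<open>simp add: summable_iff_shift\<close>)
        have "norm ((\<Sum>i<n. f' i y h) - (\<Sum>i. f' i y h)) = norm (\<Sum>i. f' (i + n) y h)"
          using suminf_split_initial_segment[OF sf[OF y], of h n] by (simp add: norm_minus_commute)
        also have "\<dots> \<le> (\<Sum>i. B (i + n) * norm h)"
          by (rule norm_suminf_le[OF _ sB]) (rule B(2)[OF y])
        also have "\<dots> = (\<Sum>i. B (i + n)) * norm h"
          by (rule suminf_mult2[symmetric]) (use B(1) in \<open>simp add: summable_iff_shift\<close>)
        also have "\<dots> \<le> e * norm h" using elim by (intro mult_right_mono) auto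
        finally show "norm ((\<Sum>i<n. f' i y h) - (\<Sum>i. f' i y h)) \<le> e * norm h" .
      qed
    qed
  qed
  then obtain g where g: "\<And>y. y \<in> S \<Longrightarrow> (\<lambda>n. f n y) sums (g y)"
    "(g has_derivative (\<lambda>h. \<Sum>n. f' n x h)) (at x within S)" using S(3) by blast
  have "(g has_derivative (\<lambda>h. \<Sum>n. f' n x h)) (at x)"
    using g(2) at_within_open[OF S(3,2)] by simp
  then show ?thesis
    by (rule has_derivative_transform_within_open[OF _ S(2,3)]) (use g(1) in \<open>simp add: sums_iff\<close>)
qed

section \<open>Moments against powers of the Hermitian product\<close>

definition herm :: "pt \<Rightarrow> pt \<Rightarrow> complex" where
  "herm x y = fst x * cnj (fst y) + snd x * cnj (snd y)"

lemma norm_herm_le: "norm (herm x y) \<le> norm x * norm y"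
proof -
  have "norm (herm x y) \<le> norm (fst x) * norm (fst y) + norm (snd x) * norm (snd y)"
    unfolding herm_def by (rule order_trans[OF norm_triangle_ineq]) (simp add: norm_mult)
  also have "\<dots> \<le> \<bar>inner (norm (fst x), norm (snd x)) (norm (fst y), norm (snd y))\<bar>"
    by (simp add: inner_prod_def)
  also have "\<dots> \<le> norm (norm (fst x), norm (snd x)) * norm (norm (fst y), norm (snd y))"
    by (rule Cauchy_Schwarz_ineq2)
  also have "\<dots> = norm x * norm y" by (simp add: norm_prod_def)
  finally show ?thesis .
qed

text \<open>Up to the factor \<open>vol / (p + 1)\<close> this is the component of \<phi> in
  \<open>Hpq p 0\<close>, the kernel being a multiple of the reproducing kernel. It is taken for all
  \<open>x\<close> in the plane, where it is a polynomial in \<open>x\<close>.\<close>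

definition moment :: "(pt \<Rightarrow> complex) \<Rightarrow> nat \<Rightarrow> pt \<Rightarrow> complex" where
  "moment \<phi> p x = L2ip \<phi> (\<lambda>y. herm y x ^ p)"

lemma BH_power:
  assumes "BH 1 0 F"
  shows "BH n 0 (\<lambda>x. F x ^ n)"
proof (induction n)
  case 0
  then show ?case using BH_coords(5)[of 1] by simp
next
  case (Suc n)
  then show ?case using BH_mult[OF assms Suc] by simp
qed

lemma BH_herm_power: "BH p 0 (\<lambda>y. herm y x ^ p)"
proof (rule BH_power)
  have "BH 1 0 (\<lambda>y. cnj (fst x) * fst y + cnj (snd x) * snd y)"
    by (intro BH_add BH_cmult BH_coords)
  then show "BH 1 0 (\<lambda>y. herm y x)" by (simp add: herm_def mult.commute)
qed

lemma smooth_herm_power: "smooth_S3 (\<lambda>y. herm y x ^ p)"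
  by (rule smooth_S3_BH[OF BH_herm_power])

lemma moment_Treeb:
  assumes "smooth_S3 \<phi>"
  shows "moment (Treeb \<phi>) p x = \<i> * of_nat p * moment \<phi> p x"
proof -
  let ?F = "\<lambda>y. herm y x ^ p"
  have "moment (Treeb \<phi>) p x = - L2ip \<phi> (Treeb ?F)"
    unfolding moment_def by (rule L2ip_adjoint(3)[OF assms smooth_herm_power])
  also have "L2ip \<phi> (Treeb ?F) = L2ip \<phi> (\<lambda>y. (\<i> * of_nat p) * ?F y)"
  proof (rule L2ip_cong[OF refl])
    show "Treeb ?F y = (\<i> * of_nat p) * ?F y" if "y \<in> S3" for y
      using fields_BH(3)[OF BH_herm_power that] by simp
  qed (intro smooth_S3_continuous assms smooth_S3_fields smooth_herm_power)+
  finally show ?thesis unfolding L2ip_cmult_right moment_def by simp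
qed

lemma moment_decay:
  assumes "smooth_S3 \<phi>"
  shows "\<exists>D. \<forall>p. \<forall>x\<in>S3. (real p + 1) ^ k * norm (moment \<phi> p x) \<le> D"
  using assms
proof (induction k arbitrary: \<phi>)
  case 0
  note c = smooth_S3_continuous[OF 0]
  obtain B where B: "B \<ge> 0" "\<And>x. x \<in> S3 \<Longrightarrow> norm (\<phi> x) \<le> B"
    using continuous_S3_bounded[OF c] by blast
  have "norm (moment \<phi> p x) \<le> B * 1 * vol" if "x \<in> S3" for p x
    unfolding moment_def
  proof (rule L2ip_norm_le[OF c smooth_S3_continuous[OF smooth_herm_power] B(2) _ B(1)])
    show "norm (herm y x ^ p) \<le> 1" if "y \<in> S3" for y
      using norm_herm_le[of y x] that \<open>x \<in> S3\<close> by (simp add: norm_power power_le_one S3_def)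
  qed
  then show ?case by (intro exI[of _ "B * vol"]) simp
next
  case (Suc k)
  obtain D E where D: "\<And>p x. x \<in> S3 \<Longrightarrow> (real p + 1) ^ k * norm (moment \<phi> p x) \<le> D"
    and E: "\<And>p x. x \<in> S3 \<Longrightarrow> (real p + 1) ^ k * norm (moment (Treeb \<phi>) p x) \<le> E"
    using Suc.IH[OF Suc.prems] Suc.IH[OF smooth_S3_fields(3)[OF Suc.prems]] by blast
  have "(real p + 1) ^ Suc k * norm (moment \<phi> p x) \<le> D + E" if "x \<in> S3" for p x
  proof -
    have "norm (moment (Treeb \<phi>) p x) = real p * norm (moment \<phi> p x)"
      unfolding moment_Treeb[OF Suc.prems] by (simp add: norm_mult)
    \<comment> \<open>One factor \<open>real p + 1\<close> is split as p + 1, and p times the moment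
      has the norm of the moment of \<open>Treeb \<phi>\<close>; hence the induction over all
      \<phi>.\<close>
    then have "(real p + 1) ^ Suc k * norm (moment \<phi> p x)
       = (real p + 1) ^ k * norm (moment \<phi> p x) + (real p + 1) ^ k * norm (moment (Treeb \<phi>) p x)"
      by (simp add: algebra_simps)
    then show ?thesis using D[OF that, of p] E[OF that, of p] by linarith
  qed
  then show ?case by blast
qed

text \<open>Moments decay faster than every power, so such weights keep the series summable. The
  class is stable under multiplication by p and under index shifts, the two effects of
  differentiation.\<close>

definition poly_bounded :: "(nat \<Rightarrow> complex) \<Rightarrow> bool" where
  "poly_bounded r \<longleftrightarrow> (\<exists>C m. \<forall>p. norm (r p) \<le> C * (real p + 1) ^ m)"

lemma poly_bounded_mult:
  assumes "poly_bounded r" "poly_bounded s"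
  shows "poly_bounded (\<lambda>p. r p * s p)"
proof -
  obtain C m D n where *: "\<And>p. norm (r p) \<le> C * (real p + 1) ^ m" "\<And>p. norm (s p) \<le> D * (real p + 1) ^ n"
    using assms unfolding poly_bounded_def by blast
  have "norm (r p * s p) \<le> (C * D) * (real p + 1) ^ (m + n)" for p
    using mult_mono[OF *(1)[of p] *(2)[of p]] order_trans[OF norm_ge_zero *(1)[of p]]
    by (simp add: norm_mult power_add mult_ac)
  then show ?thesis unfolding poly_bounded_def by blast
qed

lemma poly_bounded_of_nat: "poly_bounded of_nat"
  unfolding poly_bounded_def by (rule exI[of _ 1], rule exI[of _ 1]) simp

lemma poly_bounded_const: "poly_bounded (\<lambda>p. c)"
  unfolding poly_bounded_def by (rule exI[of _ "norm c"], rule exI[of _ 0]) simp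

lemma poly_bounded_Suc:
  assumes "poly_bounded r"
  shows "poly_bounded (\<lambda>p. r (Suc p))"
proof -
  obtain C m where *: "\<And>p. norm (r p) \<le> C * (real p + 1) ^ m"
    using assms unfolding poly_bounded_def by blast
  have C: "C \<ge> 0" using order_trans[OF norm_ge_zero *[of 0]] by simp
  have "norm (r (Suc p)) \<le> (C * 2 ^ m) * (real p + 1) ^ m" for p
  proof -
    have "norm (r (Suc p)) \<le> C * (real (Suc p) + 1) ^ m" by (rule *)
    also have "\<dots> \<le> C * (2 * (real p + 1)) ^ m"
      using C by (intro mult_left_mono power_mono) auto
    finally show ?thesis by (simp only: power_mult_distrib mult_ac)
  qed
  then show ?thesis unfolding poly_bounded_def by blast
qed

lemma moment_summable_bound:
  assumes "smooth_S3 \<phi>" "poly_bounded r"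
  shows "\<exists>b. summable b \<and> (\<forall>p. \<forall>x\<in>S3. norm (r p * moment \<phi> p x) \<le> b p)"
proof -
  obtain C m where r: "\<And>p. norm (r p) \<le> C * (real p + 1) ^ m"
    using assms(2) unfolding poly_bounded_def by blast
  have C: "C \<ge> 0" using order_trans[OF norm_ge_zero r[of 0]] by simp
  \<comment> \<open>Two orders beyond \<open>m\<close>, which leaves the summable bound 1 / (p +
    1)^2.\<close>
  obtain D where D: "\<And>p x. x \<in> S3 \<Longrightarrow> (real p + 1) ^ (m + 2) * norm (moment \<phi> p x) \<le> D"
    using moment_decay[OF assms(1), of "m + 2"] by blast
  let ?b = "\<lambda>p. C * D * inverse (real (Suc p) ^ 2)"
  have "summable (\<lambda>p. inverse (real (Suc p) ^ 2))"
    using inverse_power_summable[of 2, where ?'a=real] summable_Suc_iff[of "\<lambda>p. inverse (real p ^ 2)"] by simp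
  then have 1: "summable ?b" by (rule summable_mult)
  have 2: "norm (r p * moment \<phi> p x) \<le> ?b p" if "x \<in> S3" for p x
  proof -
    let ?n = "real p + 1"
    have "norm (r p * moment \<phi> p x) * ?n ^ 2 \<le> (C * ?n ^ m) * norm (moment \<phi> p x) * ?n ^ 2"
      using r[of p] by (simp add: norm_mult mult_right_mono)
    also have "\<dots> = C * (?n ^ (m + 2) * norm (moment \<phi> p x))" by (simp add: power_add power2_eq_square mult_ac)
    also have "\<dots> \<le> C * D" using D[OF that] C by (intro mult_left_mono)
    finally have "norm (r p * moment \<phi> p x) \<le> C * D / ?n ^ 2" by (simp add: pos_le_divide_eq)
    then show ?thesis by (simp add: divide_inverse add.commute)
  qed
  show ?thesis by (intro exI[of _ ?b] conjI allI ballI 1 2)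
qed

text \<open>Peels one factor off the kernel. This recursion takes the place of differentiation under
  the integral: it makes the moment a polynomial in \<open>x\<close> and yields its derivatives
  algebraically.\<close>

lemma moment_Suc:
  assumes "smooth_S3 \<phi>"
  shows "moment \<phi> (Suc p) x = fst x * moment (\<lambda>y. \<phi> y * cnj (fst y)) p x
     + snd x * moment (\<lambda>y. \<phi> y * cnj (snd y)) p x"
proof -
  have "moment \<phi> (Suc p) x = sint (\<lambda>y. fst x * (\<phi> y * cnj (fst y) * cnj (herm y x ^ p))
      + snd x * (\<phi> y * cnj (snd y) * cnj (herm y x ^ p)))"
    unfolding moment_def L2ip_sint by (simp add: herm_def algebra_simps)
  also have "\<dots> = sint (\<lambda>y. fst x * (\<phi> y * cnj (fst y) * cnj (herm y x ^ p)))
      + sint (\<lambda>y. snd x * (\<phi> y * cnj (snd y) * cnj (herm y x ^ p)))"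
    by (rule sint_add; rule smooth_S3_continuous; intro smooth_S3_const smooth_S3_mult smooth_S3_cnj
        smooth_S3_fst smooth_S3_snd smooth_herm_power assms)
  finally show ?thesis unfolding moment_def L2ip_sint by (simp only: sint_cmult)
qed

lemma smooth_times_cnj_coord:
  assumes "smooth_S3 \<phi>"
  shows "smooth_S3 (\<lambda>y. \<phi> y * cnj (fst y))" "smooth_S3 (\<lambda>y. \<phi> y * cnj (snd y))"
  by (intro smooth_S3_intros assms)+

lemma BH_moment: "smooth_S3 \<phi> \<Longrightarrow> BH p 0 (moment \<phi> p)"
proof (induction p arbitrary: \<phi>)
  case 0
  have "moment \<phi> 0 = (\<lambda>x. L2ip \<phi> (\<lambda>y. 1))" by (simp add: moment_def[abs_def])
  then show ?case using BH_coords(5) by simp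
next
  case (Suc p)
  have "moment \<phi> (Suc p) = (\<lambda>x. fst x * moment (\<lambda>y. \<phi> y * cnj (fst y)) p x
     + snd x * moment (\<lambda>y. \<phi> y * cnj (snd y)) p x)"
    by (rule ext) (rule moment_Suc[OF Suc.prems])
  moreover have "BH (1 + p) (0 + 0) (\<lambda>x. fst x * moment (\<lambda>y. \<phi> y * cnj (fst y)) p x
     + snd x * moment (\<lambda>y. \<phi> y * cnj (snd y)) p x)"
    by (intro BH_add BH_mult BH_coords Suc.IH smooth_times_cnj_coord Suc.prems)
  ultimately show ?case by simp
qed

lemma moment_derivative:
  "smooth_S3 \<phi> \<Longrightarrow> dz (moment \<phi> p) x = of_nat p * moment (\<lambda>y. \<phi> y * cnj (fst y)) (p - 1) x
    \<and> dw (moment \<phi> p) x = of_nat p * moment (\<lambda>y. \<phi> y * cnj (snd y)) (p - 1) x"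
proof (induction p arbitrary: \<phi>)
  case 0
  then show ?case using BH_wirtinger_zero(1)[OF BH_moment[OF 0]] by simp
next
  case (Suc p)
  let ?a = "\<lambda>y. \<phi> y * cnj (fst y)" and ?b = "\<lambda>y. \<phi> y * cnj (snd y)"
  note s = smooth_times_cnj_coord[OF Suc.prems]
  have e: "moment \<phi> (Suc p) = (\<lambda>x. fst x * moment ?a p x + snd x * moment ?b p x)"
    by (rule ext) (rule moment_Suc[OF Suc.prems])
  note d = BH_differentiable[OF BH_moment[OF s(1)]] BH_differentiable[OF BH_moment[OF s(2)]] differentiable_coords
  have c: "(\<lambda>y. \<phi> y * cnj (snd y) * cnj (fst y)) = (\<lambda>y. \<phi> y * cnj (fst y) * cnj (snd y))"
    by (simp add: mult_ac)
  \<comment> \<open>The moments with two extra coordinates. The mixed one arises from both orders of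
    multiplication, which is the symmetry \<open>ba\<close>.\<close>
  define aa ab bb where "aa = moment (\<lambda>y. ?a y * cnj (fst y)) (p - 1) x"
    and "ab = moment (\<lambda>y. ?a y * cnj (snd y)) (p - 1) x" and "bb = moment (\<lambda>y. ?b y * cnj (snd y)) (p - 1) x"
  have ba: "moment (\<lambda>y. ?b y * cnj (fst y)) (p - 1) x = ab" unfolding ab_def c ..
  \<comment> \<open>\<open>moment_Suc\<close> at index \<open>p - 1\<close>, multiplied by p; at
    \<open>p = 0\<close> that factor hides the truncated index.\<close>
  have 1: "fst x * (of_nat p * aa) + snd x * (of_nat p * ab) = of_nat p * moment ?a p x"
    "fst x * (of_nat p * ab) + snd x * (of_nat p * bb) = of_nat p * moment ?b p x"
  proof -
    have "moment ?a p x = fst x * aa + snd x * ab" "moment ?b p x = fst x * ab + snd x * bb" if "p \<noteq> 0"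
      using moment_Suc[OF s(1), of "p - 1" x] moment_Suc[OF s(2), of "p - 1" x] that ba
      by (simp_all add: aa_def ab_def bb_def)
    then show "fst x * (of_nat p * aa) + snd x * (of_nat p * ab) = of_nat p * moment ?a p x"
      "fst x * (of_nat p * ab) + snd x * (of_nat p * bb) = of_nat p * moment ?b p x"
      by (cases "p = 0"; simp add: algebra_simps)+
  qed
  have "dz (moment \<phi> (Suc p)) x = moment ?a p x + (fst x * (of_nat p * aa) + snd x * (of_nat p * ab))"
    "dw (moment \<phi> (Suc p)) x = moment ?b p x + (fst x * (of_nat p * ab) + snd x * (of_nat p * bb))"
    unfolding e using Suc.IH[OF s(1)] Suc.IH[OF s(2)]
    by (simp_all add: wirtinger_add wirtinger_mult d wirtinger_coords ba[simplified] flip: aa_def[simplified] ab_def[simplified] bb_def[simplified])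
  then show ?case unfolding 1 by (simp add: algebra_simps)
qed

text \<open>Normalisation contributes a radial correction, which Euler's identity turns into p times
  \<open>F\<close>. In this form the dependence on p sits in extensions of polynomials and in the
  factor p, ready for summation.\<close>

lemma hext_derivative_BH:
  assumes F: "BH p 0 F" and x: "x \<noteq> 0"
  shows "(hext F has_derivative (\<lambda>v. complex_of_real (1 / norm x) * (fst v * hext (dz F) x + snd v * hext (dw F) x)
      - complex_of_real (x \<bullet> v) * (complex_of_real (1 / norm x) * complex_of_real (1 / norm x)) * (of_nat p * hext F x))) (at x)"
proof -
  define y where "y = scaleR (1 / norm x) x"
  have y: "y \<in> S3" using normalize_in_S3[OF x] by (simp add: y_def)
  have xy: "x = norm x *\<^sub>R y" using x by (simp add: y_def)
  have hx: "hext G x = G y" for G by (simp add: hext_def y_def)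
  have Fd: "F differentiable at y" by (rule BH_differentiable[OF F])
  have n: "((\<lambda>x. scaleR (1 / norm x) x) has_derivative
      (\<lambda>v. (1 / norm x) *\<^sub>R v - ((x \<bullet> v) * (1 / norm x) * (1 / norm x)) *\<^sub>R y)) (at x)"
  proof -
    have d: "(norm has_derivative (\<lambda>v. v \<bullet> sgn x)) (at x)" using has_derivative_norm[of x] x by simp
    show ?thesis
      by (rule has_derivative_eq_rhs[OF has_derivative_scaleR[OF has_derivative_divide[OF has_derivative_const d] has_derivative_ident]])
        (use x in \<open>auto simp: fun_eq_iff sgn_div_norm y_def inner_commute divide_simps\<close>)
  qed
  have "(hext F has_derivative (\<lambda>v. frechet_derivative F (at y)
      ((1 / norm x) *\<^sub>R v - ((x \<bullet> v) * (1 / norm x) * (1 / norm x)) *\<^sub>R y))) (at x)"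
    unfolding hext_def[abs_def]
    by (rule has_derivative_compose[OF n]) (use Fd in \<open>simp add: frechet_derivative_works y_def\<close>)
  moreover have "frechet_derivative F (at y)
      ((1 / norm x) *\<^sub>R v - ((x \<bullet> v) * (1 / norm x) * (1 / norm x)) *\<^sub>R y)
     = complex_of_real (1 / norm x) * (fst v * hext (dz F) x + snd v * hext (dw F) x)
      - complex_of_real (x \<bullet> v) * (complex_of_real (1 / norm x) * complex_of_real (1 / norm x)) * (of_nat p * hext F x)" for v
  proof -
    define a where "a = complex_of_real (1 / norm x)"
    define c where "c = complex_of_real (x \<bullet> v)"
    have "frechet_derivative F (at y)
      ((1 / norm x) *\<^sub>R v - ((x \<bullet> v) * (1 / norm x) * (1 / norm x)) *\<^sub>R y)
      = dz F y * (a * fst v - (c * a * a) * fst y) + dw F y * (a * snd v - (c * a * a) * snd y)"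
      unfolding wirtinger_expand[OF Fd] a_def c_def
      using BH_wirtinger_zero(2)[OF F] by (simp add: scaleR_conv_of_real)
    also have "\<dots> = a * (fst v * dz F y + snd v * dw F y) - c * (a * a) * (fst y * dz F y + snd y * dw F y)"
      by (simp add: algebra_simps)
    finally show ?thesis unfolding BH_Euler(1)[OF F] hx a_def c_def .
  qed
  ultimately show ?thesis by simp
qed

definition szego :: "(pt \<Rightarrow> complex) \<Rightarrow> (nat \<Rightarrow> complex) \<Rightarrow> pt \<Rightarrow> complex" where
  "szego \<phi> r x = (\<Sum>p. r p * moment \<phi> p x)"

lemma szego_sums:
  assumes "smooth_S3 \<phi>" "poly_bounded r" "x \<in> S3"
  shows "(\<lambda>p. r p * moment \<phi> p x) sums szego \<phi> r x"
proof -
  obtain b where b: "summable b" "\<And>p x. x \<in> S3 \<Longrightarrow> norm (r p * moment \<phi> p x) \<le> b p"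
    using moment_summable_bound[OF assms(1,2)] by blast
  have "summable (\<lambda>p. r p * moment \<phi> p x)"
    by (rule summable_comparison_test'[OF b(1), of 0]) (rule b(2)[OF assms(3)])
  then show ?thesis by (simp add: szego_def summable_sums)
qed

text \<open>Holomorphic derivatives lower the degree of a moment, which shifts the weights to
  \<open>r (Suc p) * of_nat (Suc p)\<close>; the radial correction keeps the degree and multiplies
  the weights by p.\<close>

lemma szego_has_derivative:
  assumes \<phi>: "smooth_S3 \<phi>" and r: "poly_bounded r" and x: "x \<noteq> 0"
  shows "(hext (szego \<phi> r) has_derivative (\<lambda>v. complex_of_real (1 / norm x) *
       (fst v * hext (szego (\<lambda>y. \<phi> y * cnj (fst y)) (\<lambda>p. r (Suc p) * of_nat (Suc p))) x
      + snd v * hext (szego (\<lambda>y. \<phi> y * cnj (snd y)) (\<lambda>p. r (Suc p) * of_nat (Suc p))) x)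
      - complex_of_real (x \<bullet> v) * (complex_of_real (1 / norm x) * complex_of_real (1 / norm x))
        * hext (szego \<phi> (\<lambda>p. r p * of_nat p)) x)) (at x)"
proof -
  let ?a = "\<lambda>y. \<phi> y * cnj (fst y)" and ?b = "\<lambda>y. \<phi> y * cnj (snd y)"
  let ?r1 = "\<lambda>p. r (Suc p) * of_nat (Suc p)" and ?r2 = "\<lambda>p. r p * of_nat p"
  note s = smooth_times_cnj_coord[OF \<phi>]
  have r2: "poly_bounded ?r2" by (rule poly_bounded_mult[OF r poly_bounded_of_nat])
  have r1: "poly_bounded ?r1" by (rule poly_bounded_Suc[OF r2])
  define t1 where "t1 p y = r p * of_nat p * moment ?a (p - 1) y" for p y
  define t2 where "t2 p y = r p * of_nat p * moment ?b (p - 1) y" for p y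
  define t3 where "t3 p y = r p * of_nat p * moment \<phi> p y" for p y
  obtain b1 where b1: "summable b1" "\<And>p x. x \<in> S3 \<Longrightarrow> norm (?r1 p * moment ?a p x) \<le> b1 p"
    using moment_summable_bound[OF s(1) r1] by blast
  obtain b2 where b2: "summable b2" "\<And>p x. x \<in> S3 \<Longrightarrow> norm (?r1 p * moment ?b p x) \<le> b2 p"
    using moment_summable_bound[OF s(2) r1] by blast
  obtain b3 where b3: "summable b3" "\<And>p x. x \<in> S3 \<Longrightarrow> norm (?r2 p * moment \<phi> p x) \<le> b3 p"
    using moment_summable_bound[OF \<phi> r2] by blast
  \<comment> \<open>The majorants moved by one place, to match moments of index
    \<open>p - 1\<close>; the terms at \<open>p = 0\<close> vanish.\<close>
  define c1 where "c1 p = (case p of 0 \<Rightarrow> 0 | Suc q \<Rightarrow> b1 q)" for p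
  define c2 where "c2 p = (case p of 0 \<Rightarrow> 0 | Suc q \<Rightarrow> b2 q)" for p
  have "summable (\<lambda>p. c1 (Suc p))" "summable (\<lambda>p. c2 (Suc p))"
    using b1(1) b2(1) by (simp_all add: c1_def c2_def)
  then have c: "summable c1" "summable c2" by (simp_all only: summable_Suc_iff)
  have t: "norm (t1 p y) \<le> c1 p" "norm (t2 p y) \<le> c2 p" "norm (t3 p y) \<le> b3 p" if "y \<in> S3" for p y
    unfolding t1_def t2_def t3_def c1_def c2_def
    using b1(2)[OF that, of "p - 1"] b2(2)[OF that, of "p - 1"] b3(2)[OF that, of p] by (cases p; simp)+
  have sums: "(\<lambda>p. t1 p y) sums szego ?a ?r1 y" "(\<lambda>p. t2 p y) sums szego ?b ?r1 y"
    "(\<lambda>p. t3 p y) sums szego \<phi> ?r2 y" if "y \<in> S3" for y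
  proof -
    have 0: "t1 0 y = 0" "t2 0 y = 0" by (simp_all add: t1_def t2_def)
    have "(\<lambda>p. t1 (Suc p) y) sums szego ?a ?r1 y" "(\<lambda>p. t2 (Suc p) y) sums szego ?b ?r1 y"
      using szego_sums[OF s(1) r1 that] szego_sums[OF s(2) r1 that] by (simp_all add: t1_def t2_def)
    from this[THEN sums_Suc]
    show "(\<lambda>p. t1 p y) sums szego ?a ?r1 y" "(\<lambda>p. t2 p y) sums szego ?b ?r1 y"
      by (simp_all only: 0 add_0_right)
    show "(\<lambda>p. t3 p y) sums szego \<phi> ?r2 y"
      using szego_sums[OF \<phi> r2 that] by (simp add: t3_def)
  qed
  define f' where "f' p y v = complex_of_real (1 / norm y) * (fst v * hext (t1 p) y + snd v * hext (t2 p) y)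
      - complex_of_real (y \<bullet> v) * (complex_of_real (1 / norm y) * complex_of_real (1 / norm y)) * hext (t3 p) y"
    for p y v
  \<comment> \<open>On this ball \<open>norm y\<close> is at least half of \<open>norm x\<close>,
    whence the constant \<open>K\<close>.\<close>
  let ?S = "ball x (norm x / 2)"
  define K where "K = 2 / norm x"
  have K: "1 / norm y \<le> K" "y \<noteq> 0" if "y \<in> ?S" for y
  proof -
    have "norm x \<le> norm y + norm (x - y)" using norm_triangle_ineq[of y "x - y"] by simp
    then have n: "norm x / 2 \<le> norm y" using that by (simp add: dist_norm)
    then show "y \<noteq> 0" using x by auto
    then show "1 / norm y \<le> K" using n x by (simp add: K_def field_simps)
  qed
  have "((\<lambda>y. \<Sum>p. r p * hext (moment \<phi> p) y) has_derivative (\<lambda>v. \<Sum>p. f' p x v)) (at x)"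
  proof (rule has_derivative_suminf[where S="?S" and B="\<lambda>p. K * (c1 p + c2 p + b3 p)"])
    show "x \<in> ?S" using x by simp
    show "summable (\<lambda>p. K * (c1 p + c2 p + b3 p))" by (intro summable_mult summable_add c b3(1))
    show "summable (\<lambda>p. r p * hext (moment \<phi> p) x)"
      using szego_sums[OF \<phi> r normalize_in_S3[OF x]] by (simp add: hext_def sums_iff)
    fix p y assume y: "y \<in> ?S"
    have "((\<lambda>y. r p * hext (moment \<phi> p) y) has_derivative (\<lambda>v. r p * (complex_of_real (1 / norm y) *
       (fst v * hext (dz (moment \<phi> p)) y + snd v * hext (dw (moment \<phi> p)) y)
      - complex_of_real (y \<bullet> v) * (complex_of_real (1 / norm y) * complex_of_real (1 / norm y)) * (of_nat p * hext (moment \<phi> p) y)))) (at y)"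
      by (rule bounded_linear.has_derivative[OF bounded_linear_mult_right hext_derivative_BH[OF BH_moment[OF \<phi>] K(2)[OF y]]])
    moreover have "r p * (complex_of_real (1 / norm y) *
       (fst v * hext (dz (moment \<phi> p)) y + snd v * hext (dw (moment \<phi> p)) y)
      - complex_of_real (y \<bullet> v) * (complex_of_real (1 / norm y) * complex_of_real (1 / norm y)) * (of_nat p * hext (moment \<phi> p) y)) = f' p y v" for v
      unfolding f'_def hext_def t1_def t2_def t3_def using moment_derivative[OF \<phi>, of p] by (simp add: algebra_simps)
    ultimately show "((\<lambda>y. r p * hext (moment \<phi> p) y) has_derivative f' p y) (at y)" by simp
    fix v
    define z where "z = scaleR (1 / norm y) y"
    have z: "z \<in> S3" unfolding z_def by (rule normalize_in_S3[OF K(2)[OF y]])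
    have ny: "norm y > 0" using K(2)[OF y] by simp
    have "norm (f' p y v) \<le> norm (complex_of_real (1 / norm y) * (fst v * t1 p z + snd v * t2 p z))
        + norm (complex_of_real (y \<bullet> v) * (complex_of_real (1 / norm y) * complex_of_real (1 / norm y)) * t3 p z)"
      unfolding f'_def hext_def z_def by (rule norm_triangle_ineq4)
    also have "\<dots> \<le> (1 / norm y) * (norm v * c1 p + norm v * c2 p) + (1 / norm y) * (norm v * b3 p)"
    proof (rule add_mono)
      have "norm (fst v * t1 p z + snd v * t2 p z) \<le> norm (fst v) * norm (t1 p z) + norm (snd v) * norm (t2 p z)"
        by (rule order_trans[OF norm_triangle_ineq]) (simp add: norm_mult)
      also have "\<dots> \<le> norm v * c1 p + norm v * c2 p"
        using norm_fst_le[of "fst v" "snd v"] norm_snd_le[of "snd v" "fst v"]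
        by (intro add_mono mult_mono t z) auto
      finally have *: "norm (fst v * t1 p z + snd v * t2 p z) \<le> norm v * c1 p + norm v * c2 p" .
      have "norm (complex_of_real (1 / norm y) * (fst v * t1 p z + snd v * t2 p z))
          = (1 / norm y) * norm (fst v * t1 p z + snd v * t2 p z)"
        by (simp only: norm_mult norm_of_real) simp
      then show "norm (complex_of_real (1 / norm y) * (fst v * t1 p z + snd v * t2 p z))
        \<le> (1 / norm y) * (norm v * c1 p + norm v * c2 p)"
        using mult_left_mono[OF *, of "1 / norm y"] by simp
      have "norm (complex_of_real (y \<bullet> v) * (complex_of_real (1 / norm y) * complex_of_real (1 / norm y)) * t3 p z)
        = \<bar>y \<bullet> v\<bar> * ((1 / norm y) * (1 / norm y)) * norm (t3 p z)"
        by (simp add: norm_mult norm_divide)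
      also have "\<dots> \<le> (norm y * norm v) * ((1 / norm y) * (1 / norm y)) * b3 p"
        by (intro mult_mono Cauchy_Schwarz_ineq2 t z) auto
      also have "\<dots> = (1 / norm y) * (norm v * b3 p)" using ny by simp
      finally show "norm (complex_of_real (y \<bullet> v) * (complex_of_real (1 / norm y) * complex_of_real (1 / norm y)) * t3 p z)
        \<le> (1 / norm y) * (norm v * b3 p)" .
    qed
    also have "\<dots> = (1 / norm y) * (norm v * (c1 p + c2 p + b3 p))" by (simp add: algebra_simps)
    also have "\<dots> \<le> K * (norm v * (c1 p + c2 p + b3 p))"
    proof (rule mult_right_mono[OF K(1)[OF y]])
      have "0 \<le> c1 p + c2 p + b3 p"
        using order_trans[OF norm_ge_zero t(1)[OF z]] order_trans[OF norm_ge_zero t(2)[OF z]]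
          order_trans[OF norm_ge_zero t(3)[OF z]] by (simp add: add_nonneg_nonneg)
      then show "0 \<le> norm v * (c1 p + c2 p + b3 p)" by simp
    qed
    finally show "norm (f' p y v) \<le> K * (c1 p + c2 p + b3 p) * norm v" by (simp add: mult_ac)
  qed auto
  moreover have "(\<lambda>y. \<Sum>p. r p * hext (moment \<phi> p) y) = hext (szego \<phi> r)"
    by (simp add: hext_def[abs_def] szego_def)
  moreover have "(\<Sum>p. f' p x v) = complex_of_real (1 / norm x) * (fst v * hext (szego ?a ?r1) x + snd v * hext (szego ?b ?r1) x)
      - complex_of_real (x \<bullet> v) * (complex_of_real (1 / norm x) * complex_of_real (1 / norm x)) * hext (szego \<phi> ?r2) x" for v
  proof (rule sums_unique[symmetric])
    show "(\<lambda>p. f' p x v) sums (complex_of_real (1 / norm x) * (fst v * hext (szego ?a ?r1) x + snd v * hext (szego ?b ?r1) x)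
      - complex_of_real (x \<bullet> v) * (complex_of_real (1 / norm x) * complex_of_real (1 / norm x)) * hext (szego \<phi> ?r2) x)"
      unfolding f'_def hext_def
      by (intro sums_diff sums_mult sums_add sums normalize_in_S3 x)
  qed
  ultimately show ?thesis by simp
qed

lemma smooth_S3_szego:
  assumes "smooth_S3 \<phi>" "poly_bounded r"
  shows "smooth_S3 (szego \<phi> r)"
proof -
  have "Ck k (UNIV - {0}) (hext (szego \<phi> r))" for k
    using assms
  proof (induction k arbitrary: \<phi> r)
    case 0
    have "hext (szego \<phi> r) differentiable (at x)" if "x \<noteq> 0" for x
      using szego_has_derivative[OF 0 that] by (rule differentiableI)
    then show ?case
      by (auto intro!: continuous_at_imp_continuous_on differentiable_imp_continuous_within)
  next
    case (Suc k)
    have r2: "poly_bounded (\<lambda>p. r p * of_nat p)" by (rule poly_bounded_mult[OF Suc.prems(2) poly_bounded_of_nat])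
    note r1 = poly_bounded_Suc[OF r2]
    note s = smooth_times_cnj_coord[OF Suc.prems(1)]
    show ?case
    proof (rule Ck_SucI[OF open_punctured szego_has_derivative[OF Suc.prems]])
      fix v :: pt
      have m: "Ck k (UNIV - {0}) (\<lambda>x::pt. - complex_of_real (x \<bullet> v))"
        by (intro Ck_bounded_linear open_punctured bounded_linear_minus bounded_linear_compose[OF bounded_linear_of_real] bounded_linear_inner_left)
      have "Ck k (UNIV - {0}) (\<lambda>x. complex_of_real (1 / norm x) *
       (fst v * hext (szego (\<lambda>y. \<phi> y * cnj (fst y)) (\<lambda>p. r (Suc p) * of_nat (Suc p))) x
      + snd v * hext (szego (\<lambda>y. \<phi> y * cnj (snd y)) (\<lambda>p. r (Suc p) * of_nat (Suc p))) x)
      + (- complex_of_real (x \<bullet> v)) * (complex_of_real (1 / norm x) * complex_of_real (1 / norm x))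
        * hext (szego \<phi> (\<lambda>p. r p * of_nat p)) x)"
        by (intro Ck_add Ck_mult Ck_const Ck_inverse_norm m open_punctured Suc.IH s Suc.prems(1) r1 r2)
      then show "Ck k (UNIV - {0}) (\<lambda>x. complex_of_real (1 / norm x) *
       (fst v * hext (szego (\<lambda>y. \<phi> y * cnj (fst y)) (\<lambda>p. r (Suc p) * of_nat (Suc p))) x
      + snd v * hext (szego (\<lambda>y. \<phi> y * cnj (snd y)) (\<lambda>p. r (Suc p) * of_nat (Suc p))) x)
      - complex_of_real (x \<bullet> v) * (complex_of_real (1 / norm x) * complex_of_real (1 / norm x))
        * hext (szego \<phi> (\<lambda>p. r p * of_nat p)) x)" by simp
    qed auto
  qed
  then show ?thesis by (simp add: smooth_S3_def)
qed

section \<open>Projection onto the boundary values of holomorphic functions\<close>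

text \<open>For \<open>q \<ge> 1\<close>, \<open>h\<close> is a multiple of
  \<open>Z1 (Z1b h)\<close>, and the adjoint of the outer \<open>Z1\<close> kills \<open>f\<close>.
  For \<open>q = 0\<close> the two functions have distinct Reeb eigenvalues, i n and i p.\<close>

lemma Hpq_orthogonal_degree:
  assumes f: "f \<in> Hpq n 0" and h: "h \<in> Hpq p q" and "q \<ge> 1 \<or> n \<noteq> p"
  shows "L2ip f h = 0"
proof (cases "q = 0")
  case False
  define c :: complex where "c = of_nat (q * (p + 1))"
  have c: "c \<noteq> 0" using False by (simp only: c_def of_nat_eq_0_iff) simp
  note s = Hpq_smooth[OF f] Hpq_smooth[OF h] Hpq_smooth[OF Hpq_Z1b[OF h]]
  have "L2ip f (Z1 (Z1b h)) = - L2ip (Z1b f) (Z1b h)" by (simp add: L2ip_adjoint s)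
  also have "L2ip (Z1b f) (Z1b h) = L2ip (\<lambda>x. 0) (Z1b h)"
    by (rule L2ip_cong[OF Hpq_Z1b_zero[OF f] refl]) (auto intro: smooth_S3_continuous smooth_S3_fields s)
  finally have "L2ip f (Z1 (Z1b h)) = 0" by (simp add: L2ip_zero)
  moreover have "L2ip f (Z1 (Z1b h)) = L2ip f (\<lambda>x. - c * h x)"
  proof (rule L2ip_cong[OF refl])
    show "Z1 (Z1b h) x = - c * h x" if "x \<in> S3" for x
      using Hpq_Z1_Z1b[OF h that] by (simp add: c_def algebra_simps)
  qed (intro smooth_S3_continuous smooth_S3_fields s)+
  ultimately show ?thesis using c unfolding L2ip_cmult_right by simp
next
  case True
  then have ne: "of_nat n \<noteq> (of_nat p :: complex)" using assms(3) by simp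
  note s = Hpq_smooth[OF f] Hpq_smooth[OF h]
  have "L2ip (Treeb f) h = L2ip (\<lambda>x. (\<i> * of_nat n) * f x) h"
  proof (rule L2ip_cong[OF _ refl])
    show "Treeb f x = (\<i> * of_nat n) * f x" if "x \<in> S3" for x using Hpq_Treeb[OF f that] by simp
  qed (intro smooth_S3_continuous smooth_S3_fields s)+
  moreover have "L2ip f (Treeb h) = L2ip f (\<lambda>x. (\<i> * of_nat p) * h x)"
  proof (rule L2ip_cong[OF refl])
    show "Treeb h x = (\<i> * of_nat p) * h x" if "x \<in> S3" for x using Hpq_Treeb[OF h that] True by simp
  qed (intro smooth_S3_continuous smooth_S3_fields s)+
  ultimately have "(\<i> * of_nat n) * L2ip f h = (\<i> * of_nat p) * L2ip f h"
    using L2ip_adjoint(3)[OF s] unfolding L2ip_cmult_left L2ip_cmult_right by auto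
  then show ?thesis using ne by auto
qed

section \<open>Inner products of holomorphic monomials\<close>

definition hmon :: "nat \<Rightarrow> nat \<Rightarrow> pt \<Rightarrow> complex" where
  "hmon a b x = fst x ^ a * snd x ^ b"

lemma BH_hmon: "BH (a + b) 0 (hmon a b)"
  using BH_cmonom[of a b "a + b" 0 0 0 1] by (simp add: cmonom_def[abs_def] hmon_def[abs_def])

lemma hpoly_BH0: "BH p 0 F \<Longrightarrow> hpoly p 0 F"
proof -
  assume F: "BH p 0 F"
  then have "dzb F = (\<lambda>x. 0)" "dwb F = (\<lambda>x. 0)" using BH_wirtinger_zero(2) by blast+
  then show ?thesis using F by (simp add: hpoly_def wirtinger_coords)
qed

lemma smooth_hmon: "smooth_S3 (hmon a b)"
  by (rule smooth_S3_BH[OF BH_hmon])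

text \<open>Rotating the two coordinates in opposite directions preserves the measure and multiplies
  the integrand by a phase; with the phase -1 the integral equals its own negative.\<close>

lemma hmon_orthogonal:
  assumes "a + b = a' + b'" "a \<noteq> a'"
  shows "L2ip (hmon a b) (hmon a' b') = 0"
proof -
  have less: "L2ip (hmon a b) (hmon a' b') = 0" if ab: "a + b = a' + b'" "a' < a" for a b a' b'
  proof -
    define n where "n = a - a'"
    have n: "n > 0" "a = a' + n" "b' = b + n" using ab by (auto simp: n_def)
    \<comment> \<open>The integrand has weight \<open>2 * n\<close> under the rotation, so \<alpha>
      is taken with \<open>\<alpha> ^ (2 * n) = - 1\<close>.\<close>
    define \<alpha> where "\<alpha> = cis (pi / (2 * real n))"
    have \<alpha>: "cmod \<alpha> = 1" by (simp add: \<alpha>_def)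
    have \<alpha>n: "\<alpha> ^ (2 * n) = - 1"
    proof -
      have "real (2 * n) * (pi / (2 * real n)) = pi" using n(1) by simp
      then show ?thesis unfolding \<alpha>_def Complex.DeMoivre by simp
    qed
    let ?R = "\<lambda>(z,w). (\<alpha> * z, cnj \<alpha> * w)"
    let ?f = "\<lambda>x. hmon a b x * cnj (hmon a' b' x)"
    have aa: "\<alpha> * cnj \<alpha> = 1" using \<alpha> by (simp add: complex_norm_square[symmetric])
    have l: "linear ?R" by (auto intro!: linearI simp: algebra_simps)
    have nR: "norm (?R x) = norm x" for x
      by (cases x) (simp add: norm_prod_def norm_mult \<alpha>)
    have "sint (\<lambda>x. ?f (?R x)) = sint ?f"
      by (rule sint_mpres[OF mpres_diag(2)[OF \<alpha>] l nR])
        (intro smooth_S3_continuous smooth_S3_mult smooth_S3_cnj smooth_hmon)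
    moreover have "?f (?R x) = (- 1) * ?f x" for x
    proof -
      obtain z w where x: "x = (z, w)" by (cases x)
      have "?f (?R x) = ((\<alpha> * cnj \<alpha>) ^ a' * (\<alpha> * cnj \<alpha>) ^ b * \<alpha> ^ (2 * n)) * ?f x"
        unfolding x hmon_def n(2,3) mult_2
        by (simp add: power_mult_distrib power_add mult_ac)
      then show ?thesis by (simp add: aa \<alpha>n)
    qed
    ultimately have "(- 1) * sint ?f = sint ?f" by (simp only: sint_cmult)
    then show ?thesis unfolding L2ip_sint by (simp add: minus_equation_iff)
  qed
  show ?thesis
  proof (cases "a' < a")
    case True
    then show ?thesis using less assms by blast
  next
    case False
    then have "L2ip (hmon a' b') (hmon a b) = 0" using assms by (intro less) auto
    then show ?thesis by (subst L2ip_sym) simp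
  qed
qed

text \<open>Two linear relations between neighbouring norms are solved: the vanishing integral of a
  \<open>Z1\<close>-derivative, and the equation of the sphere.\<close>

lemma hmon_norm_recurrence:
  defines "N \<equiv> \<lambda>a b. L2ip (hmon a b) (hmon a b)"
  shows "of_nat (a + b + 2) * N (Suc a) b = of_nat (a + 1) * N a b"
    "of_nat (a + b + 2) * N a (Suc b) = of_nat (b + 1) * N a b"
proof -
  \<comment> \<open>Chosen so that both terms of its \<open>Z1\<close>-derivative are squared
    moduli, those of \<open>hmon a (Suc b)\<close> and \<open>hmon (Suc a) b\<close>.\<close>
  let ?F = "cmonom 1 (Suc a) (Suc b) a b"
  have BF: "BH (Suc a + Suc b) (a + b) ?F" by (rule BH_cmonom) auto
  have cc: "continuous_on S3 (\<lambda>x. c * (hmon i j x * cnj (hmon k l x)))" for c i j k l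
    by (intro smooth_S3_continuous smooth_S3_mult smooth_S3_cnj smooth_hmon smooth_S3_const)
  have "0 = sint (Z1 ?F)" by (simp add: sint_fields_zero[OF smooth_S3_BH[OF BF]])
  also have "\<dots> = sint (\<lambda>x. of_nat (Suc a) * (hmon a (Suc b) x * cnj (hmon a (Suc b) x))
      + (- of_nat (Suc b)) * (hmon (Suc a) b x * cnj (hmon (Suc a) b x)))"
  proof (rule sint_cong)
    fix x assume "x \<in> S3"
    then have "Z1 ?F x = PZ ?F x" by (rule fields_BH(1)[OF BF])
    then show "Z1 ?F x = of_nat (Suc a) * (hmon a (Suc b) x * cnj (hmon a (Suc b) x))
      + (- of_nat (Suc b)) * (hmon (Suc a) b x * cnj (hmon (Suc a) b x))"
      unfolding PZ_def wirtinger_cmonom by (simp add: cmonom_def hmon_def algebra_simps)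
  qed (rule smooth_S3_continuous[OF smooth_S3_fields(1)[OF smooth_S3_BH[OF BF]]])
  also have "\<dots> = of_nat (Suc a) * N a (Suc b) + (- of_nat (Suc b)) * N (Suc a) b"
    unfolding N_def L2ip_sint by (simp only: sint_add[OF cc cc] sint_cmult)
  finally have "0 = of_nat (Suc a) * N a (Suc b) + (- of_nat (Suc b)) * N (Suc a) b" .
  then have 1: "of_nat (Suc b) * N (Suc a) b = of_nat (Suc a) * N a (Suc b)" by (simp add: algebra_simps)
  have "N a b = sint (\<lambda>x. 1 * (hmon (Suc a) b x * cnj (hmon (Suc a) b x)) + 1 * (hmon a (Suc b) x * cnj (hmon a (Suc b) x)))"
    unfolding N_def L2ip_sint
  proof (rule sint_cong)
    fix x assume "x \<in> S3"
    then have e: "fst x * cnj (fst x) + snd x * cnj (snd x) = 1" by (simp add: S3_iff)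
    have "1 * (hmon (Suc a) b x * cnj (hmon (Suc a) b x)) + 1 * (hmon a (Suc b) x * cnj (hmon a (Suc b) x))
      = (fst x * cnj (fst x) + snd x * cnj (snd x)) * (hmon a b x * cnj (hmon a b x))"
      by (simp add: hmon_def algebra_simps)
    then show "hmon a b x * cnj (hmon a b x) = 1 * (hmon (Suc a) b x * cnj (hmon (Suc a) b x)) + 1 * (hmon a (Suc b) x * cnj (hmon a (Suc b) x))"
      unfolding e by simp
  qed (use cc[of 1] in simp)
  also have "\<dots> = N (Suc a) b + N a (Suc b)"
    unfolding N_def L2ip_sint sint_add[OF cc cc] by simp
  finally have 2: "N a b = N (Suc a) b + N a (Suc b)" .
  show "of_nat (a + b + 2) * N (Suc a) b = of_nat (a + 1) * N a b"
    "of_nat (a + b + 2) * N a (Suc b) = of_nat (b + 1) * N a b"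
    using 1 unfolding 2 by (simp_all add: algebra_simps)
qed

lemma hmon_norm:
  "L2ip (hmon a b) (hmon a b) * fact (a + b + 1) = of_real vol * fact a * fact b"
proof (induction a)
  case 0
  show ?case
  proof (induction b)
    case 0
    have "L2ip (hmon 0 0) (hmon 0 0) = of_real vol"
      by (simp add: L2ip_sint hmon_def[abs_def] sint_one)
    then show ?case by simp
  next
    case (Suc b)
    have "L2ip (hmon 0 (Suc b)) (hmon 0 (Suc b)) * fact (0 + Suc b + 1)
      = (of_nat (0 + b + 2) * L2ip (hmon 0 (Suc b)) (hmon 0 (Suc b))) * fact (0 + b + 1)"
      by (simp add: algebra_simps)
    also have "\<dots> = of_nat (b + 1) * (L2ip (hmon 0 b) (hmon 0 b) * fact (0 + b + 1))"
      unfolding hmon_norm_recurrence(2) by (simp only: mult.assoc)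
    also have "\<dots> = of_nat (b + 1) * (of_real vol * fact 0 * fact b)" by (simp only: Suc)
    also have "\<dots> = of_real vol * fact 0 * fact (Suc b)" by (simp add: algebra_simps)
    finally show ?case .
  qed
next
  case (Suc a)
  have "L2ip (hmon (Suc a) b) (hmon (Suc a) b) * fact (Suc a + b + 1)
      = (of_nat (a + b + 2) * L2ip (hmon (Suc a) b) (hmon (Suc a) b)) * fact (a + b + 1)"
    by (simp add: algebra_simps)
  also have "\<dots> = of_nat (a + 1) * (L2ip (hmon a b) (hmon a b) * fact (a + b + 1))"
    unfolding hmon_norm_recurrence(1) by (simp only: mult.assoc)
  also have "\<dots> = of_nat (a + 1) * (of_real vol * fact a * fact b)" by (simp only: Suc)
  also have "\<dots> = of_real vol * fact (Suc a) * fact b" by (simp add: algebra_simps)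
  finally show ?case .
qed

text \<open>The value is the same for all \<open>a\<close>: the binomial coefficients of the
  expanded kernel exactly compensate the unequal norms, so that taking moments is a scalar on each
  degree.\<close>

lemma hmon_norm_choose:
  assumes "a \<le> p"
  shows "of_nat (p choose a) * L2ip (hmon a (p - a)) (hmon a (p - a)) = of_real vol / of_nat (p + 1)"
proof -
  have f: "of_nat (p choose a) * (fact a * fact (p - a)) = (fact p :: complex)"
    using binomial_fact_lemma[OF assms] by (metis (no_types, lifting) mult.commute of_nat_fact of_nat_mult)
  have n: "L2ip (hmon a (p - a)) (hmon a (p - a)) * fact (p + 1) = of_real vol * (fact a * fact (p - a))"
    using hmon_norm[of a "p - a"] assms by (simp add: mult.assoc)
  have "(of_nat (p choose a) * L2ip (hmon a (p - a)) (hmon a (p - a)) * of_nat (p + 1)) * fact p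
     = of_nat (p choose a) * (L2ip (hmon a (p - a)) (hmon a (p - a)) * fact (p + 1))"
    by (simp add: algebra_simps)
  also have "\<dots> = of_real vol * (of_nat (p choose a) * (fact a * fact (p - a)))"
    unfolding n by (simp only: mult_ac)
  also have "\<dots> = of_real vol * fact p" unfolding f ..
  finally have "of_nat (p choose a) * L2ip (hmon a (p - a)) (hmon a (p - a)) * of_nat (p + 1) = of_real vol"
    by simp
  then show ?thesis by (metis Suc_eq_plus1 nat.distinct(1) nonzero_eq_divide_eq of_nat_eq_0_iff)
qed

lemma L2ip_sum_left:
  assumes "finite A" "\<And>a. a \<in> A \<Longrightarrow> continuous_on S3 (f a)" "continuous_on S3 g"
  shows "L2ip (\<lambda>x. \<Sum>a\<in>A. f a x) g = (\<Sum>a\<in>A. L2ip (f a) g)"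
  unfolding L2ip_sint sum_distrib_right
  by (rule sint_sum[OF assms(1)]) (intro continuous_intros assms)

lemma L2ip_sum_right:
  assumes "finite A" "\<And>a. a \<in> A \<Longrightarrow> continuous_on S3 (f a)" "continuous_on S3 g"
  shows "L2ip g (\<lambda>x. \<Sum>a\<in>A. f a x) = (\<Sum>a\<in>A. L2ip g (f a))"
  by (subst (1 2) L2ip_sym) (simp add: L2ip_sum_left assms)

lemma L2ip_diff_left:
  assumes "continuous_on S3 f" "continuous_on S3 g" "continuous_on S3 h"
  shows "L2ip (\<lambda>x. f x - g x) h = L2ip f h - L2ip g h"
  using L2ip_add_left[OF assms(1) continuous_on_mult_left[OF assms(2)] assms(3), of "- 1"]
  by (simp add: L2ip_cmult_left[of "- 1", simplified])

lemma L2ip_diff_right: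
  assumes "continuous_on S3 f" "continuous_on S3 g" "continuous_on S3 h"
  shows "L2ip h (\<lambda>x. f x - g x) = L2ip h f - L2ip h g"
  by (subst (1 2 3) L2ip_sym) (simp add: L2ip_diff_left assms)

lemma continuous_hmon: "continuous_on S3 (hmon a b)"
  by (rule smooth_S3_continuous[OF smooth_hmon])

lemma moment_expand:
  assumes "continuous_on S3 \<phi>"
  shows "moment \<phi> p x = (\<Sum>a\<le>p. (of_nat (p choose a) * L2ip \<phi> (hmon a (p - a))) * hmon a (p - a) x)"
proof -
  have "(\<lambda>y. herm y x ^ p) = (\<lambda>y. \<Sum>a\<le>p. (of_nat (p choose a) * cnj (hmon a (p - a) x)) * hmon a (p - a) y)"
    unfolding herm_def binomial_ring by (simp add: hmon_def power_mult_distrib mult_ac)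
  then have "moment \<phi> p x = (\<Sum>a\<le>p. L2ip \<phi> (\<lambda>y. (of_nat (p choose a) * cnj (hmon a (p - a) x)) * hmon a (p - a) y))"
    unfolding moment_def by (simp only:) (rule L2ip_sum_right, auto intro!: continuous_intros continuous_hmon assms)
  then show ?thesis
    by (simp only: L2ip_cmult_right complex_cnj_mult complex_cnj_cnj complex_cnj_of_nat) (simp only: mult_ac)
qed

lemma moment_hmon:
  assumes \<phi>: "continuous_on S3 \<phi>" and a: "a \<le> p"
  shows "L2ip (moment \<phi> p) (hmon a (p - a)) = of_real vol / of_nat (p + 1) * L2ip \<phi> (hmon a (p - a))"
proof -
  have "L2ip (moment \<phi> p) (hmon a (p - a))
     = L2ip (\<lambda>x. \<Sum>b\<le>p. (of_nat (p choose b) * L2ip \<phi> (hmon b (p - b))) * hmon b (p - b) x) (hmon a (p - a))"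
    by (simp only: moment_expand[OF \<phi>, abs_def])
  also have "\<dots> = (\<Sum>b\<le>p. (of_nat (p choose b) * L2ip \<phi> (hmon b (p - b))) * L2ip (hmon b (p - b)) (hmon a (p - a)))"
    unfolding L2ip_cmult_left[symmetric]
    by (rule L2ip_sum_left) (auto intro!: continuous_intros continuous_hmon)
  also have "\<dots> = (\<Sum>b\<le>p. if b = a then (of_nat (p choose a) * L2ip (hmon a (p - a)) (hmon a (p - a))) * L2ip \<phi> (hmon a (p - a)) else 0)"
    by (rule sum.cong) (use a hmon_orthogonal in auto)
  also have "\<dots> = of_real vol / of_nat (p + 1) * L2ip \<phi> (hmon a (p - a))"
    using a by (simp only: sum.delta finite_atMost hmon_norm_choose) simp
  finally show ?thesis .
qed

lemma moment_pairing:
  assumes \<phi>: "smooth_S3 \<phi>" and h: "h \<in> Hpq p 0"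
  shows "L2ip (moment \<phi> p) h = of_real vol / of_nat (p + 1) * L2ip \<phi> h"
proof -
  obtain F where F: "hpoly p 0 F" "\<And>x. x \<in> S3 \<Longrightarrow> h x = F x" using h by (auto simp: Hpq_iff_hpoly)
  then obtain cf where cf: "F = bihom p 0 cf" by (auto simp: hpoly_def BH_iff_bihom)
  have hx: "h x = (\<Sum>a\<le>p. cf a 0 * hmon a (p - a) x)" if "x \<in> S3" for x
    using F(2)[OF that] by (simp add: cf bihom_def hmon_def mult.assoc)
  note c = smooth_S3_continuous[OF \<phi>] smooth_S3_continuous[OF smooth_S3_BH[OF BH_moment[OF \<phi>]]]
    smooth_S3_continuous[OF Hpq_smooth[OF h]]
  have e: "L2ip u h = (\<Sum>a\<le>p. cnj (cf a 0) * L2ip u (hmon a (p - a)))" if "continuous_on S3 u" for u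
  proof -
    have "L2ip u h = L2ip u (\<lambda>x. \<Sum>a\<le>p. cf a 0 * hmon a (p - a) x)"
      by (rule L2ip_cong[OF refl hx that c(3)])
    also have "\<dots> = (\<Sum>a\<le>p. L2ip u (\<lambda>x. cf a 0 * hmon a (p - a) x))"
      by (rule L2ip_sum_right) (auto intro!: continuous_intros continuous_hmon that)
    finally show ?thesis by (simp add: L2ip_cmult_right)
  qed
  show ?thesis unfolding e[OF c(1)] e[OF c(2)] sum_distrib_left
    by (rule sum.cong) (simp_all add: moment_hmon[OF c(1)])
qed

lemma szego_pairing:
  assumes \<phi>: "smooth_S3 \<phi>" and r: "poly_bounded r" and h: "continuous_on S3 h"
  shows "(\<lambda>p. r p * L2ip (moment \<phi> p) h) sums L2ip (szego \<phi> r) h"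
proof -
  obtain b where b: "summable b" "\<And>p x. x \<in> S3 \<Longrightarrow> norm (r p * moment \<phi> p x) \<le> b p"
    using moment_summable_bound[OF \<phi> r] by blast
  obtain B where B: "B \<ge> 0" "\<And>x. x \<in> S3 \<Longrightarrow> norm (h x) \<le> B" using continuous_S3_bounded[OF h] by blast
  note cm = smooth_S3_continuous[OF smooth_S3_BH[OF BH_moment[OF \<phi>]]]
  note cs = smooth_S3_continuous[OF smooth_S3_szego[OF \<phi> r]]
  have bs: "summable (\<lambda>i. b (i + n))" for n using b(1) by (simp add: summable_iff_shift)
  have "norm ((\<Sum>p<n. r p * L2ip (moment \<phi> p) h) - L2ip (szego \<phi> r) h) \<le> (\<Sum>i. b (i + n)) * B * vol" for n
  proof -
    let ?s = "\<lambda>x. \<Sum>p<n. r p * moment \<phi> p x"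
    have c: "continuous_on S3 ?s" by (intro continuous_intros cm)
    have "(\<Sum>p<n. r p * L2ip (moment \<phi> p) h) = L2ip ?s h"
      by (subst L2ip_sum_left) (auto intro!: continuous_intros cm h simp: L2ip_cmult_left)
    then have "(\<Sum>p<n. r p * L2ip (moment \<phi> p) h) - L2ip (szego \<phi> r) h = L2ip (\<lambda>x. ?s x - szego \<phi> r x) h"
      by (simp only: L2ip_diff_left[OF c cs h])
    also have "norm \<dots> \<le> (\<Sum>i. b (i + n)) * B * vol"
    proof (rule L2ip_norm_le[OF _ h _ B(2)])
      show "continuous_on S3 (\<lambda>x. ?s x - szego \<phi> r x)" by (intro continuous_intros c cs)
      show bd: "norm (?s x - szego \<phi> r x) \<le> (\<Sum>i. b (i + n))" if "x \<in> S3" for x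
      proof -
        note s = szego_sums[OF \<phi> r that]
        have "szego \<phi> r x = (\<Sum>i. r (i + n) * moment \<phi> (i + n) x) + ?s x"
          using suminf_split_initial_segment[OF sums_summable[OF s], of n] by (simp add: szego_def)
        then have "norm (?s x - szego \<phi> r x) = norm (\<Sum>i. r (i + n) * moment \<phi> (i + n) x)"
          by simp
        also have "\<dots> \<le> (\<Sum>i. b (i + n))" by (rule norm_suminf_le[OF b(2)[OF that] bs])
        finally show ?thesis .
      qed
      \<comment> \<open>Any point of the sphere serves to show that the bound is nonnegative, as
        \<open>L2ip_norm_le\<close> requires.\<close>
      have "(1::complex, 0::complex) \<in> S3" by (simp add: S3_def)
      then show "0 \<le> (\<Sum>i. b (i + n))" by (rule order_trans[OF norm_ge_zero bd])
    qed
    finally show ?thesis .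
  qed
  note le = this
  have "(\<lambda>n. (\<Sum>i. b (i + n)) * B * vol) \<longlonglongrightarrow> 0 * B * vol"
    by (intro tendsto_mult tendsto_const suminf_exist_split2[OF b(1)])
  then have "(\<lambda>n. (\<Sum>i. b (i + n)) * B * vol) \<longlonglongrightarrow> 0" by simp
  then have "(\<lambda>n. (\<Sum>p<n. r p * L2ip (moment \<phi> p) h) - L2ip (szego \<phi> r) h) \<longlonglongrightarrow> 0"
    by (rule Lim_null_comparison[OF always_eventually[OF allI[OF le]]])
  then show ?thesis unfolding sums_def by (rule LIM_zero_cancel)
qed

lemma poly_bounded_scale: "poly_bounded (\<lambda>p. of_nat (p + 1) / of_real vol)"
proof -
  have "poly_bounded (\<lambda>p. (1 / of_real vol) * of_nat (Suc p))"
    by (rule poly_bounded_mult[OF poly_bounded_const poly_bounded_Suc[OF poly_bounded_of_nat]])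
  then show ?thesis by simp
qed

lemma szego_projection:
  assumes \<phi>: "smooth_S3 \<phi>" and r: "poly_bounded r"
  shows "\<exists>g. smooth_S3 g \<and> (\<forall>p q. \<forall>h\<in>Hpq p q. q \<ge> 1 \<longrightarrow> L2ip g h = 0)
     \<and> (\<forall>p. \<forall>h\<in>Hpq p 0. L2ip g h = r p * L2ip \<phi> h)"
proof -
  \<comment> \<open>The extra factor cancels \<open>vol / (p + 1)\<close> in
    \<open>moment_pairing\<close>.\<close>
  let ?r = "\<lambda>p. r p * (of_nat (p + 1) / of_real vol)"
  have pr: "poly_bounded ?r" by (rule poly_bounded_mult[OF r poly_bounded_scale])
  have m: "moment \<phi> n \<in> Hpq n 0" for n by (rule hpoly_in_Hpq[OF hpoly_BH0[OF BH_moment[OF \<phi>]]])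
  show ?thesis
  proof (intro exI[of _ "szego \<phi> ?r"] conjI allI ballI impI)
    show "smooth_S3 (szego \<phi> ?r)" by (rule smooth_S3_szego[OF \<phi> pr])
    fix p q h assume h: "h \<in> Hpq p q" and q: "1 \<le> q"
    have "L2ip (moment \<phi> n) h = 0" for n
      by (rule Hpq_orthogonal_degree[OF m h]) (use q in simp)
    then show "L2ip (szego \<phi> ?r) h = 0"
      using szego_pairing[OF \<phi> pr smooth_S3_continuous[OF Hpq_smooth[OF h]]] by (simp add: sums_iff)
  next
    fix p h assume h: "h \<in> Hpq p 0"
    have "L2ip (moment \<phi> n) h = 0" if "n \<noteq> p" for n
      by (rule Hpq_orthogonal_degree[OF m h]) (use that in simp)
    then have "(\<lambda>n. ?r n * L2ip (moment \<phi> n) h) sums (?r p * L2ip (moment \<phi> p) h)"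
      using sums_finite[of "{p}" "\<lambda>n. ?r n * L2ip (moment \<phi> n) h"] by simp
    then have "L2ip (szego \<phi> ?r) h = ?r p * L2ip (moment \<phi> p) h"
      by (rule sums_unique2[OF szego_pairing[OF \<phi> pr smooth_S3_continuous[OF Hpq_smooth[OF h]]]])
    also have "\<dots> = r p * L2ip \<phi> h"
    proof -
      have "of_nat (p + 1) \<noteq> (0::complex)" by (simp only: of_nat_eq_0_iff)
      then show ?thesis unfolding moment_pairing[OF \<phi> h] using vol_pos by simp
    qed
    finally show "L2ip (szego \<phi> ?r) h = r p * L2ip \<phi> h" .
  qed
qed

section \<open>The spaces \<open>D0\<close> and \<open>D0perp\<close>\<close>

lemma D0perp_smooth: "\<phi> \<in> D0perp \<Longrightarrow> smooth_S3 \<phi>"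
  by (simp add: D0perp_def Dspace_def)

lemma D0_smooth: "\<phi> \<in> D0 \<Longrightarrow> smooth_S3 \<phi>"
  by (simp add: D0_def Dspace_def)

lemma D0perpI:
  assumes "smooth_S3 \<phi>" "\<And>p q h. h \<in> Hpq p q \<Longrightarrow> q \<ge> 2 \<Longrightarrow> L2ip \<phi> h = 0"
  shows "\<phi> \<in> D0perp"
proof -
  have "q \<ge> 2" if "q \<notin> {0,1}" for q :: nat using that by auto
  then show ?thesis using assms by (auto simp: D0perp_def Dspace_def comp_zero_def simp del: insert_iff)
qed

lemma D0perpD: "\<phi> \<in> D0perp \<Longrightarrow> h \<in> Hpq p q \<Longrightarrow> q \<ge> 2 \<Longrightarrow> L2ip \<phi> h = 0"
proof -
  assume "\<phi> \<in> D0perp" "h \<in> Hpq p q" "q \<ge> 2"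
  moreover from \<open>q \<ge> 2\<close> have "q \<notin> {0,1}" by auto
  ultimately show ?thesis unfolding D0perp_def comp_zero_def by blast
qed

lemma D0I:
  assumes "smooth_S3 \<phi>" "\<And>p q h. h \<in> Hpq p q \<Longrightarrow> q \<le> 1 \<Longrightarrow> L2ip \<phi> h = 0"
  shows "\<phi> \<in> D0"
  using assms by (auto simp: D0_def Dspace_def comp_zero_def)

lemma D0D: "\<phi> \<in> D0 \<Longrightarrow> h \<in> Hpq p q \<Longrightarrow> q \<le> 1 \<Longrightarrow> L2ip \<phi> h = 0"
proof -
  assume "\<phi> \<in> D0" "h \<in> Hpq p q" "q \<le> 1"
  moreover from \<open>q \<le> 1\<close> have "q \<in> {0,1}" by auto
  ultimately show ?thesis unfolding D0_def comp_zero_def by blast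
qed

lemma Hpq_in_D0perp: "h \<in> Hpq p q \<Longrightarrow> q \<le> 1 \<Longrightarrow> h \<in> D0perp"
  by (rule D0perpI[OF Hpq_smooth Hpq_orthogonal])

lemma Hpq_in_D0: "h \<in> Hpq p q \<Longrightarrow> q \<ge> 2 \<Longrightarrow> h \<in> D0"
proof (rule D0I[OF Hpq_smooth])
  fix p' q' k assume "h \<in> Hpq p q" "2 \<le> q" "k \<in> Hpq p' q'" "q' \<le> 1"
  then have "L2ip k h = 0" by (intro Hpq_orthogonal)
  then show "L2ip h k = 0" by (subst L2ip_sym) simp
qed

lemma D0perp_infinite_dimensional:
  "\<exists>f :: nat \<Rightarrow> pt \<Rightarrow> complex. (\<forall>i<n. f i \<in> D0perp) \<and>
     (\<forall>c :: nat \<Rightarrow> complex. (\<forall>x\<in>S3. (\<Sum>i<n. c i * f i x) = 0) \<longrightarrow> (\<forall>i<n. c i = 0))"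
\<comment> \<open>The powers of z: orthogonal because their degrees differ, with nonzero norms by
  \<open>hmon_norm\<close>.\<close>
proof (intro exI[of _ "\<lambda>i. hmon i 0"] conjI allI impI)
  have H: "hmon i 0 \<in> Hpq i 0" for i
    using hpoly_in_Hpq[OF hpoly_BH0[OF BH_hmon[of i 0]]] by simp
  then show "hmon i 0 \<in> D0perp" for i by (rule Hpq_in_D0perp) simp
  fix c :: "nat \<Rightarrow> complex" and i
  assume z: "\<forall>x\<in>S3. (\<Sum>i<n. c i * hmon i 0 x) = 0" and i: "i < n"
  let ?s = "\<lambda>x. \<Sum>j<n. c j * hmon j 0 x"
  have cs: "continuous_on S3 ?s" by (intro continuous_intros continuous_hmon)
  have "L2ip ?s (hmon i 0) = L2ip (\<lambda>x. 0) (hmon i 0)"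
    by (rule L2ip_cong[OF _ refl cs continuous_hmon]) (use z in simp)
  then have "0 = L2ip ?s (hmon i 0)" by (simp add: L2ip_zero)
  also have "\<dots> = (\<Sum>j<n. c j * L2ip (hmon j 0) (hmon i 0))"
    by (subst L2ip_sum_left) (auto intro!: continuous_intros continuous_hmon simp: L2ip_cmult_left)
  also have "\<dots> = (\<Sum>j<n. if j = i then c i * L2ip (hmon i 0) (hmon i 0) else 0)"
    by (rule sum.cong) (use Hpq_orthogonal_degree[OF H H] in auto)
  also have "\<dots> = c i * L2ip (hmon i 0) (hmon i 0)" using i by simp
  finally have "c i * L2ip (hmon i 0) (hmon i 0) = 0" by simp
  moreover have "L2ip (hmon i 0) (hmon i 0) \<noteq> 0"
    using hmon_norm[of i 0] vol_pos by auto
  ultimately show "c i = 0" by simp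
qed

lemma L2ip_self_nonneg: "Re (L2ip f f) \<ge> 0"
proof -
  have e: "(\<lambda>x. indicator (ball 0 1) x *\<^sub>R hext (\<lambda>x. f x * cnj (f x)) x) =
    (\<lambda>x. complex_of_real (indicator (ball 0 1) x *\<^sub>R (norm (hext f x))\<^sup>2))"
    by (simp only: hext_def complex_norm_square[symmetric] scaleR_conv_of_real of_real_mult of_real_eq_id id_apply)
  show ?thesis
    unfolding L2ip_sint sint_def set_lebesgue_integral_def e integral_complex_of_real Re_complex_of_real
    by (rule Bochner_Integration.integral_nonneg) simp
qed

text \<open>The bound is used with \<open>g\<close> of arbitrarily small norm and fixed \<open>L2ip f g\<close>, which replaces the
  Cauchy-Schwarz inequality.\<close>

lemma L2ip_weak_Cauchy_Schwarz:
  assumes f: "continuous_on S3 f" and g: "continuous_on S3 g" and s: "s > 0" "s * Re (L2ip g g) \<le> 1"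
  shows "s * (norm (L2ip f g))\<^sup>2 \<le> Re (L2ip f f)"
proof -
  define a where "a = L2ip f g"
  define \<mu> where "\<mu> = of_real s * a"
  let ?d = "\<lambda>x. f x - \<mu> * g x"
  have gc: "continuous_on S3 (\<lambda>x. \<mu> * g x)" "continuous_on S3 ?d" by (intro continuous_intros f g)+
  have "L2ip ?d ?d = L2ip f f - cnj \<mu> * a - (\<mu> * cnj a - \<mu> * cnj \<mu> * L2ip g g)"
    unfolding L2ip_diff_left[OF f gc(1) gc(2)] L2ip_diff_right[OF f gc(1) f] L2ip_diff_right[OF f gc(1) gc(1)]
      L2ip_cmult_left L2ip_cmult_right
    using L2ip_sym[of g f] by (simp add: a_def algebra_simps)
  also have "\<dots> = L2ip f f - of_real (2 * s * (norm a)\<^sup>2) + of_real (s\<^sup>2 * (norm a)\<^sup>2) * L2ip g g"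
    unfolding \<mu>_def of_real_mult complex_norm_square by (simp add: power2_eq_square algebra_simps)
  finally have "Re (L2ip ?d ?d) = Re (L2ip f f) - 2 * s * (norm a)\<^sup>2 + s\<^sup>2 * (norm a)\<^sup>2 * Re (L2ip g g)"
    by (simp only: plus_complex.sel minus_complex.sel Re_complex_of_real times_complex.sel Im_complex_of_real)
  then have 1: "0 \<le> Re (L2ip f f) - 2 * s * (norm a)\<^sup>2 + s\<^sup>2 * (norm a)\<^sup>2 * Re (L2ip g g)"
    using L2ip_self_nonneg[of ?d] by simp
  have "s\<^sup>2 * (norm a)\<^sup>2 * Re (L2ip g g) = (s * (norm a)\<^sup>2) * (s * Re (L2ip g g))"
    by (simp only: power2_eq_square mult_ac)
  also have "\<dots> \<le> (s * (norm a)\<^sup>2) * 1"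
    using s by (intro mult_left_mono) auto
  finally show ?thesis using 1 unfolding a_def by linarith
qed

lemma hspan_orthogonal:
  assumes "hspan (\<lambda>q. q \<le> 1) f" "hspan (\<lambda>q. \<not> q \<le> 1) g"
  shows "L2ip g f = 0"
proof -
  have "L2ip g h = 0" if h: "h \<in> Hpq p q" "q \<le> 1" for h p q
  proof -
    have "L2ip h g = 0"
      by (rule L2ip_hspan_zero[OF smooth_S3_continuous[OF Hpq_smooth[OF h(1)]] _ assms(2)])
        (rule Hpq_orthogonal[OF h], auto)
    then show ?thesis by (subst L2ip_sym) simp
  qed
  then show ?thesis
    by (intro L2ip_hspan_zero[OF smooth_S3_continuous[OF hspan_smooth[OF assms(2)]] _ assms(1)])
qed

text \<open>Approximate \<psi> uniformly by a sum of \<open>f\<close> (q \<le> 1) and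
  \<open>g\<close> (q \<ge> 2). Both \<psi> and \<open>g\<close> are orthogonal to \<open>f\<close>,
  so by Pythagoras \<psi> - \<open>g\<close> is already small, while \<phi> does not see
  \<open>g\<close>.\<close>

lemma D0perp_orthogonal_D0:
  assumes \<phi>: "\<phi> \<in> D0perp" and \<psi>: "\<psi> \<in> D0"
  shows "L2ip \<phi> \<psi> = 0"
proof -
  note c\<phi> = smooth_S3_continuous[OF D0perp_smooth[OF \<phi>]] and c\<psi> = smooth_S3_continuous[OF D0_smooth[OF \<psi>]]
  have le: "s * (norm (L2ip \<phi> \<psi>))\<^sup>2 \<le> Re (L2ip \<phi> \<phi>)" if s: "s > 0" for s
  proof -
    \<comment> \<open>The uniform error that keeps the squared norm of the remainder below
      \<open>1 / s\<close>; afterwards \<open>s\<close> may be taken large.\<close>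
    define e where "e = sqrt (1 / (s * vol))"
    have e: "e > 0" "e * e * vol = 1 / s"
      using s vol_pos by (simp_all add: e_def)
    obtain h where h: "hspan_all h" "\<And>x. x \<in> S3 \<Longrightarrow> norm (\<psi> x - h x) < e"
      using hspan_dense[OF c\<psi> e(1)] by blast
    obtain f g where fg: "hspan (\<lambda>q. q \<le> 1) f" "hspan (\<lambda>q. \<not> q \<le> 1) g" "h = (\<lambda>x. f x + g x)"
      using hspan_split[OF h(1), of "\<lambda>q. q \<le> 1"] by blast
    note cf = smooth_S3_continuous[OF hspan_smooth[OF fg(1)]] and cg = smooth_S3_continuous[OF hspan_smooth[OF fg(2)]]
    let ?d = "\<lambda>x. \<psi> x - g x"
    have cd: "continuous_on S3 ?d" by (intro continuous_intros c\<psi> cg)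
    have "L2ip \<phi> g = 0" by (rule L2ip_hspan_zero[OF c\<phi> _ fg(2)]) (use D0perpD[OF \<phi>] in auto)
    then have \<phi>d: "L2ip \<phi> ?d = L2ip \<phi> \<psi>" by (simp add: L2ip_diff_right c\<psi> cg c\<phi>)
    have "L2ip \<psi> f = 0" by (rule L2ip_hspan_zero[OF c\<psi> _ fg(1)]) (use D0D[OF \<psi>] in auto)
    then have df: "L2ip ?d f = 0" using hspan_orthogonal[OF fg(1,2)] by (simp add: L2ip_diff_left c\<psi> cg cf)
    then have fd: "L2ip f ?d = 0" by (subst L2ip_sym) simp
    have cdf: "continuous_on S3 (\<lambda>x. ?d x - f x)" by (intro continuous_intros cd cf)
    have "L2ip (\<lambda>x. ?d x - f x) (\<lambda>x. ?d x - f x) = L2ip ?d ?d + L2ip f f"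
      by (simp add: L2ip_diff_left[OF cd cf cdf] L2ip_diff_right[OF cd cf cd] L2ip_diff_right[OF cd cf cf] df fd)
    moreover have "norm (L2ip (\<lambda>x. ?d x - f x) (\<lambda>x. ?d x - f x)) \<le> e * e * vol"
      by (rule L2ip_norm_le[OF cdf cdf]) (use h(2) e(1) in \<open>auto simp: fg(3) algebra_simps intro: less_imp_le\<close>)
    ultimately have "Re (L2ip ?d ?d) + Re (L2ip f f) \<le> 1 / s"
      using complex_Re_le_cmod[of "L2ip ?d ?d + L2ip f f"] e(2) by simp
    then have "Re (L2ip ?d ?d) \<le> 1 / s" using L2ip_self_nonneg[of f] by linarith
    then have "s * Re (L2ip ?d ?d) \<le> 1" using s by (simp add: field_simps)
    from L2ip_weak_Cauchy_Schwarz[OF c\<phi> cd s this] show ?thesis unfolding \<phi>d .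
  qed
  show ?thesis
  proof (rule ccontr)
    assume nz: "L2ip \<phi> \<psi> \<noteq> 0"
    define n where "n = (norm (L2ip \<phi> \<psi>))\<^sup>2"
    have n: "n > 0" using nz by (simp add: n_def)
    \<comment> \<open>With this value for \<open>s\<close> the left side of \<open>le\<close>
      exceeds the right side by 1.\<close>
    have "(Re (L2ip \<phi> \<phi>) + 1) / n > 0"
      using n L2ip_self_nonneg[of \<phi>] by (intro divide_pos_pos) linarith+
    from le[OF this] have "(Re (L2ip \<phi> \<phi>) + 1) / n * n \<le> Re (L2ip \<phi> \<phi>)"
      unfolding n_def .
    then show False using n by simp
  qed
qed

lemma D0perp_eq_orthogonal_complement: "D0perp = {\<phi>\<in>Dspace. \<forall>\<psi>\<in>D0. L2ip \<phi> \<psi> = 0}"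
proof
  show "D0perp \<subseteq> {\<phi>\<in>Dspace. \<forall>\<psi>\<in>D0. L2ip \<phi> \<psi> = 0}"
    using D0perp_orthogonal_D0 by (auto simp: D0perp_def)
  show "{\<phi>\<in>Dspace. \<forall>\<psi>\<in>D0. L2ip \<phi> \<psi> = 0} \<subseteq> D0perp"
    using Hpq_in_D0 by (auto intro!: D0perpI simp: Dspace_def)
qed

lemma D0_D0perp_decomposition:
  assumes "\<phi> \<in> Dspace"
  shows "\<exists>\<psi>\<in>D0. \<exists>\<xi>\<in>D0perp. \<forall>x\<in>S3. \<phi> x = \<psi> x + \<xi> x"
proof -
  have \<phi>: "smooth_S3 \<phi>" using assms by (simp add: Dspace_def)
  \<comment> \<open>The weight is indexed by the image: for \<open>h\<close> in
    \<open>Hpq p 1\<close>, \<open>Z1b h\<close> has first index \<open>Suc p\<close> and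
    \<open>Z1 (Z1b h)\<close> is -(p + 1) times \<open>h\<close>. At index 0, which is no successor,
    the weight is 0 by the division convention.\<close>
  have r: "poly_bounded (\<lambda>p. - 1 / of_nat p)"
    unfolding poly_bounded_def
  proof (rule exI[of _ 1], rule exI[of _ 0], rule allI)
    fix p :: nat
    show "norm (- 1 / of_nat p :: complex) \<le> 1 * (real p + 1) ^ 0"
      by (cases "p = 0") (auto simp: norm_divide divide_le_eq)
  qed
  obtain u where u: "smooth_S3 u" "\<And>p q h. h \<in> Hpq p q \<Longrightarrow> q \<ge> 1 \<Longrightarrow> L2ip u h = 0"
    "\<And>p h. h \<in> Hpq p 0 \<Longrightarrow> L2ip u h = L2ip \<phi> h"
    using szego_projection[OF \<phi> poly_bounded_const[of 1]] by auto
  obtain g where g: "smooth_S3 g" "\<And>p q h. h \<in> Hpq p q \<Longrightarrow> q \<ge> 1 \<Longrightarrow> L2ip g h = 0"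
    "\<And>p h. h \<in> Hpq p 0 \<Longrightarrow> L2ip g h = (- 1 / of_nat p) * L2ip (Z1b \<phi>) h"
    using szego_projection[OF smooth_S3_fields(2)[OF \<phi>] r] by blast
  let ?\<xi> = "\<lambda>x. u x + Z1 g x"
  have sg: "smooth_S3 (Z1 g)" by (rule smooth_S3_fields(1)[OF g(1)])
  have s\<xi>: "smooth_S3 ?\<xi>" by (rule smooth_S3_add[OF u(1) sg])
  \<comment> \<open>The two parts of \<open>?\<xi>\<close> respond to separate components:
    \<open>u\<close> only to q = 0, and \<open>g\<close> only through \<open>Z1b h\<close> with
    second index 0, that is q = 1, since \<open>Z1b h\<close> vanishes for q = 0.\<close>
  have pair: "L2ip ?\<xi> h = L2ip u h - L2ip g (Z1b h)" if "h \<in> Hpq p q" for p q h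
    using L2ip_add_left[OF smooth_S3_continuous[OF u(1)] smooth_S3_continuous[OF sg]
        smooth_S3_continuous[OF Hpq_smooth[OF that]]] L2ip_adjoint(1)[OF g(1) Hpq_smooth[OF that]] by simp
  have "?\<xi> \<in> D0perp"
  proof (rule D0perpI[OF s\<xi>])
    fix p q h assume h: "h \<in> Hpq p q" "2 \<le> (q::nat)"
    then show "L2ip ?\<xi> h = 0"
      unfolding pair[OF h(1)] using u(2)[OF h(1)] g(2)[OF Hpq_Z1b[OF h(1)]] by simp
  qed
  moreover have "(\<lambda>x. \<phi> x - ?\<xi> x) \<in> D0"
  proof (rule D0I)
    show "smooth_S3 (\<lambda>x. \<phi> x - ?\<xi> x)" by (rule smooth_S3_diff[OF \<phi> s\<xi>])
    fix p q h assume h: "h \<in> Hpq p q" "(q::nat) \<le> 1"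
    note sh = Hpq_smooth[OF h(1)]
    have "L2ip ?\<xi> h = L2ip \<phi> h"
    proof (cases "q = 0")
      case True
      then have "h \<in> Hpq p 0" using h by simp
      have "L2ip g (Z1b h) = L2ip g (\<lambda>x. 0)"
        by (rule L2ip_cong[OF refl Hpq_Z1b_zero[OF \<open>h \<in> Hpq p 0\<close>]])
          (intro smooth_S3_continuous smooth_S3_fields g(1) sh | assumption)+
      then show ?thesis unfolding pair[OF h(1)] using u(3)[OF \<open>h \<in> Hpq p 0\<close>] by (simp add: L2ip_zero)
    next
      case False
      then have q: "q = 1" using h(2) by simp
      have k: "Z1b h \<in> Hpq (Suc p) 0" using Hpq_Z1b[OF h(1)] q by simp
      have p1: "of_nat (Suc p) \<noteq> (0::complex)" by (simp only: of_nat_eq_0_iff)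
      have "L2ip (Z1b \<phi>) (Z1b h) = - L2ip \<phi> (Z1 (Z1b h))"
        by (rule L2ip_adjoint(2)[OF \<phi> smooth_S3_fields(2)[OF sh]])
      also have "L2ip \<phi> (Z1 (Z1b h)) = L2ip \<phi> (\<lambda>x. - of_nat (Suc p) * h x)"
      proof (rule L2ip_cong[OF refl])
        show "Z1 (Z1b h) x = - of_nat (Suc p) * h x" if "x \<in> S3" for x
          using Hpq_Z1_Z1b[OF h(1) that] q by simp
      qed (intro smooth_S3_continuous smooth_S3_fields \<phi> sh)+
      also have "\<dots> = - of_nat (Suc p) * L2ip \<phi> h" by (subst L2ip_cmult_right) simp
      finally have "L2ip g (Z1b h) = - L2ip \<phi> h"
        unfolding g(3)[OF k] using p1 by (simp add: field_simps del: of_nat_Suc)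
      then show ?thesis unfolding pair[OF h(1)] using u(2)[OF h(1)] q by simp
    qed
    then show "L2ip (\<lambda>x. \<phi> x - ?\<xi> x) h = 0"
      by (subst L2ip_diff_left) (auto intro: smooth_S3_continuous \<phi> s\<xi> sh)
  qed
  ultimately show ?thesis by (intro bexI[of _ "\<lambda>x. \<phi> x - ?\<xi> x"] bexI[of _ ?\<xi>]) auto
qed

section \<open>The linearized operators on \<open>D0perp\<close>\<close>

lemma L2ip_Tp:
  assumes f: "smooth_S3 f" and k: "k \<in> Hpq p q"
  shows "L2ip (Tp f) k = \<i> * (of_nat p - of_nat q + 4) * L2ip f k"
proof -
  note sk = Hpq_smooth[OF k] and sf = smooth_S3_fields(3)[OF f]
  have "L2ip f (Treeb k) = L2ip f (\<lambda>x. \<i> * (of_nat p - of_nat q) * k x)"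
    by (rule L2ip_cong[OF refl Hpq_Treeb[OF k]]) (intro smooth_S3_continuous smooth_S3_fields f sk | assumption)+
  then have "L2ip (Treeb f) k = \<i> * (of_nat p - of_nat q) * L2ip f k"
    unfolding L2ip_adjoint(3)[OF f sk] L2ip_cmult_right by simp
  moreover have "L2ip (Tp f) k = L2ip (Treeb f) k + 4 * \<i> * L2ip f k"
    unfolding Tp_def[abs_def]
    by (subst L2ip_add_left) (auto intro!: continuous_intros intro: smooth_S3_continuous f sk sf simp: L2ip_cmult_left)
  ultimately show ?thesis by (simp add: algebra_simps)
qed

text \<open>The adjoint of every complex-linear term maps \<open>Hpq p q\<close> into itself, so
  these terms preserve the vanishing of components with q \<ge> 2; only the antilinear term changes
  the bidegree.\<close>

lemma L2ip_DQ_zero: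
  assumes \<phi>: "\<phi> \<in> D0perp" and k: "k \<in> Hpq p q" and q: "q \<ge> 2"
  shows "L2ip (DQ \<phi>) k = 0"
proof -
  note s = D0perp_smooth[OF \<phi>] and sk = Hpq_smooth[OF k]
  note sc = smooth_S3_cnj[OF s]
  note smf = smooth_S3_fields
  have 1: "L2ip (Z1 (Z1 (Z1b (Z1b \<phi>)))) k = 0"
  proof -
    have "Z1 (Z1 (Z1b (Z1b k))) \<in> Hpq (Suc (Suc p) - 1 - 1) (Suc (Suc (q - 1 - 1)))"
      by (intro Hpq_Z1 Hpq_Z1b k)
    \<comment> \<open>As \<open>q \<ge> 2\<close>, lowering twice is not truncated, and raising
      twice returns to the original indices.\<close>
    moreover have "Suc (Suc p) - 1 - 1 = p" "Suc (Suc (q - 1 - 1)) = q" using q by auto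
    ultimately have "Z1 (Z1 (Z1b (Z1b k))) \<in> Hpq p q" by (simp only:)
    then have "L2ip \<phi> (Z1 (Z1 (Z1b (Z1b k)))) = 0" using D0perpD[OF \<phi> _ q] by blast
    then show ?thesis by (simp add: L2ip_Z1_Z1 s sk smf)
  qed
  \<comment> \<open>After conjugation the second index is p + 4, so the pairing vanishes even where
    \<open>q < 4\<close> truncates the first.\<close>
  have 2: "L2ip (Z1 (Z1 (Z1 (Z1 (\<lambda>y. cnj (\<phi> y)))))) k = 0"
  proof -
    have "(\<lambda>x. cnj (Z1b (Z1b (Z1b (Z1b k))) x)) \<in> Hpq (q - 1 - 1 - 1 - 1) (Suc (Suc (Suc (Suc p))))"
      by (intro Hpq_cnj Hpq_Z1b k)
    then have "L2ip \<phi> (\<lambda>x. cnj (Z1b (Z1b (Z1b (Z1b k))) x)) = 0" by (rule D0perpD[OF \<phi>]) simp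
    then show ?thesis by (simp add: L2ip_Z1_Z1 sc sk smf L2ip_cnj)
  qed
  have T: "L2ip (Tp \<phi>) h = 0" "L2ip (Tp (Tp \<phi>)) h = 0" if "h \<in> Hpq p q" for h
    using L2ip_Tp[OF s that] L2ip_Tp[OF smf(4)[OF s] that] D0perpD[OF \<phi> that q] by simp_all
  have 4: "L2ip (Z1 (Z1b (Tp \<phi>))) k = 0"
  proof -
    have "Z1 (Z1b k) \<in> Hpq (Suc p - 1) (Suc (q - 1))" by (intro Hpq_Z1 Hpq_Z1b k)
    then have "Z1 (Z1b k) \<in> Hpq p q" using q by simp
    then show ?thesis using T(1) by (simp add: L2ip_adjoint s sk smf)
  qed
  note c = smooth_S3_continuous
  have DQ: "DQ \<phi> = (\<lambda>x. 1/6 * Z1 (Z1 (Z1b (Z1b \<phi>))) x + 1/6 * Z1 (Z1 (Z1 (Z1 (\<lambda>y. cnj (\<phi> y))))) x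
     - Tp (Tp \<phi>) x - (2 * \<i> / 3) * Z1 (Z1b (Tp \<phi>)) x + \<i> * Tp \<phi> x)"
    by (simp add: DQ_def[abs_def])
  have "L2ip (DQ \<phi>) k = 1/6 * L2ip (Z1 (Z1 (Z1b (Z1b \<phi>)))) k + 1/6 * L2ip (Z1 (Z1 (Z1 (Z1 (\<lambda>y. cnj (\<phi> y)))))) k
     - L2ip (Tp (Tp \<phi>)) k - (2 * \<i> / 3) * L2ip (Z1 (Z1b (Tp \<phi>))) k + \<i> * L2ip (Tp \<phi>) k"
    unfolding DQ L2ip_cmult_left[symmetric]
    by (subst L2ip_add_left L2ip_diff_left;
        (intro c smooth_S3_const smooth_S3_mult smooth_S3_add smooth_S3_diff smf s sc sk)?)+ (rule refl)
  then show ?thesis using 1 2 4 T[OF k] by simp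
qed

text \<open>Moving \<open>Z1b\<close> twice across raises the second index of the test harmonic to
  at least 2, where \<open>DQ \<phi>\<close> has no component.\<close>

lemma DO_zero:
  assumes \<phi>: "\<phi> \<in> D0perp" and x: "x \<in> S3"
  shows "DO \<phi> x = 0"
proof (rule completeness[OF _ _ x])
  have sD: "smooth_S3 (DQ \<phi>)" by (rule smooth_S3_DQ[OF D0perp_smooth[OF \<phi>]])
  show "continuous_on S3 (DO \<phi>)"
    unfolding DO_def by (intro smooth_S3_continuous smooth_S3_fields sD)
  fix p q h assume h: "h \<in> Hpq p q"
  have "L2ip (DO \<phi>) h = L2ip (DQ \<phi>) (Z1 (Z1 h))"
    unfolding DO_def by (simp add: L2ip_Z1_Z1 sD Hpq_smooth[OF h])
  also have "\<dots> = 0"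
    by (rule L2ip_DQ_zero[OF \<phi> Hpq_Z1[OF Hpq_Z1[OF h]]]) simp
  finally show "L2ip (DO \<phi>) h = 0" .
qed

lemma D0_D0perp_disjoint:
  assumes "\<phi> \<in> D0" "\<phi> \<in> D0perp" "x \<in> S3"
  shows "\<phi> x = 0"
  by (rule L2ip_zero_imp_zero[OF smooth_S3_continuous[OF D0_smooth[OF assms(1)]]
        D0perp_orthogonal_D0[OF assms(2,1)] assms(3)])

text \<open>The adjoint, \<open>Z1b\<close> applied twice, kills harmonics with q \<le> 1. This
  places the trivial deformations in \<open>D0\<close>, which meets \<open>D0perp\<close> only in
  zero.\<close>

lemma Z1_Z1_in_D0:
  assumes "smooth_S3 f"
  shows "Z1 (Z1 f) \<in> D0"
proof (rule D0I)
  show s: "smooth_S3 (Z1 (Z1 f))" by (intro smooth_S3_fields assms)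
  fix p q h assume h: "h \<in> Hpq p q" "(q::nat) \<le> 1"
  note sh = Hpq_smooth[OF h(1)]
  have "L2ip (Z1 (Z1 f)) h = L2ip f (Z1b (Z1b h))" by (simp add: L2ip_Z1_Z1 assms sh)
  also have "\<dots> = L2ip f (\<lambda>x. 0)"
    by (rule L2ip_cong[OF refl Z1b_Z1b_zero[OF h]]) (intro smooth_S3_continuous smooth_S3_fields assms sh | assumption)+
  finally show "L2ip (Z1 (Z1 f)) h = 0" by (simp add: L2ip_zero)
qed

lemma D0_cong:
  assumes "\<phi> \<in> D0" "\<And>x. x \<in> S3 \<Longrightarrow> \<phi> x = \<psi> x"
  shows "\<psi> \<in> D0"
proof (rule D0I)
  show "smooth_S3 \<psi>" using smooth_S3_cong[of \<phi> \<psi>, OF assms(2)] D0_smooth[OF assms(1)] by simp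
  fix p q h assume h: "h \<in> Hpq p q" "(q::nat) \<le> 1"
  have "L2ip \<phi> h = L2ip \<psi> h"
    by (rule L2ip_cong[OF assms(2) refl]) (intro smooth_S3_continuous D0_smooth[OF assms(1)] Hpq_smooth[OF h(1)] | assumption)+
  then show "L2ip \<psi> h = 0" using D0D[OF assms(1) h] by simp
qed

lemma D0_cmult: "\<phi> \<in> D0 \<Longrightarrow> (\<lambda>x. c * \<phi> x) \<in> D0"
  by (rule D0I) (auto intro: smooth_S3_mult smooth_S3_const D0_smooth simp: L2ip_cmult_left D0D)

lemma D0perp_trivial_deformation:
  assumes "\<phi> \<in> D0perp" "smooth_S3 f" "\<And>x. x \<in> S3 \<Longrightarrow> \<phi> x = \<i> * Z1 (Z1 f) x" "x \<in> S3"
  shows "\<phi> x = 0"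
proof (rule D0_D0perp_disjoint[OF _ assms(1,4)])
  show "\<phi> \<in> D0"
    by (rule D0_cong[OF D0_cmult[OF Z1_Z1_in_D0[OF assms(2)], of \<i>]]) (simp add: assms(3))
qed

theorem theorem1p1:
  shows "(\<forall>n. \<exists>f :: nat \<Rightarrow> pt \<Rightarrow> complex. (\<forall>i<n. f i \<in> D0perp) \<and>
            (\<forall>c :: nat \<Rightarrow> complex. (\<forall>x\<in>S3. (\<Sum>i<n. c i * f i x) = 0) \<longrightarrow> (\<forall>i<n. c i = 0)))
    \<and> (D0perp = {\<phi>\<in>Dspace. \<forall>\<psi>\<in>D0. L2ip \<phi> \<psi> = 0})
    \<and> (\<forall>\<phi>\<in>Dspace. \<exists>\<psi>\<in>D0. \<exists>\<xi>\<in>D0perp. \<forall>x\<in>S3. \<phi> x = \<psi> x + \<xi> x)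
    \<and> (\<forall>\<phi>\<in>D0 \<inter> D0perp. \<forall>x\<in>S3. \<phi> x = 0)
    \<and> (\<forall>\<phi>\<in>D0perp. \<forall>x\<in>S3. DO \<phi> x = 0)
    \<and> (\<forall>\<phi>\<in>D0perp. \<forall>f :: pt \<Rightarrow> real.
            smooth_S3 (\<lambda>y. complex_of_real (f y)) \<and>
            (\<forall>x\<in>S3. \<phi> x = \<i> * Z1 (Z1 (\<lambda>y. complex_of_real (f y))) x)
            \<longrightarrow> (\<forall>x\<in>S3. \<phi> x = 0))"
proof (intro conjI allI ballI impI)
  show "\<exists>f :: nat \<Rightarrow> pt \<Rightarrow> complex. (\<forall>i<n. f i \<in> D0perp) \<and>
      (\<forall>c :: nat \<Rightarrow> complex. (\<forall>x\<in>S3. (\<Sum>i<n. c i * f i x) = 0) \<longrightarrow> (\<forall>i<n. c i = 0))" for n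
    by (rule D0perp_infinite_dimensional)
  show "D0perp = {\<phi>\<in>Dspace. \<forall>\<psi>\<in>D0. L2ip \<phi> \<psi> = 0}"
    by (rule D0perp_eq_orthogonal_complement)
  show "\<exists>\<psi>\<in>D0. \<exists>\<xi>\<in>D0perp. \<forall>x\<in>S3. \<phi> x = \<psi> x + \<xi> x" if "\<phi> \<in> Dspace" for \<phi>
    using that by (rule D0_D0perp_decomposition)
  show "\<phi> x = 0" if "\<phi> \<in> D0 \<inter> D0perp" "x \<in> S3" for \<phi> x
    using that D0_D0perp_disjoint by blast
  show "DO \<phi> x = 0" if "\<phi> \<in> D0perp" "x \<in> S3" for \<phi> x
    using that by (rule DO_zero)
next
  fix \<phi> and f :: "pt \<Rightarrow> real" and x
  assume *: "\<phi> \<in> D0perp" "x \<in> S3" "smooth_S3 (\<lambda>y. complex_of_real (f y)) \<and>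
    (\<forall>x\<in>S3. \<phi> x = \<i> * Z1 (Z1 (\<lambda>y. complex_of_real (f y))) x)"
  show "\<phi> x = 0"
    by (rule D0perp_trivial_deformation[OF *(1) _ _ *(2)]) (use *(3) in blast)+
qed

end
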